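(* For $0.42\le\alpha\le0.5$ let $$|\psi_1\rangle=\sqrt{\alpha}\,|01\rangle-\sqrt{1-\alpha}\,|10\rangle,\qquad |\psi_2\rangle=\sqrt{\alpha}\,|02\rangle-\sqrt{1-\alpha}\,|20\rangle$$ in $\mathbb{C}^3\otimes\mathbb{C}^3$, and let $\rho^{(\alpha)}=\frac12(|\psi_1\rangle\langle\psi_1|+|\psi_2\rangle\langle\psi_2|)$. Then $$E_D(\rho^{(\alpha)})\le E_W(\rho^{(\alpha)})<E_\eta(\rho^{(\alpha)})\le E_C(\rho^{(\alpha)}),$$ where $E_D$ and $E_C$ are the distillable entanglement and the entanglement cost under PPT operations.
   Context: $\{|0\rangle,|1\rangle,|2\rangle\}$ is the standard orthonormal basis of $\mathbb{C}^3$. All Hilbert spaces are finite-dimensional and $\log=\log_2$. A state is a positive semidefinite operator of trace one. $T_B$ denotes partial transpose on the second (Bob's) system: $(|i_Aj_B\rangle\langle k_Al_B|)^{T_B}=|i_Al_B\rangle\langle k_Aj_B|$. For tensor powers, the bipartition is all of Alice's systems versus all of Bob's systems. $\|\cdot\|_1$ is the trace norm and $\|\cdot\|_\infty$ the operator norm. For a state $\rho$ on $A\otimes B$ with $P$ the orthogonal projection onto the support of $\rho$, $$E_\eta(\rho)=\max\{-\log\|Y^{T_B}\|_\infty:\ Y \text{ Hermitian on }A\otimes B,\ -Y\le P^{T_B}\le Y\},$$ $$E_W(\rho)=\min\{\log\|X^{T_B}\|_1:\ X \text{ Hermitian on }A\otimes B,\ X\ge\rho\}.$$ PPT operations: a CPTP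 map $\Lambda:\mathcal{L}(A\otimes B)\to\mathcal{L}(A'\otimes B')$ is a PPT operation if $T_{B'}\circ\Lambda\circ T_B$ is completely positive. Let $\Phi=|\phi\rangle\langle\phi|$, $|\phi\rangle=\frac1{\sqrt2}(|00\rangle+|11\rangle)$. Then $$E_D(\rho)=\sup\Big\{r\ge0:\lim_{n\to\infty}\inf_{\Lambda\text{ PPT operation}}\|\Lambda(\rho^{\otimes n})-\Phi^{\otimes\lfloor rn\rfloor}\|_1=0\Big\},$$ $$E_C(\rho)=\inf\Big\{r\ge0:\lim_{n\to\infty}\inf_{\Lambda\text{ PPT operation}}\|\rho^{\otimes n}-\Lambda(\Phi^{\otimes\lfloor rn\rfloor})\|_1=0\Big\}.$$ *)

theory Defs
  imports
    Complex_Main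
    "HOL-Library.Extended_Real"
    "HOL-Computational_Algebra.Polynomial"
    "Jordan_Normal_Form.Matrix"
    "Jordan_Normal_Form.Matrix_Kernel"
    "Jordan_Normal_Form.Char_Poly"
    "Jordan_Normal_Form.Schur_Decomposition"
begin

section \<open>Operators on finite-dimensional Hilbert spaces\<close>

definition mat_trace :: "complex mat \<Rightarrow> complex" where
  "mat_trace A = (\<Sum>i<dim_row A. A $$ (i, i))"

definition hermitian :: "nat \<Rightarrow> complex mat \<Rightarrow> bool" where
  "hermitian d A \<longleftrightarrow> A \<in> carrier_mat d d \<and> mat_adjoint A = A"

definition psd :: "nat \<Rightarrow> complex mat \<Rightarrow> bool" where
  "psd d A \<longleftrightarrow> hermitian d A \<and> (\<forall>v \<in> carrier_vec d. 0 \<le> Re ((A *\<^sub>v v) \<bullet>c v))"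

definition loewner_le :: "nat \<Rightarrow> complex mat \<Rightarrow> complex mat \<Rightarrow> bool" where
  "loewner_le d A B \<longleftrightarrow> A \<in> carrier_mat d d \<and> B \<in> carrier_mat d d \<and> psd d (B - A)"

text \<open>The sum of the singular values, with multiplicity.\<close>

definition trace_norm :: "complex mat \<Rightarrow> real" where
  "trace_norm A = (\<Sum>x \<in># proots (char_poly (mat_adjoint A * A)). sqrt (Re x))"

definition vnorm :: "complex vec \<Rightarrow> real" where
  "vnorm v = sqrt (Re (v \<bullet>c v))"

definition op_norm :: "complex mat \<Rightarrow> real" where
  "op_norm A = (SUP v \<in> {v \<in> carrier_vec (dim_col A). vnorm v \<le> 1}. vnorm (A *\<^sub>v v))"

text \<open>The support of an operator is the orthogonal complement of its kernel.\<close>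

definition supp :: "nat \<Rightarrow> complex mat \<Rightarrow> complex vec set" where
  "supp d A = {v \<in> carrier_vec d. \<forall>w \<in> mat_kernel A. v \<bullet>c w = 0}"

definition orth_proj :: "nat \<Rightarrow> complex vec set \<Rightarrow> complex mat" where
  "orth_proj d S = (THE P. P \<in> carrier_mat d d \<and>
     (\<forall>v \<in> carrier_vec d. P *\<^sub>v v \<in> S \<and> (\<forall>w \<in> S. (v - P *\<^sub>v v) \<bullet>c w = 0)))"

section \<open>Bipartite operators\<close>

text \<open>
  The basis vector \<open>|a\<rangle> \<otimes> |b\<rangle>\<close> of a bipartite space with local dimensions \<open>dA\<close>, \<open>dB\<close>
  has index \<open>a * dB + b\<close>. The matrix \<open>bmat dA dB f\<close> has the entry \<open>f a b a' b'\<close> in the row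
  of \<open>|a b\<rangle>\<close> and the column of \<open>|a' b'\<rangle>\<close>, and \<open>bentry\<close> reads this entry off.
\<close>

definition bmat :: "nat \<Rightarrow> nat \<Rightarrow> (nat \<Rightarrow> nat \<Rightarrow> nat \<Rightarrow> nat \<Rightarrow> complex) \<Rightarrow> complex mat" where
  "bmat dA dB f = mat (dA * dB) (dA * dB)
     (\<lambda>(r, c). f (r div dB) (r mod dB) (c div dB) (c mod dB))"

definition bentry :: "nat \<Rightarrow> complex mat \<Rightarrow> nat \<Rightarrow> nat \<Rightarrow> nat \<Rightarrow> nat \<Rightarrow> complex" where
  "bentry dB M a b a' b' = M $$ (a * dB + b, a' * dB + b')"

definition ptranspose :: "nat \<Rightarrow> nat \<Rightarrow> complex mat \<Rightarrow> complex mat" where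
  "ptranspose dA dB M = bmat dA dB (\<lambda>a b a' b'. bentry dB M a b' a' b)"

text \<open>
  The tensor product of an operator on \<open>A \<otimes> B\<close> and one on \<open>A' \<otimes> B'\<close>, regrouped as
  an operator on the bipartite space \<open>(A \<otimes> A') \<otimes> (B \<otimes> B')\<close>.
\<close>

definition btensor ::
    "nat \<Rightarrow> nat \<Rightarrow> nat \<Rightarrow> nat \<Rightarrow> complex mat \<Rightarrow> complex mat \<Rightarrow> complex mat" where
  "btensor dA dB dA' dB' M N = bmat (dA * dA') (dB * dB')
     (\<lambda>i j k l. bentry dB M (i div dA') (j div dB') (k div dA') (l div dB') *
                bentry dB' N (i mod dA') (j mod dB') (k mod dA') (l mod dB'))"

text \<open>An operator on a bipartite space with local dimensions \<open>dA ^ n\<close>, \<open>dB ^ n\<close>.\<close>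

primrec btensor_power :: "nat \<Rightarrow> nat \<Rightarrow> complex mat \<Rightarrow> nat \<Rightarrow> complex mat" where
  "btensor_power dA dB M 0 = 1\<^sub>m 1"
| "btensor_power dA dB M (Suc n) =
     btensor dA dB (dA ^ n) (dB ^ n) M (btensor_power dA dB M n)"

section \<open>Quantum operations\<close>

text \<open>
  Maps on operators are functions on all matrices, of which only the values on
  \<open>carrier_mat d d\<close> matter.
\<close>

definition linear_op_map :: "nat \<Rightarrow> nat \<Rightarrow> (complex mat \<Rightarrow> complex mat) \<Rightarrow> bool" where
  "linear_op_map d d' L \<longleftrightarrow>
     (\<forall>X \<in> carrier_mat d d. L X \<in> carrier_mat d' d') \<and>
     (\<forall>X \<in> carrier_mat d d. \<forall>Y \<in> carrier_mat d d. L (X + Y) = L X + L Y) \<and>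
     (\<forall>c. \<forall>X \<in> carrier_mat d d. L (c \<cdot>\<^sub>m X) = c \<cdot>\<^sub>m L X)"

text \<open>
  The map \<open>id \<otimes> L\<close> with an ancilla of dimension \<open>k\<close>: apply \<open>L\<close> to each of the
  \<open>k * k\<close> blocks of size \<open>d\<close>.
\<close>

definition ampliation ::
    "nat \<Rightarrow> nat \<Rightarrow> nat \<Rightarrow> (complex mat \<Rightarrow> complex mat) \<Rightarrow> complex mat \<Rightarrow> complex mat" where
  "ampliation k d d' L M =
     bmat k d' (\<lambda>i x j y. L (mat d d (\<lambda>(u, v). bentry d M i u j v)) $$ (x, y))"

definition completely_positive :: "nat \<Rightarrow> nat \<Rightarrow> (complex mat \<Rightarrow> complex mat) \<Rightarrow> bool" where
  "completely_positive d d' L \<longleftrightarrow> linear_op_map d d' L \<and>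
     (\<forall>k M. psd (k * d) M \<longrightarrow> psd (k * d') (ampliation k d d' L M))"

definition cptp :: "nat \<Rightarrow> nat \<Rightarrow> (complex mat \<Rightarrow> complex mat) \<Rightarrow> bool" where
  "cptp d d' L \<longleftrightarrow> completely_positive d d' L \<and>
     (\<forall>X \<in> carrier_mat d d. mat_trace (L X) = mat_trace X)"

definition ppt_operation ::
    "nat \<Rightarrow> nat \<Rightarrow> nat \<Rightarrow> nat \<Rightarrow> (complex mat \<Rightarrow> complex mat) \<Rightarrow> bool" where
  "ppt_operation dA dB dA' dB' L \<longleftrightarrow> cptp (dA * dB) (dA' * dB') L \<and>
     completely_positive (dA * dB) (dA' * dB') (ptranspose dA' dB' \<circ> L \<circ> ptranspose dA dB)"

section \<open>Vectors and pure states\<close>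

definition ket2 :: "nat \<Rightarrow> nat \<Rightarrow> nat \<Rightarrow> nat \<Rightarrow> complex vec" where
  "ket2 dA dB a b = unit_vec (dA * dB) (a * dB + b)"

definition proj :: "complex vec \<Rightarrow> complex mat" where
  "proj v = mat (dim_vec v) (dim_vec v) (\<lambda>(i, j). v $ i * cnj (v $ j))"

definition max_entangled :: "complex mat" where
  "max_entangled =
     proj (complex_of_real (1 / sqrt 2) \<cdot>\<^sub>v (ket2 2 2 0 0 + ket2 2 2 1 1))"

section \<open>Entanglement measures\<close>

text \<open>
  All measures are intended for a state \<open>\<rho>\<close> on a bipartite space with local dimensions
  \<open>dA\<close>, \<open>dB\<close>. For a state, the maximum and the minimum in the first two definitions are
  attained, and the arguments of the logarithm are positive.
\<close>

definition E_eta :: "nat \<Rightarrow> nat \<Rightarrow> complex mat \<Rightarrow> real" where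
  "E_eta dA dB \<rho> =
     (let d = dA * dB; Q = ptranspose dA dB (orth_proj d (supp d \<rho>))
      in Sup {- log 2 (op_norm (ptranspose dA dB Y)) | Y.
           hermitian d Y \<and> loewner_le d (- Y) Q \<and> loewner_le d Q Y})"

definition E_W :: "nat \<Rightarrow> nat \<Rightarrow> complex mat \<Rightarrow> real" where
  "E_W dA dB \<rho> =
     Inf {log 2 (trace_norm (ptranspose dA dB X)) | X.
       hermitian (dA * dB) X \<and> loewner_le (dA * dB) \<rho> X}"

text \<open>
  The rates below are taken in the extended reals, so that the infimum of an empty set
  of achievable rates is infinite.
\<close>

definition E_D :: "nat \<Rightarrow> nat \<Rightarrow> complex mat \<Rightarrow> ereal" where
  "E_D dA dB \<rho> = Sup (ereal ` {r. 0 \<le> r \<and>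
     (\<lambda>n. let m = nat \<lfloor>r * real n\<rfloor>
          in INF L \<in> {L. ppt_operation (dA ^ n) (dB ^ n) (2 ^ m) (2 ^ m) L}.
               trace_norm (L (btensor_power dA dB \<rho> n) - btensor_power 2 2 max_entangled m))
       \<longlonglongrightarrow> 0})"

definition E_C :: "nat \<Rightarrow> nat \<Rightarrow> complex mat \<Rightarrow> ereal" where
  "E_C dA dB \<rho> = Inf (ereal ` {r. 0 \<le> r \<and>
     (\<lambda>n. let m = nat \<lfloor>r * real n\<rfloor>
          in INF L \<in> {L. ppt_operation (2 ^ m) (2 ^ m) (dA ^ n) (dB ^ n) L}.
               trace_norm (btensor_power dA dB \<rho> n - L (btensor_power 2 2 max_entangled m)))
       \<longlonglongrightarrow> 0})"

section \<open>The family of states\<close>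

definition psi1 :: "real \<Rightarrow> complex vec" where
  "psi1 \<alpha> = complex_of_real (sqrt \<alpha>) \<cdot>\<^sub>v ket2 3 3 0 1
            - complex_of_real (sqrt (1 - \<alpha>)) \<cdot>\<^sub>v ket2 3 3 1 0"

definition psi2 :: "real \<Rightarrow> complex vec" where
  "psi2 \<alpha> = complex_of_real (sqrt \<alpha>) \<cdot>\<^sub>v ket2 3 3 0 2
            - complex_of_real (sqrt (1 - \<alpha>)) \<cdot>\<^sub>v ket2 3 3 2 0"

definition rho :: "real \<Rightarrow> complex mat" where
  "rho \<alpha> = (1 / 2) \<cdot>\<^sub>m (proj (psi1 \<alpha>) + proj (psi2 \<alpha>))"

end

theory Submission
  imports Defs "HOL-Real_Asymp.Real_Asymp"
begin

text \<open>
  Everything rests on two-sided bounds \<open>- Y \<le> A \<le> Y\<close>: they are preserved by positive maps and by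
  tensor products, and \<open>- Y \<le> A \<le> Y\<close>, \<open>- Z \<le> B \<le> Z\<close> imply \<open>tr (A B) \<le> tr (Y Z)\<close>, because
  \<open>2 (Y Z - A B)\<close> has the same trace as \<open>(Y - A)(Z + B) + (Y + A)(Z - B)\<close>. The trace norm of a
  Hermitian operator is the least trace of such a bound, and the operator norm the least multiple
  of the identity. The partial transpose of \<open>\<Phi>\<close> is half the swap, so that of \<open>\<Phi>\<^sup>\<otimes>\<^sup>m\<close> is bounded
  by \<open>2 ^ (- m)\<close> times the identity.

  Write \<open>N\<close> for the map \<open>T \<circ> \<Lambda> \<circ> T\<close> of a PPT operation \<open>\<Lambda>\<close>. If \<open>X \<ge> \<rho>\<close>, then
  \<open>tr (\<Phi>\<^sub>m \<Lambda>(\<rho>\<^sub>n)) \<le> tr (\<Phi>\<^sub>m\<^sup>T N(X\<^sub>n\<^sup>T)) \<le> 2 ^ (- m) \<parallel>X\<^sup>T\<parallel>\<^sub>1 ^ n\<close>, which bounds the distillation rate.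
  If \<open>- Y \<le> P\<^sup>T \<le> Y\<close>, then \<open>tr (P\<^sub>n \<Lambda>(\<Phi>\<^sub>m)) \<le> 2 ^ (- m) tr (Y\<^sub>n\<^sup>T \<Lambda>(1)) \<le> 2 ^ m \<parallel>Y\<^sup>T\<parallel>\<^sub>\<infinity> ^ n\<close>, which
  bounds the cost. For the given family, \<open>X = \<rho>\<close> gives \<open>E\<^sub>W \<le> log (1 + sqrt (2 \<alpha> (1 - \<alpha>)))\<close> and an
  explicit \<open>Y\<close> gives \<open>E\<^sub>\<eta> \<ge> - log (1 - \<alpha>)\<close>; these are separated when \<open>2 (1 - \<alpha>) ^ 3 < \<alpha>\<close>.
\<close>

text \<open>The bounds on \<open>E_D\<close> and \<open>E_C\<close> hold for each feasible
  \<open>X\<close> or \<open>Y\<close>, and the n-fold tensor power of a one-copy choice is feasible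
  for n copies. Hence only explicit matrices of size nine have to be examined, and one-sided
  estimates of \<open>E_W\<close> and \<open>E_eta\<close> suffice. The definitions use a multiset
  of polynomial roots, real suprema and infima, and a definite description. The spectral theorem, in
  coordinates, ties both norms to two-sided bounds. A real supremum or infimum is informative only
  over a nonempty set, and a member can be compared with it only if the set is bounded; this is why
  crude estimates and a trivial PPT operation are supplied. The interval for \<alpha> has two
  sources. The separation reads 1 + sqrt (2 \<alpha> (1 - \<alpha>)) < 1 / (1 - \<alpha>),
  equivalent to 2 (1 - \<alpha>)^3 < \<alpha>; the left side of the latter decreases, and equality
  occurs between 0.41 and 0.42. The end 1/2 makes 1 - \<alpha> the larger of the weights \<alpha>
  and 1 - \<alpha> in the transposed \<open>Y\<close>.\<close>

section \<open>Adjoints, products, traces and positivity in terms of entries\<close>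

lemma mat_adjoint_carrier [simp]:
  "A \<in> carrier_mat n m \<Longrightarrow> mat_adjoint A \<in> carrier_mat m n"
  by (auto simp: mat_adjoint_def)

lemma mat_adjoint_index [simp]:
  fixes A :: "complex mat"
  assumes "i < dim_col A" "j < dim_row A"
  shows "mat_adjoint A $$ (i, j) = cnj (A $$ (j, i))"
  using assms by (simp add: mat_adjoint_def mat_of_rows_def conjugate_complex_def)

lemma mat_adjoint_dim [simp]:
  "dim_row (mat_adjoint A) = dim_col A" "dim_col (mat_adjoint A) = dim_row A"
  by (auto simp: mat_adjoint_def)

lemma hermitian_iff:
  "hermitian d A \<longleftrightarrow> A \<in> carrier_mat d d \<and> (\<forall>i<d. \<forall>j<d. A $$ (j, i) = cnj (A $$ (i, j)))"
proof -
  have "mat_adjoint A = A \<longleftrightarrow> (\<forall>i<d. \<forall>j<d. A $$ (j, i) = cnj (A $$ (i, j)))" if "A \<in> carrier_mat d d"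
  proof
    assume "mat_adjoint A = A"
    hence "mat_adjoint A $$ (j, i) = A $$ (j, i)" for i j by simp
    thus "\<forall>i<d. \<forall>j<d. A $$ (j, i) = cnj (A $$ (i, j))" using that by (metis carrier_matD mat_adjoint_index)
  next
    assume *: "\<forall>i<d. \<forall>j<d. A $$ (j, i) = cnj (A $$ (i, j))"
    show "mat_adjoint A = A"
    proof (rule eq_matI)
      fix i j assume "i < dim_row A" "j < dim_col A"
      thus "mat_adjoint A $$ (i, j) = A $$ (i, j)"
        using that *[rule_format, of j i] by (simp only: mat_adjoint_index carrier_matD)
    qed (use that in auto)
  qed
  thus ?thesis by (auto simp: hermitian_def)
qed

lemma hermitian_cnj:
  "hermitian d A \<Longrightarrow> i < d \<Longrightarrow> j < d \<Longrightarrow> cnj (A $$ (i, j)) = A $$ (j, i)"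
  by (metis hermitian_iff)

lemma hermitianI:
  "A \<in> carrier_mat d d \<Longrightarrow> (\<And>i j. i < d \<Longrightarrow> j < d \<Longrightarrow> cnj (A $$ (i, j)) = A $$ (j, i)) \<Longrightarrow>
    hermitian d A"
  by (simp add: hermitian_iff)

lemma mult_mat_index:
  fixes A B :: "'a::semiring_0 mat"
  assumes "A \<in> carrier_mat n m" "B \<in> carrier_mat m l" "i < n" "j < l"
  shows "(A * B) $$ (i, j) = (\<Sum>k<m. A $$ (i, k) * B $$ (k, j))"
  using assms by (auto simp: scalar_prod_def atLeast0LessThan intro!: sum.cong)

lemma mult_mat_vec_nth:
  fixes A :: "'a::semiring_0 mat"
  assumes "A \<in> carrier_mat n m" "v \<in> carrier_vec m" "i < n"
  shows "(A *\<^sub>v v) $ i = (\<Sum>k<m. A $$ (i, k) * v $ k)"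
  using assms by (auto simp: scalar_prod_def atLeast0LessThan intro!: sum.cong)

lemma inner_vec:
  fixes v w :: "complex vec"
  assumes "w \<in> carrier_vec d"
  shows "v \<bullet>c w = (\<Sum>i<d. v $ i * cnj (w $ i))"
  using assms by (auto simp: scalar_prod_def atLeast0LessThan conjugate_complex_def intro!: sum.cong)

lemma quad_form:
  fixes A :: "complex mat"
  assumes "A \<in> carrier_mat d d" "v \<in> carrier_vec d"
  shows "(A *\<^sub>v v) \<bullet>c v = (\<Sum>i<d. \<Sum>j<d. A $$ (i, j) * v $ j * cnj (v $ i))"
  using assms by (simp add: inner_vec[OF assms(2)] mult_mat_vec_nth[OF assms] sum_distrib_right del: index_mult_mat_vec)

text \<open>Vectors become functions on the naturals, of which only the values below
  \<open>d\<close> enter, so that families of coefficients can be inserted without carrier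
  conditions.\<close>

lemma psd_iff:
  "psd d A \<longleftrightarrow> hermitian d A \<and>
     (\<forall>x. 0 \<le> Re (\<Sum>i<d. \<Sum>j<d. A $$ (i, j) * x j * cnj (x i)))"
proof -
  have "(\<forall>v\<in>carrier_vec d. 0 \<le> Re ((A *\<^sub>v v) \<bullet>c v)) \<longleftrightarrow>
     (\<forall>x. 0 \<le> Re (\<Sum>i<d. \<Sum>j<d. A $$ (i, j) * x j * cnj (x i)))" if A: "A \<in> carrier_mat d d"
  proof safe
    fix x assume *: "\<forall>v\<in>carrier_vec d. 0 \<le> Re ((A *\<^sub>v v) \<bullet>c v)"
    have "(\<Sum>i<d. \<Sum>j<d. A $$ (i, j) * vec d x $ j * cnj (vec d x $ i)) =
      (\<Sum>i<d. \<Sum>j<d. A $$ (i, j) * x j * cnj (x i))"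
      by (intro sum.cong) auto
    with *[rule_format, of "vec d x"] quad_form[OF A, of "vec d x"]
    show "0 \<le> Re (\<Sum>i<d. \<Sum>j<d. A $$ (i, j) * x j * cnj (x i))" by simp
  next
    fix v :: "complex vec" assume *: "\<forall>x. 0 \<le> Re (\<Sum>i<d. \<Sum>j<d. A $$ (i, j) * x j * cnj (x i))"
      and v: "v \<in> carrier_vec d"
    show "0 \<le> Re ((A *\<^sub>v v) \<bullet>c v)"
      using *[rule_format, of "\<lambda>i. v $ i"] by (simp only: quad_form[OF A v])
  qed
  thus ?thesis by (auto simp: psd_def hermitian_def)
qed

lemma mat_trace_mult:
  assumes "A \<in> carrier_mat n m" "B \<in> carrier_mat m n"
  shows "mat_trace (A * B) = (\<Sum>i<n. \<Sum>j<m. A $$ (i, j) * B $$ (j, i))"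
  using assms unfolding mat_trace_def
  by (auto simp del: index_mult_mat(1) simp: mult_mat_index[OF assms] intro!: sum.cong)

lemma mat_trace_comm:
  assumes "A \<in> carrier_mat n m" "B \<in> carrier_mat m n"
  shows "mat_trace (A * B) = mat_trace (B * A)"
  unfolding mat_trace_mult[OF assms] mat_trace_mult[OF assms(2,1)]
  by (subst sum.swap) (simp add: mult.commute)

section \<open>The spectral theorem and the trace norm\<close>

text \<open>A triangular form with zero diagonal would make the trace of \<open>H * H\<close>
  vanish, which happens only for \<open>H = 0\<close>.\<close>

lemma hermitian_nonzero_eigenvector:
  assumes H: "hermitian d H" and H0: "\<exists>a<d. \<exists>b<d. H $$ (a, b) \<noteq> 0"
  shows "\<exists>(v :: nat \<Rightarrow> complex) c. c \<noteq> 0 \<and> (\<exists>a<d. v a \<noteq> 0) \<and>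
    (\<forall>a<d. (\<Sum>b<d. H $$ (a, b) * v b) = c * v a)"
proof -
  have Hc: "H \<in> carrier_mat d d" using H by (simp add: hermitian_def)
  obtain es where es: "char_poly H = (\<Prod>e\<leftarrow>es. [:- e, 1:])"
    using char_poly_factorized[OF Hc] by blast
  obtain B P Q where BPQ: "schur_decomposition H es = (B, P, Q)" by (metis prod_cases3)
  from schur_decomposition[OF Hc es BPQ] have sim: "similar_mat_wit H B P Q"
    and ut: "upper_triangular B" by auto
  from similar_mat_witD2[OF Hc sim] have PQ: "P * Q = 1\<^sub>m d" "Q * P = 1\<^sub>m d" "H = P * B * Q"
    and c: "B \<in> carrier_mat d d" "P \<in> carrier_mat d d" "Q \<in> carrier_mat d d" by auto
  \<comment> \<open>\<open>tr (H\<^sup>2)\<close> is both the squared Frobenius norm of \<open>H\<close> and the sum of its squared eigenvalues.\<close>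
  have "H * H = P * B * (Q * P) * B * Q" unfolding PQ(3) using c
    by (simp add: assoc_mult_mat[of _ d d _ d _ d])
  also have "\<dots> = P * (B * B) * Q" using c unfolding PQ(2) by (simp add: assoc_mult_mat[of _ d d _ d _ d])
  finally have "mat_trace (H * H) = mat_trace (P * (B * B) * Q)" by simp
  also have "\<dots> = mat_trace (P * (B * B * Q))" using c by (simp add: assoc_mult_mat[of _ d d _ d _ d])
  also have "\<dots> = mat_trace (B * B * Q * P)"
    by (rule mat_trace_comm) (use c in auto)
  also have "\<dots> = mat_trace (B * B)" using c PQ(2)
    by (simp add: assoc_mult_mat[of _ d d _ d _ d])
  also have "\<dots> = (\<Sum>i<d. \<Sum>j<d. B $$ (i, j) * B $$ (j, i))" by (rule mat_trace_mult) (use c in auto)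
  also have "\<dots> = (\<Sum>i<d. \<Sum>j<d. if i = j then B $$ (i, i) * B $$ (i, i) else 0)"
  proof (intro sum.cong refl)
    fix i j assume "i \<in> {..<d}" "j \<in> {..<d}"
    thus "B $$ (i, j) * B $$ (j, i) = (if i = j then B $$ (i, i) * B $$ (i, i) else 0)"
      using upper_triangularD[OF ut, of i j] upper_triangularD[OF ut, of j i] c
      by (cases i j rule: linorder_cases) auto
  qed
  also have "\<dots> = (\<Sum>i<d. B $$ (i, i) * B $$ (i, i))" by simp
  finally have tr: "mat_trace (H * H) = (\<Sum>i<d. B $$ (i, i) * B $$ (i, i))" .
  have "mat_trace (H * H) = (\<Sum>i<d. \<Sum>j<d. H $$ (i, j) * H $$ (j, i))"
    by (rule mat_trace_mult) (use Hc in auto)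
  also have "\<dots> = (\<Sum>i<d. \<Sum>j<d. of_real ((cmod (H $$ (i, j)))\<^sup>2))"
    using H by (intro sum.cong refl) (simp add: hermitian_cnj[OF H] complex_norm_square del: of_real_power)
  also have "\<dots> = of_real (\<Sum>i<d. \<Sum>j<d. (cmod (H $$ (i, j)))\<^sup>2)" by simp
  finally have tr2: "mat_trace (H * H) = of_real (\<Sum>i<d. \<Sum>j<d. (cmod (H $$ (i, j)))\<^sup>2)" .
  have "(\<Sum>i<d. \<Sum>j<d. (cmod (H $$ (i, j)))\<^sup>2) \<noteq> 0"
  proof
    assume "(\<Sum>i<d. \<Sum>j<d. (cmod (H $$ (i, j)))\<^sup>2) = 0"
    hence "\<forall>i<d. (\<Sum>j<d. (cmod (H $$ (i, j)))\<^sup>2) = 0"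
      by (subst (asm) sum_nonneg_eq_0_iff) (auto intro: sum_nonneg)
    hence "\<forall>i<d. \<forall>j<d. (cmod (H $$ (i, j)))\<^sup>2 = 0"
      by (subst (asm) sum_nonneg_eq_0_iff) auto
    with H0 show False by auto
  qed
  hence "\<exists>i<d. B $$ (i, i) \<noteq> 0" using tr unfolding tr2 by (metis (no_types, lifting) lessThan_iff mult_zero_left of_real_eq_0_iff sum.neutral)
  then obtain i where i: "i < d" "B $$ (i, i) \<noteq> 0" by blast
  have "char_poly H = (\<Prod>a\<leftarrow>diag_mat B. [:- a, 1:])"
    using char_poly_upper_triangular[OF c(1) ut] char_poly_similar[of H B] sim
    by (auto simp: similar_mat_def)
  hence "poly (char_poly H) (B $$ (i, i)) = (\<Prod>a\<leftarrow>diag_mat B. B $$ (i, i) - a)"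
    by (simp add: poly_prod_list o_def)
  also have "\<dots> = 0" using i c by (auto simp: prod_list_zero_iff diag_mat_def)
  finally have "eigenvalue H (B $$ (i, i))" using eigenvalue_root_char_poly[OF Hc] by simp
  then obtain v where v: "v \<in> carrier_vec d" "v \<noteq> 0\<^sub>v d" "H *\<^sub>v v = B $$ (i, i) \<cdot>\<^sub>v v"
    using Hc unfolding eigenvalue_def eigenvector_def by auto
  have "\<exists>a<d. v $ a \<noteq> 0" using v(1,2) by (auto simp: vec_eq_iff)
  moreover have "(\<Sum>b<d. H $$ (a, b) * v $ b) = B $$ (i, i) * v $ a" if "a < d" for a
    using arg_cong[OF v(3), of "\<lambda>w. w $ a"] that v(1) mult_mat_vec_nth[OF Hc v(1) that] by simp
  ultimately show ?thesis using i by blast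
qed

lemma extend_orthonormal_eigenvectors:
  assumes H: "hermitian d H" and k: "k < d"
    and on: "\<And>i j. i < k \<Longrightarrow> j < k \<Longrightarrow> (\<Sum>a<d. u i a * cnj (u j a)) = (if i = j then 1 else 0)"
    and ev: "\<And>i a. i < k \<Longrightarrow> a < d \<Longrightarrow> (\<Sum>b<d. H $$ (a, b) * u i b) = of_real (c i) * u i a"
  shows "\<exists>v e. (\<Sum>a<d. v a * cnj (v a)) = 1 \<and> (\<forall>i<k. (\<Sum>a<d. v a * cnj (u i a)) = 0) \<and>
     (\<forall>a<d. (\<Sum>b<d. H $$ (a, b) * v b) = complex_of_real e * v a)"
proof -
  \<comment> \<open>\<open>M\<close> annihilates the given eigenvectors. An eigenvector of \<open>M\<close> for a nonzero eigenvalue is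
    therefore orthogonal to them; if \<open>M = 0\<close>, any vector of their complement will do.\<close>
  define M where "M = mat d d (\<lambda>(a, b). H $$ (a, b) - (\<Sum>i<k. of_real (c i) * u i a * cnj (u i b)))"
  have M_idx: "M $$ (a, b) = H $$ (a, b) - (\<Sum>i<k. of_real (c i) * u i a * cnj (u i b))"
    if "a < d" "b < d" for a b using that by (simp add: M_def)
  have M: "hermitian d M"
    unfolding hermitian_iff by (auto simp: M_idx hermitian_cnj[OF H] mult_ac intro!: sum.cong) (simp add: M_def)
  have Mv: "(\<Sum>b<d. M $$ (a, b) * v b) = (\<Sum>b<d. H $$ (a, b) * v b)
      - (\<Sum>i<k. of_real (c i) * u i a * (\<Sum>b<d. v b * cnj (u i b)))" if "a < d" for a v
  proof -
    have "(\<Sum>b<d. M $$ (a, b) * v b) = (\<Sum>b<d. H $$ (a, b) * v b) -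
       (\<Sum>b<d. \<Sum>i<k. of_real (c i) * u i a * cnj (u i b) * v b)"
      using that by (simp add: M_idx left_diff_distrib sum_subtractf sum_distrib_right)
    also have "(\<Sum>b<d. \<Sum>i<k. of_real (c i) * u i a * cnj (u i b) * v b) =
      (\<Sum>i<k. of_real (c i) * u i a * (\<Sum>b<d. v b * cnj (u i b)))"
      by (subst sum.swap) (simp add: sum_distrib_left mult_ac)
    finally show ?thesis .
  qed
  have Mu: "(\<Sum>b<d. M $$ (a, b) * u i b) = 0" if "a < d" "i < k" for a i
  proof -
    have "(\<Sum>j<k. of_real (c j) * u j a * (\<Sum>b<d. u i b * cnj (u j b))) =
       (\<Sum>j<k. if j = i then of_real (c i) * u i a else 0)"
      using that by (intro sum.cong) (auto simp: on)
    also have "\<dots> = of_real (c i) * u i a" using that by simp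
    finally show ?thesis using that by (simp add: Mv ev)
  qed
  have "\<exists>v e. (\<exists>a<d. v a \<noteq> 0) \<and> (\<forall>i<k. (\<Sum>a<d. v a * cnj (u i a)) = 0) \<and>
     (\<forall>a<d. (\<Sum>b<d. H $$ (a, b) * v b) = e * v a)"
  proof (cases "\<exists>a<d. \<exists>b<d. M $$ (a, b) \<noteq> 0")
    case True
    from hermitian_nonzero_eigenvector[OF M True] obtain v e where
      e: "e \<noteq> 0" and v: "\<exists>a<d. v a \<noteq> 0" and Mve: "\<forall>a<d. (\<Sum>b<d. M $$ (a, b) * v b) = e * v a"
      by blast
    have orth: "(\<Sum>a<d. v a * cnj (u i a)) = 0" if i: "i < k" for i
    proof -
      have "e * (\<Sum>a<d. v a * cnj (u i a)) = (\<Sum>a<d. (\<Sum>b<d. M $$ (a, b) * v b) * cnj (u i a))"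
        using Mve by (simp add: sum_distrib_left mult_ac)
      also have "\<dots> = (\<Sum>b<d. v b * cnj (\<Sum>a<d. M $$ (b, a) * u i a))"
        unfolding sum_distrib_right cnj_sum sum_distrib_left
        by (subst sum.swap, intro sum.cong refl) (simp add: hermitian_cnj[OF M] mult_ac)
      also have "\<dots> = 0" using i by (simp add: Mu)
      finally show ?thesis using e by simp
    qed
    have "(\<Sum>b<d. H $$ (a, b) * v b) = e * v a" if "a < d" for a
      using Mve[rule_format, OF that] Mv[OF that, of v] by (simp add: orth)
    with v orth show ?thesis by blast
  next
    case False
    \<comment> \<open>\<open>q\<close> is the projection onto the orthogonal complement of the given
      vectors. Its trace \<open>d - k\<close> is nonzero, so some diagonal entry is, and the column
      \<open>b\<close> through it is a nonzero vector of the complement.\<close>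
    define q where "q a b = (if a = b then 1 else 0) - (\<Sum>i<k. u i a * cnj (u i b))" for a b
    have "(\<Sum>a<d. q a a) = of_nat d - (\<Sum>i<k. \<Sum>a<d. u i a * cnj (u i a))"
      unfolding q_def sum_subtractf by (subst (2) sum.swap) simp
    also have "(\<Sum>i<k. \<Sum>a<d. u i a * cnj (u i a)) = of_nat k" by (simp add: on)
    finally have "(\<Sum>a<d. q a a) \<noteq> 0" using k by simp
    then obtain b where b: "b < d" "q b b \<noteq> 0" by (meson lessThan_iff sum.not_neutral_contains_not_neutral)
    have orth: "(\<Sum>a<d. q a b * cnj (u i a)) = 0" if i: "i < k" for i
    proof -
      have "(\<Sum>a<d. q a b * cnj (u i a)) = (\<Sum>a<d. (if a = b then cnj (u i b) else 0)) -
        (\<Sum>a<d. \<Sum>j<k. u j a * cnj (u j b) * cnj (u i a))"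
        unfolding sum_subtractf[symmetric] by (intro sum.cong) (auto simp: q_def left_diff_distrib sum_distrib_right)
      also have "(\<Sum>a<d. \<Sum>j<k. u j a * cnj (u j b) * cnj (u i a)) =
        (\<Sum>j<k. cnj (u j b) * (\<Sum>a<d. u j a * cnj (u i a)))"
        by (subst sum.swap) (simp add: sum_distrib_left mult_ac)
      also have "\<dots> = (\<Sum>j<k. if j = i then cnj (u i b) else 0)"
        using i by (intro sum.cong) (auto simp: on)
      finally show ?thesis using i b by simp
    qed
    have "(\<Sum>e<d. H $$ (a, e) * q e b) = 0 * q a b" if "a < d" for a
    proof -
      have "(\<Sum>e<d. M $$ (a, e) * q e b) = 0" using False that by simp
      thus ?thesis using Mv[OF that, of "\<lambda>e. q e b"] by (simp add: orth)
    qed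
    with b orth show ?thesis by (intro exI[of _ "\<lambda>a. q a b"] exI[of _ 0]) auto
  qed
  then obtain v e where v: "\<exists>a<d. v a \<noteq> 0" "\<forall>i<k. (\<Sum>a<d. v a * cnj (u i a)) = 0"
    and He: "\<forall>a<d. (\<Sum>b<d. H $$ (a, b) * v b) = e * v a" by blast
  define N where "N = (\<Sum>a<d. (cmod (v a))\<^sup>2)"
  have N: "(\<Sum>a<d. v a * cnj (v a)) = of_real N"
    unfolding N_def of_real_sum by (intro sum.cong) (simp_all only: complex_norm_square)
  have "N > 0" unfolding N_def using v(1) by (auto intro!: sum_pos2)
  \<comment> \<open>Moving \<open>H\<close> across the inner product shows that the eigenvalue
    \<open>e\<close> equals its conjugate.\<close>
  have "e * of_real N = (\<Sum>a<d. (\<Sum>b<d. H $$ (a, b) * v b) * cnj (v a))"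
    using He by (simp add: N[symmetric] sum_distrib_left mult_ac)
  also have "\<dots> = (\<Sum>b<d. v b * cnj (\<Sum>a<d. H $$ (b, a) * v a))"
    unfolding sum_distrib_right cnj_sum sum_distrib_left
    by (subst sum.swap, intro sum.cong refl) (simp add: hermitian_cnj[OF H] mult_ac)
  also have "\<dots> = cnj e * of_real N"
    using He by (simp add: N[symmetric] sum_distrib_left mult_ac)
  finally have "e = cnj e" using \<open>N > 0\<close> by simp
  hence e: "e = of_real (Re e)" by (simp add: complex_eq_iff)
  define w where "w a = v a / of_real (sqrt N)" for a
  have "(\<Sum>a<d. w a * cnj (w a)) = (\<Sum>a<d. v a * cnj (v a)) / (of_real (sqrt N) * of_real (sqrt N))"
    by (simp add: w_def sum_divide_distrib)
  also have "\<dots> = 1" using \<open>N > 0\<close> by (simp add: N flip: of_real_mult)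
  finally have 1: "(\<Sum>a<d. w a * cnj (w a)) = 1" .
  have 2: "\<forall>i<k. (\<Sum>a<d. w a * cnj (u i a)) = 0"
    using v(2) by (simp add: w_def sum_divide_distrib[symmetric])
  have 3: "\<forall>a<d. (\<Sum>b<d. H $$ (a, b) * w b) = of_real (Re e) * w a"
    using He e by (simp add: w_def sum_divide_distrib[symmetric])
  from 1 2 3 show ?thesis by blast
qed

lemma orthonormal_eigenvectors:
  assumes H: "hermitian d H"
  shows "k \<le> d \<Longrightarrow> \<exists>(u :: nat \<Rightarrow> nat \<Rightarrow> complex) c.
    (\<forall>i<k. \<forall>j<k. (\<Sum>a<d. u i a * cnj (u j a)) = (if i = j then 1 else 0)) \<and>
    (\<forall>i<k. \<forall>a<d. (\<Sum>b<d. H $$ (a, b) * u i b) = of_real (c i) * u i a)"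
proof (induction k)
  case (Suc k)
  hence "k \<le> d" by simp
  from Suc.IH[OF this] obtain u :: "nat \<Rightarrow> nat \<Rightarrow> complex" and c :: "nat \<Rightarrow> real" where
    u: "\<forall>i<k. \<forall>j<k. (\<Sum>a<d. u i a * cnj (u j a)) = (if i = j then 1 else 0)"
    and c: "\<forall>i<k. \<forall>a<d. (\<Sum>b<d. H $$ (a, b) * u i b) = of_real (c i) * u i a"
    by blast
  have "k < d" using Suc by simp
  from extend_orthonormal_eigenvectors[OF H this u[rule_format] c[rule_format]] obtain v e where
    v: "(\<Sum>a<d. v a * cnj (v a)) = 1" "\<forall>i<k. (\<Sum>a<d. v a * cnj (u i a)) = 0"
    and e: "\<forall>a<d. (\<Sum>b<d. H $$ (a, b) * v b) = of_real e * v a" by blast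
  have v': "(\<Sum>a<d. u i a * cnj (v a)) = 0" if "i < k" for i
  proof -
    have "(\<Sum>a<d. u i a * cnj (v a)) = cnj (\<Sum>a<d. v a * cnj (u i a))" by (simp add: mult.commute)
    thus ?thesis using v that by simp
  qed
  have all_less_Suc: "(\<forall>i<Suc k. R i) \<longleftrightarrow> (\<forall>i<k. R i) \<and> R k" for R :: "nat \<Rightarrow> bool"
    by (auto simp: less_Suc_eq)
  show ?case
    by (rule exI[of _ "u(k := v)"], rule exI[of _ "c(k := e)"])
      (use u c v v' e in \<open>simp add: all_less_Suc\<close>)
qed simp

text \<open>\<open>u k a\<close> is the component \<open>a\<close> of the eigenvector number
  \<open>k\<close>. Orthonormality and completeness are both recorded: the first evaluates quadratic
  forms at eigenvectors, the second expands the identity and traces.\<close>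

definition spectral_form :: "nat \<Rightarrow> complex mat \<Rightarrow> (nat \<Rightarrow> nat \<Rightarrow> complex) \<Rightarrow> (nat \<Rightarrow> real) \<Rightarrow> bool" where
  "spectral_form d H u c \<longleftrightarrow>
     (\<forall>i<d. \<forall>j<d. (\<Sum>a<d. u i a * cnj (u j a)) = (if i = j then 1 else 0)) \<and>
     (\<forall>a<d. \<forall>b<d. (\<Sum>k<d. u k a * cnj (u k b)) = (if a = b then 1 else 0)) \<and>
     (\<forall>a<d. \<forall>b<d. H $$ (a, b) = (\<Sum>k<d. of_real (c k) * u k a * cnj (u k b)))"

lemma spectral_formD:
  assumes "spectral_form d H u c"
  shows "i < d \<Longrightarrow> j < d \<Longrightarrow> (\<Sum>a<d. u i a * cnj (u j a)) = (if i = j then 1 else 0)"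
    and "a < d \<Longrightarrow> b < d \<Longrightarrow> (\<Sum>k<d. u k a * cnj (u k b)) = (if a = b then 1 else 0)"
    and "a < d \<Longrightarrow> b < d \<Longrightarrow> H $$ (a, b) = (\<Sum>k<d. of_real (c k) * u k a * cnj (u k b))"
  using assms unfolding spectral_form_def by blast+

text \<open>The matrix \<open>U\<close> with the eigenvectors as columns is an isometry and square,
  hence unitary, which gives the resolution of the identity; inserting that after \<open>H\<close>
  expands \<open>H\<close> in its eigenvectors.\<close>

theorem spectral_decomposition:
  assumes H: "hermitian d H"
  obtains u c where "spectral_form d H u c"
proof -
  from orthonormal_eigenvectors[OF H order.refl] obtain u :: "nat \<Rightarrow> nat \<Rightarrow> complex" and c :: "nat \<Rightarrow> real" where
    u: "\<forall>i<d. \<forall>j<d. (\<Sum>a<d. u i a * cnj (u j a)) = (if i = j then 1 else 0)"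
    and c: "\<forall>i<d. \<forall>a<d. (\<Sum>b<d. H $$ (a, b) * u i b) = of_real (c i) * u i a"
    by blast
  define U where "U = mat d d (\<lambda>(a, k). u k a)"
  have U: "U \<in> carrier_mat d d" by (simp add: U_def)
  have "mat_adjoint U * U = 1\<^sub>m d"
  proof (rule eq_matI)
    fix i j assume ij: "i < dim_row (1\<^sub>m d :: complex mat)" "j < dim_col (1\<^sub>m d :: complex mat)"
    have "(mat_adjoint U * U) $$ (i, j) = (\<Sum>a<d. mat_adjoint U $$ (i, a) * U $$ (a, j))"
      by (rule mult_mat_index) (use U ij in auto)
    also have "\<dots> = (\<Sum>a<d. u j a * cnj (u i a))"
      using ij by (intro sum.cong) (auto simp: U_def mult.commute)
    finally show "(mat_adjoint U * U) $$ (i, j) = 1\<^sub>m d $$ (i, j)" using ij by (simp add: u)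
  qed (use U in auto)
  hence UU: "U * mat_adjoint U = 1\<^sub>m d"
    by (rule mat_mult_left_right_inverse[OF mat_adjoint_carrier[OF U] U])
  have compl: "(\<Sum>k<d. u k a * cnj (u k b)) = (if a = b then 1 else 0)" if "a < d" "b < d" for a b
  proof -
    have "(U * mat_adjoint U) $$ (a, b) = (\<Sum>k<d. U $$ (a, k) * mat_adjoint U $$ (k, b))"
      by (rule mult_mat_index) (use U that in auto)
    also have "\<dots> = (\<Sum>k<d. u k a * cnj (u k b))"
      using that by (intro sum.cong) (auto simp: U_def)
    finally show ?thesis using that by (simp add: UU)
  qed
  have "H $$ (a, b) = (\<Sum>k<d. of_real (c k) * u k a * cnj (u k b))" if ab: "a < d" "b < d" for a b
  proof -
    have "H $$ (a, b) = (\<Sum>e<d. if e = b then H $$ (a, e) else 0)"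
      using ab by simp
    also have "\<dots> = (\<Sum>e<d. H $$ (a, e) * (\<Sum>k<d. u k e * cnj (u k b)))"
      using ab by (intro sum.cong) (auto simp: compl)
    also have "\<dots> = (\<Sum>k<d. (\<Sum>e<d. H $$ (a, e) * u k e) * cnj (u k b))"
      unfolding sum_distrib_left sum_distrib_right by (subst sum.swap) (simp add: mult_ac)
    finally show ?thesis using ab by (simp add: c)
  qed
  with u compl have "spectral_form d H u c" unfolding spectral_form_def by blast
  thus thesis by (rule that)
qed

text \<open>Makes the multiset in \<open>trace_norm\<close> readable from a diagonal form.\<close>

lemma proots_prod_linear:
  fixes xs :: "'a::idom list"
  shows "proots (\<Prod>a\<leftarrow>xs. [:- a, 1:]) = mset xs"
proof (induction xs)
  case (Cons a xs)
  have "(\<Prod>a\<leftarrow>xs. [:- a, 1:]) \<noteq> 0" by (auto simp: prod_list_zero_iff)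
  hence "proots ([:- a, 1:] * (\<Prod>a\<leftarrow>xs. [:- a, 1:])) = proots [:- a, 1:] + proots (\<Prod>a\<leftarrow>xs. [:- a, 1:])"
    by (intro proots_mult) auto
  thus ?case using Cons by (simp del: mult_pCons_left)
qed simp

text \<open>The unitary of eigenvectors conjugates \<open>H * H\<close> to the diagonal matrix of
  the squared eigenvalues, so these are the roots of its characteristic polynomial with
  multiplicity.\<close>

lemma trace_norm_spectral:
  assumes H: "hermitian d H" and S: "spectral_form d H u c"
  shows "trace_norm H = (\<Sum>k<d. \<bar>c k\<bar>)"
proof -
  note u = spectral_formD(1)[OF S] and c = spectral_formD(3)[OF S]
  have Hc: "H \<in> carrier_mat d d" "mat_adjoint H = H" using H by (simp_all add: hermitian_def)
  define U where "U = mat d d (\<lambda>(a, k). u k a)"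
  define D where "D = mat d d (\<lambda>(i, j). if i = j then complex_of_real ((c i)\<^sup>2) else 0)"
  have U: "U \<in> carrier_mat d d" and D: "D \<in> carrier_mat d d" by (simp_all add: U_def D_def)
  have 1: "mat_adjoint U * U = 1\<^sub>m d"
  proof (rule eq_matI)
    fix i j assume ij: "i < dim_row (1\<^sub>m d :: complex mat)" "j < dim_col (1\<^sub>m d :: complex mat)"
    have "(mat_adjoint U * U) $$ (i, j) = (\<Sum>a<d. mat_adjoint U $$ (i, a) * U $$ (a, j))"
      by (rule mult_mat_index) (use U ij in auto)
    also have "\<dots> = (\<Sum>a<d. u j a * cnj (u i a))"
      using ij by (intro sum.cong) (auto simp: U_def mult.commute)
    finally show "(mat_adjoint U * U) $$ (i, j) = 1\<^sub>m d $$ (i, j)" using ij by (simp add: u)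
  qed (use U in auto)
  hence 2: "U * mat_adjoint U = 1\<^sub>m d"
    by (rule mat_mult_left_right_inverse[OF mat_adjoint_carrier[OF U] U])
  have 3: "H * H = U * D * mat_adjoint U"
  proof (rule eq_matI)
    fix a b assume "a < dim_row (U * D * mat_adjoint U)" "b < dim_col (U * D * mat_adjoint U)"
    hence ab: "a < d" "b < d" using U by auto
    have "(H * H) $$ (a, b) = (\<Sum>e<d. H $$ (a, e) * H $$ (e, b))"
      by (rule mult_mat_index) (use Hc ab in auto)
    also have "\<dots> = (\<Sum>e<d. \<Sum>k<d. \<Sum>l<d. (of_real (c k) * u k a * cnj (u k e)) *
       (of_real (c l) * u l e * cnj (u l b)))"
      using ab by (simp add: c sum_product)
    also have "\<dots> = (\<Sum>k<d. \<Sum>l<d. \<Sum>e<d. (of_real (c k) * u k a * cnj (u k e)) *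
       (of_real (c l) * u l e * cnj (u l b)))"
      by (rule trans[OF sum.swap], rule sum.cong[OF refl], rule sum.swap)
    also have "\<dots> = (\<Sum>k<d. \<Sum>l<d. of_real (c k) * u k a * of_real (c l) * cnj (u l b) *
       (\<Sum>e<d. u l e * cnj (u k e)))"
      unfolding sum_distrib_left by (intro sum.cong refl) (simp add: mult_ac)
    also have "\<dots> = (\<Sum>k<d. \<Sum>l<d. if l = k then of_real (c k) * u k a * of_real (c k) * cnj (u k b) else 0)"
      by (intro sum.cong refl) (auto simp: u)
    also have "\<dots> = (\<Sum>k<d. of_real ((c k)\<^sup>2) * u k a * cnj (u k b))"
      by (intro sum.cong) (auto simp: power2_eq_square mult_ac)
    finally have lhs: "(H * H) $$ (a, b) = (\<Sum>k<d. of_real ((c k)\<^sup>2) * u k a * cnj (u k b))" .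
    have UD: "(U * D) $$ (a, k) = of_real ((c k)\<^sup>2) * u k a" if "k < d" for k
    proof -
      have "(U * D) $$ (a, k) = (\<Sum>e<d. U $$ (a, e) * D $$ (e, k))"
        by (rule mult_mat_index) (use U D ab that in auto)
      also have "\<dots> = (\<Sum>e<d. if e = k then of_real ((c k)\<^sup>2) * u k a else 0)"
        using ab that by (intro sum.cong) (auto simp: U_def D_def)
      finally show ?thesis using that by simp
    qed
    have "(U * D * mat_adjoint U) $$ (a, b) = (\<Sum>k<d. (U * D) $$ (a, k) * mat_adjoint U $$ (k, b))"
      by (rule mult_mat_index) (use U D ab in auto)
    also have "\<dots> = (\<Sum>k<d. of_real ((c k)\<^sup>2) * u k a * cnj (u k b))"
      using ab by (intro sum.cong refl, subst UD) (auto simp: U_def)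
    finally show "(H * H) $$ (a, b) = (U * D * mat_adjoint U) $$ (a, b)" using lhs by simp
  qed (use U Hc in auto)
  have "similar_mat_wit (H * H) D U (mat_adjoint U)"
    by (rule similar_mat_witI[OF 2 1 3]) (use U D Hc in auto)
  hence "char_poly (H * H) = char_poly D" by (intro char_poly_similar) (auto simp: similar_mat_def)
  also have "\<dots> = (\<Prod>a\<leftarrow>diag_mat D. [:- a, 1:])"
    by (rule char_poly_upper_triangular[OF D]) (auto simp: D_def)
  finally have "proots (char_poly (H * H)) = mset (diag_mat D)"
    by (simp add: proots_prod_linear)
  hence "trace_norm H = (\<Sum>x\<leftarrow>diag_mat D. sqrt (Re x))"
    unfolding trace_norm_def Hc by (metis mset_map sum_mset_sum_list)
  also have "\<dots> = (\<Sum>k<d. \<bar>c k\<bar>)"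
    by (simp add: diag_mat_def D_def o_def interv_sum_list_conv_sum_set_nat atLeast0LessThan)
  finally show ?thesis .
qed

section \<open>Positive semidefinite operators and two-sided bounds\<close>

lemma psd_carrier: "psd d A \<Longrightarrow> A \<in> carrier_mat d d"
  by (simp add: psd_def hermitian_def)

text \<open>The quadratic form is a sum of squared moduli. Concrete positivity claims below are
  certified in this form or its weighted version; an arbitrary finite index set leaves room for
  products.\<close>

lemma psdI_sum:
  assumes A: "A \<in> carrier_mat d d" and "finite K"
    and f: "\<And>a b. a < d \<Longrightarrow> b < d \<Longrightarrow> A $$ (a, b) = (\<Sum>k\<in>K. f k a * cnj (f k b))"
  shows "psd d A"
  unfolding psd_iff
proof (intro conjI allI)
  show "hermitian d A" using A by (auto simp: hermitian_iff f mult.commute)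
  fix x :: "nat \<Rightarrow> complex"
  have "(\<Sum>i<d. \<Sum>j<d. A $$ (i, j) * x j * cnj (x i)) =
      (\<Sum>i<d. \<Sum>j<d. \<Sum>k\<in>K. f k i * cnj (x i) * cnj (f k j * cnj (x j)))"
    by (intro sum.cong refl) (simp add: f sum_distrib_right sum_distrib_left mult_ac)
  also have "\<dots> = (\<Sum>i<d. \<Sum>k\<in>K. \<Sum>j<d. f k i * cnj (x i) * cnj (f k j * cnj (x j)))"
    by (intro sum.cong[OF refl] sum.swap)
  also have "\<dots> = (\<Sum>k\<in>K. \<Sum>i<d. \<Sum>j<d. f k i * cnj (x i) * cnj (f k j * cnj (x j)))"
    by (rule sum.swap)
  also have "\<dots> = (\<Sum>k\<in>K. (\<Sum>i<d. f k i * cnj (x i)) * cnj (\<Sum>j<d. f k j * cnj (x j)))"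
    unfolding cnj_sum by (simp only: sum_product)
  also have "\<dots> = (\<Sum>k\<in>K. of_real ((cmod (\<Sum>i<d. f k i * cnj (x i)))\<^sup>2))"
    by (simp only: complex_norm_square)
  finally have *: "(\<Sum>i<d. \<Sum>j<d. A $$ (i, j) * x j * cnj (x i)) =
     of_real (\<Sum>k\<in>K. (cmod (\<Sum>i<d. f k i * cnj (x i)))\<^sup>2)" by simp
  show "0 \<le> Re (\<Sum>i<d. \<Sum>j<d. A $$ (i, j) * x j * cnj (x i))"
    unfolding * by (auto intro: sum_nonneg)
qed

lemma weight_eq_sqrt:
  assumes "0 \<le> w"
  shows "of_real w * x * cnj y = (of_real (sqrt w) * x) * cnj (of_real (sqrt w) * y)"
proof -
  have "complex_of_real w = of_real (sqrt w) * of_real (sqrt w)"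
    using assms by (simp flip: of_real_mult)
  thus ?thesis by (simp only: complex_cnj_mult complex_cnj_complex_of_real mult_ac)
qed

lemma psdI_weighted_sum:
  assumes A: "A \<in> carrier_mat d d" and "finite K"
    and w: "\<And>k. k \<in> K \<Longrightarrow> 0 \<le> w k"
    and f: "\<And>a b. a < d \<Longrightarrow> b < d \<Longrightarrow> A $$ (a, b) = (\<Sum>k\<in>K. of_real (w k) * f k a * cnj (f k b))"
  shows "psd d A"
proof (rule psdI_sum[OF A \<open>finite K\<close>])
  fix a b assume ab: "a < d" "b < d"
  show "A $$ (a, b) = (\<Sum>k\<in>K. (of_real (sqrt (w k)) * f k a) * cnj (of_real (sqrt (w k)) * f k b))"
    unfolding f[OF ab] by (intro sum.cong refl weight_eq_sqrt w)
qed

text \<open>The quadratic form at an eigenvector is the eigenvalue, so all eigenvalues are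
  nonnegative and their square roots can be absorbed into the eigenvectors.\<close>

lemma psd_decomposition:
  assumes "psd d A"
  obtains f :: "nat \<Rightarrow> nat \<Rightarrow> complex"
  where "\<forall>a<d. \<forall>b<d. A $$ (a, b) = (\<Sum>k<d. f k a * cnj (f k b))"
proof -
  have H: "hermitian d A" using assms by (simp add: psd_def)
  obtain u c where S: "spectral_form d A u c" by (rule spectral_decomposition[OF H])
  note u = spectral_formD(1)[OF S] and v = spectral_formD(2)[OF S] and c = spectral_formD(3)[OF S]
  have "c k \<ge> 0" if k: "k < d" for k
  proof -
    have "(\<Sum>i<d. \<Sum>j<d. A $$ (i, j) * u k j * cnj (u k i)) =
       (\<Sum>i<d. \<Sum>j<d. \<Sum>l<d. of_real (c l) * (u l i * cnj (u k i)) * (u k j * cnj (u l j)))"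
      by (intro sum.cong refl) (simp add: c sum_distrib_right sum_distrib_left mult_ac)
    also have "\<dots> = (\<Sum>i<d. \<Sum>l<d. \<Sum>j<d. of_real (c l) * (u l i * cnj (u k i)) * (u k j * cnj (u l j)))"
      by (intro sum.cong[OF refl] sum.swap)
    also have "\<dots> = (\<Sum>l<d. \<Sum>i<d. \<Sum>j<d. of_real (c l) * (u l i * cnj (u k i)) * (u k j * cnj (u l j)))"
      by (rule sum.swap)
    also have "\<dots> = (\<Sum>l<d. of_real (c l) * ((\<Sum>i<d. u l i * cnj (u k i)) * (\<Sum>j<d. u k j * cnj (u l j))))"
      by (intro sum.cong refl, subst sum_product) (simp only: sum_distrib_left mult.assoc)
    also have "\<dots> = (\<Sum>l<d. if l = k then of_real (c k) else 0)"
      using k by (intro sum.cong) (auto simp: u)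
    also have "\<dots> = of_real (c k)" using k by simp
    finally have "(\<Sum>i<d. \<Sum>j<d. A $$ (i, j) * u k j * cnj (u k i)) = of_real (c k)" .
    moreover have "0 \<le> Re (\<Sum>i<d. \<Sum>j<d. A $$ (i, j) * u k j * cnj (u k i))"
      using assms unfolding psd_iff by blast
    ultimately show ?thesis by simp
  qed
  hence "A $$ (a, b) = (\<Sum>k<d. (of_real (sqrt (c k)) * u k a) * cnj (of_real (sqrt (c k)) * u k b))"
    if "a < d" "b < d" for a b
    unfolding c[OF that] by (intro sum.cong refl weight_eq_sqrt) auto
  thus thesis by (intro that[of "\<lambda>k a. of_real (sqrt (c k)) * u k a"]) blast
qed

lemma hermitian_carrier: "hermitian d A \<Longrightarrow> A \<in> carrier_mat d d"
  by (simp add: hermitian_def)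

lemma hermitian_add: "hermitian d A \<Longrightarrow> hermitian d B \<Longrightarrow> hermitian d (A + B)"
  using hermitian_carrier[of d A] hermitian_carrier[of d B]
  by (intro hermitianI) (auto simp: hermitian_cnj)

lemma hermitian_minus: "hermitian d A \<Longrightarrow> hermitian d B \<Longrightarrow> hermitian d (A - B)"
  using hermitian_carrier[of d A] hermitian_carrier[of d B]
  by (intro hermitianI) (auto simp: hermitian_cnj)

lemma hermitian_smult: "hermitian d A \<Longrightarrow> hermitian d (complex_of_real r \<cdot>\<^sub>m A)"
  using hermitian_carrier[of d A]
  by (intro hermitianI) (auto simp: hermitian_cnj)

lemma psd_add:
  assumes "psd d A" "psd d B"
  shows "psd d (A + B)"
proof -
  have "A \<in> carrier_mat d d" "B \<in> carrier_mat d d" using assms by (auto simp: psd_carrier)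
  hence "(\<Sum>i<d. \<Sum>j<d. (A + B) $$ (i, j) * x j * cnj (x i)) =
    (\<Sum>i<d. \<Sum>j<d. A $$ (i, j) * x j * cnj (x i)) + (\<Sum>i<d. \<Sum>j<d. B $$ (i, j) * x j * cnj (x i))" for x
    by (simp add: distrib_right sum.distrib)
  with assms show ?thesis unfolding psd_iff by (simp add: hermitian_add)
qed

lemma psd_smult:
  assumes "psd d A" "r \<ge> 0"
  shows "psd d (complex_of_real r \<cdot>\<^sub>m A)"
proof -
  have A: "A \<in> carrier_mat d d" by (rule psd_carrier) fact
  have "(\<Sum>i<d. \<Sum>j<d. (complex_of_real r \<cdot>\<^sub>m A) $$ (i, j) * x j * cnj (x i)) =
     of_real r * (\<Sum>i<d. \<Sum>j<d. A $$ (i, j) * x j * cnj (x i))" for x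
    unfolding sum_distrib_left using A by (intro sum.cong refl) auto
  with assms show ?thesis
    unfolding psd_iff by (simp add: hermitian_smult)
qed

lemma psd_zero: "psd d (0\<^sub>m d d)"
  by (rule psdI_sum[of _ _ "{}" "\<lambda>_ _. 0"]) auto

lemma psd_one: "psd d (1\<^sub>m d)"
proof (rule psdI_sum[of _ _ "{..<d}" "\<lambda>k a. if a = k then 1 else 0"])
  fix a b assume "a < d" "b < d"
  have "(\<Sum>k<d. (if a = k then 1 else 0) * cnj (if b = k then 1 else 0)) =
    (\<Sum>k<d. if k = a then (if a = b then 1 else 0) else 0 :: complex)"
    by (intro sum.cong) auto
  thus "1\<^sub>m d $$ (a, b) = (\<Sum>k<d. (if a = k then 1 else 0) * cnj (if b = k then 1 else 0))"
    using \<open>a < d\<close> \<open>b < d\<close> by simp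
qed auto

text \<open>Writing \<open>A\<close> as a sum of rank-one operators turns the trace into a sum of
  values of the quadratic form of \<open>B\<close>.\<close>

lemma trace_mult_nonneg:
  assumes A: "psd d A" and B: "psd d B"
  shows "0 \<le> Re (mat_trace (A * B))"
proof -
  obtain f :: "nat \<Rightarrow> nat \<Rightarrow> complex" where
    f: "\<forall>a<d. \<forall>b<d. A $$ (a, b) = (\<Sum>k<d. f k a * cnj (f k b))" by (rule psd_decomposition[OF A])
  have "mat_trace (A * B) = (\<Sum>i<d. \<Sum>j<d. A $$ (i, j) * B $$ (j, i))"
    using A B by (intro mat_trace_mult psd_carrier)
  also have "\<dots> = (\<Sum>i<d. \<Sum>j<d. \<Sum>k<d. B $$ (j, i) * f k i * cnj (f k j))"
    by (intro sum.cong refl) (simp add: f sum_distrib_left mult_ac)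
  also have "\<dots> = (\<Sum>i<d. \<Sum>k<d. \<Sum>j<d. B $$ (j, i) * f k i * cnj (f k j))"
    by (intro sum.cong[OF refl] sum.swap)
  also have "\<dots> = (\<Sum>k<d. \<Sum>i<d. \<Sum>j<d. B $$ (j, i) * f k i * cnj (f k j))"
    by (rule sum.swap)
  also have "\<dots> = (\<Sum>k<d. \<Sum>j<d. \<Sum>i<d. B $$ (j, i) * f k i * cnj (f k j))"
    by (intro sum.cong[OF refl] sum.swap)
  finally have "mat_trace (A * B) = (\<Sum>k<d. \<Sum>j<d. \<Sum>i<d. B $$ (j, i) * f k i * cnj (f k j))" .
  moreover have "0 \<le> Re (\<Sum>j<d. \<Sum>i<d. B $$ (j, i) * f k i * cnj (f k j))" for k
    using B unfolding psd_iff by blast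
  ultimately show ?thesis by (metis (no_types, lifting) Re_sum sum_nonneg)
qed

lemma mat_trace_add:
  "A \<in> carrier_mat d d \<Longrightarrow> B \<in> carrier_mat d d \<Longrightarrow> mat_trace (A + B) = mat_trace A + mat_trace B"
  by (simp add: mat_trace_def sum.distrib)

lemma mat_trace_minus:
  "A \<in> carrier_mat d d \<Longrightarrow> B \<in> carrier_mat d d \<Longrightarrow> mat_trace (A - B) = mat_trace A - mat_trace B"
  by (simp add: mat_trace_def sum_subtractf)

lemma mat_trace_smult:
  "A \<in> carrier_mat d d \<Longrightarrow> mat_trace (c \<cdot>\<^sub>m A) = c * mat_trace A"
  by (simp add: mat_trace_def sum_distrib_left)

lemma mat_trace_mult_mono:
  assumes "psd d A" "loewner_le d B C"
  shows "Re (mat_trace (A * B)) \<le> Re (mat_trace (A * C))"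
proof -
  have c: "A \<in> carrier_mat d d" "B \<in> carrier_mat d d" "C \<in> carrier_mat d d" "psd d (C - B)"
    using assms by (auto simp: loewner_le_def psd_carrier)
  have "A * (C - B) = A * C - A * B" using c by (intro mult_minus_distrib_mat) auto
  thus ?thesis using trace_mult_nonneg[OF assms(1) c(4)] c
    by (simp add: mat_trace_minus[of _ d])
qed

section \<open>Two-sided operator bounds\<close>

text \<open>Spelled with \<open>loewner_le\<close> to agree literally with the constraint in
  \<open>E_eta\<close>; \<open>dominated_iff\<close> is the form used in calculations.\<close>

definition dominated :: "nat \<Rightarrow> complex mat \<Rightarrow> complex mat \<Rightarrow> bool" where
  "dominated d A Y \<longleftrightarrow> loewner_le d (- Y) A \<and> loewner_le d A Y"

lemma dominated_iff:
  "dominated d A Y \<longleftrightarrow> A \<in> carrier_mat d d \<and> Y \<in> carrier_mat d d \<and> psd d (Y - A) \<and> psd d (Y + A)"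
proof -
  have "A - - Y = Y + A" if "A \<in> carrier_mat d d" "Y \<in> carrier_mat d d"
    using that by (intro eq_matI) auto
  thus ?thesis by (auto simp: dominated_def loewner_le_def)
qed

lemma dominated_self: "psd d A \<Longrightarrow> dominated d A A"
proof -
  assume A: "psd d A"
  hence "A - A = 0\<^sub>m d d" by (intro minus_r_inv_mat psd_carrier)
  hence "psd d (A - A)" using psd_zero by simp
  thus ?thesis using A unfolding dominated_iff by (intro conjI psd_carrier psd_add)
qed

lemma half_eq: "complex_of_real (1 / 2) \<cdot>\<^sub>m (A + A) = A"
  by (intro eq_matI) auto

text \<open>\<open>Y - A\<close> and \<open>Y + A\<close> sum to twice \<open>Y\<close>, and
  \<open>A\<close> is the difference of \<open>Y + A\<close> and \<open>Y\<close>.\<close>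

lemma dominated_hermitian: assumes "dominated d A Y" shows "hermitian d A" "psd d Y"
proof -
  have c: "A \<in> carrier_mat d d" "Y \<in> carrier_mat d d" "psd d (Y - A)" "psd d (Y + A)"
    using assms by (auto simp: dominated_iff)
  have "(Y + A) + (Y - A) = Y + Y" using c by (intro eq_matI) auto
  hence "Y = complex_of_real (1 / 2) \<cdot>\<^sub>m ((Y + A) + (Y - A))" by (simp only: half_eq)
  moreover have "psd d (complex_of_real (1 / 2) \<cdot>\<^sub>m ((Y + A) + (Y - A)))"
    by (intro psd_smult psd_add c) simp
  ultimately show Y: "psd d Y" by simp
  have "A = (Y + A) - Y" using c by (intro eq_matI) auto
  moreover have "hermitian d ((Y + A) - Y)"
    using c(4) Y by (auto simp: psd_def intro: hermitian_minus)
  ultimately show "hermitian d A" by simp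
qed

lemma dominated_trace_mult:
  assumes "dominated d A Y" "dominated d B Z"
  shows "Re (mat_trace (A * B)) \<le> Re (mat_trace (Y * Z))"
proof -
  have c: "A \<in> carrier_mat d d" "Y \<in> carrier_mat d d" "psd d (Y - A)" "psd d (Y + A)"
    "B \<in> carrier_mat d d" "Z \<in> carrier_mat d d" "psd d (Z - B)" "psd d (Z + B)"
    using assms by (auto simp: dominated_iff)
  have "mat_trace ((Y - A) * (Z + B)) + mat_trace ((Y + A) * (Z - B)) =
    2 * (mat_trace (Y * Z) - mat_trace (A * B))"
  proof -
    have "(\<Sum>i<d. \<Sum>j<d. (Y - A) $$ (i, j) * (Z + B) $$ (j, i)) +
        (\<Sum>i<d. \<Sum>j<d. (Y + A) $$ (i, j) * (Z - B) $$ (j, i)) =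
      2 * ((\<Sum>i<d. \<Sum>j<d. Y $$ (i, j) * Z $$ (j, i)) - (\<Sum>i<d. \<Sum>j<d. A $$ (i, j) * B $$ (j, i)))"
      unfolding sum_distrib_left sum.distrib[symmetric] sum_subtractf[symmetric]
      using c by (intro sum.cong refl) (auto simp: algebra_simps)
    moreover have "mat_trace ((Y - A) * (Z + B)) = (\<Sum>i<d. \<Sum>j<d. (Y - A) $$ (i, j) * (Z + B) $$ (j, i))"
      "mat_trace ((Y + A) * (Z - B)) = (\<Sum>i<d. \<Sum>j<d. (Y + A) $$ (i, j) * (Z - B) $$ (j, i))"
      "mat_trace (Y * Z) = (\<Sum>i<d. \<Sum>j<d. Y $$ (i, j) * Z $$ (j, i))"
      "mat_trace (A * B) = (\<Sum>i<d. \<Sum>j<d. A $$ (i, j) * B $$ (j, i))"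
      by ((rule mat_trace_mult[of _ d d]; use c in \<open>auto intro: minus_carrier_mat\<close>)+)
    ultimately show ?thesis by simp
  qed
  moreover have "0 \<le> Re (mat_trace ((Y - A) * (Z + B)))" "0 \<le> Re (mat_trace ((Y + A) * (Z - B)))"
    using c by (auto intro: trace_mult_nonneg)
  ultimately show ?thesis by (simp add: complex_eq_iff)
qed

lemma dominated_trace: assumes "dominated d A Y" shows "Re (mat_trace A) \<le> Re (mat_trace Y)"
proof -
  have "A * 1\<^sub>m d = A" "Y * 1\<^sub>m d = Y" using assms by (auto simp: dominated_iff)
  thus ?thesis using dominated_trace_mult[OF assms dominated_self[OF psd_one]] by simp
qed

text \<open>\<open>K\<close> is the absolute value of \<open>H\<close>: it has the same
  eigenvectors, with eigenvalues |c k|, and both |c k| - c k and |c k| + c k are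
  nonnegative.\<close>

lemma trace_norm_dominated:
  assumes H: "hermitian d H"
  obtains K where "dominated d H K" "Re (mat_trace K) = trace_norm H"
proof -
  obtain u c where S: "spectral_form d H u c" by (rule spectral_decomposition[OF H])
  note u = spectral_formD(1)[OF S] and v = spectral_formD(2)[OF S] and c = spectral_formD(3)[OF S]
  define K where "K = mat d d (\<lambda>(a, b). \<Sum>k<d. of_real \<bar>c k\<bar> * u k a * cnj (u k b))"
  have Hc: "H \<in> carrier_mat d d" using H by (simp add: hermitian_def)
  have "psd d (K - H)"
    by (rule psdI_weighted_sum[of _ _ "{..<d}" "\<lambda>k. \<bar>c k\<bar> - c k" u])
      (use Hc in \<open>auto simp: K_def c left_diff_distrib sum_subtractf\<close>)
  moreover have "psd d (K + H)"
    by (rule psdI_weighted_sum[of _ _ "{..<d}" "\<lambda>k. \<bar>c k\<bar> + c k" u])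
      (use Hc in \<open>auto simp: K_def c distrib_right sum.distrib\<close>)
  ultimately have "dominated d H K" using Hc by (simp add: dominated_iff K_def)
  moreover have "mat_trace K = (\<Sum>k<d. of_real \<bar>c k\<bar> * (\<Sum>a<d. u k a * cnj (u k a)))"
    unfolding mat_trace_def K_def by (simp add: sum_distrib_left mult_ac) (rule sum.swap)
  hence "mat_trace K = of_real (trace_norm H)"
    using trace_norm_spectral[OF H S] by (simp add: u)
  ultimately show thesis using that by simp
qed

text \<open>Evaluating both positive operators at the eigenvector for \<open>c k\<close> bounds |c
  k| by the quadratic form of \<open>K\<close>; summed over the orthonormal basis, these values give
  the trace of \<open>K\<close>.\<close>

lemma trace_norm_le:
  assumes K: "dominated d H K"
  shows "trace_norm H \<le> Re (mat_trace K)"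
proof -
  note H = dominated_hermitian(1)[OF K]
  obtain u c where S: "spectral_form d H u c" by (rule spectral_decomposition[OF H])
  note u = spectral_formD(1)[OF S] and v = spectral_formD(2)[OF S] and c = spectral_formD(3)[OF S]
  have cr: "H \<in> carrier_mat d d" "K \<in> carrier_mat d d" "psd d (K - H)" "psd d (K + H)"
    using K by (auto simp: dominated_iff)
  define q where "q A k = (\<Sum>i<d. \<Sum>j<d. A $$ (i, j) * u k j * cnj (u k i))" for A k
  have qH: "q H k = of_real (c k)" if k: "k < d" for k
  proof -
    have "q H k =
       (\<Sum>i<d. \<Sum>j<d. \<Sum>l<d. of_real (c l) * (u l i * cnj (u k i)) * (u k j * cnj (u l j)))"
      unfolding q_def by (intro sum.cong refl) (simp add: c sum_distrib_right sum_distrib_left mult_ac)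
    also have "\<dots> = (\<Sum>i<d. \<Sum>l<d. \<Sum>j<d. of_real (c l) * (u l i * cnj (u k i)) * (u k j * cnj (u l j)))"
      by (intro sum.cong[OF refl] sum.swap)
    also have "\<dots> = (\<Sum>l<d. \<Sum>i<d. \<Sum>j<d. of_real (c l) * (u l i * cnj (u k i)) * (u k j * cnj (u l j)))"
      by (rule sum.swap)
    also have "\<dots> = (\<Sum>l<d. of_real (c l) * ((\<Sum>i<d. u l i * cnj (u k i)) * (\<Sum>j<d. u k j * cnj (u l j))))"
      by (intro sum.cong refl, subst sum_product) (simp only: sum_distrib_left mult.assoc)
    also have "\<dots> = (\<Sum>l<d. if l = k then of_real (c k) else 0)"
      using k by (intro sum.cong) (auto simp: u)
    finally show ?thesis using k by simp
  qed
  have "q (K - H) k = q K k - q H k" "q (K + H) k = q K k + q H k" for k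
    unfolding q_def using cr
    by (simp_all add: left_diff_distrib distrib_right sum_subtractf sum.distrib)
  moreover have "0 \<le> Re (q (K - H) k)" "0 \<le> Re (q (K + H) k)" for k
    using cr(3,4) unfolding psd_iff q_def by blast+
  ultimately have *: "\<bar>c k\<bar> \<le> Re (q K k)" if "k < d" for k
    using qH[OF that] by (smt (verit) Re_complex_of_real minus_complex.simps(1) plus_complex.simps(1))
  have "(\<Sum>k<d. q K k) = (\<Sum>i<d. \<Sum>k<d. \<Sum>j<d. K $$ (i, j) * u k j * cnj (u k i))"
    unfolding q_def by (rule sum.swap)
  also have "\<dots> = (\<Sum>i<d. \<Sum>j<d. \<Sum>k<d. K $$ (i, j) * u k j * cnj (u k i))"
    by (intro sum.cong[OF refl] sum.swap)
  also have "\<dots> = (\<Sum>i<d. \<Sum>j<d. K $$ (i, j) * (\<Sum>k<d. u k j * cnj (u k i)))"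
    by (simp add: sum_distrib_left mult_ac)
  also have "\<dots> = (\<Sum>i<d. \<Sum>j<d. if j = i then K $$ (i, i) else 0)"
    by (intro sum.cong refl) (auto simp: v)
  also have "\<dots> = mat_trace K" using cr by (simp add: mat_trace_def)
  finally have "Re (mat_trace K) = (\<Sum>k<d. Re (q K k))" by (metis Re_sum)
  thus ?thesis using trace_norm_spectral[OF H S] * by (auto intro: sum_mono)
qed

text \<open>Hoelder's inequality for a Hermitian contraction \<open>A\<close>: its bound by the
  identity is paired with the bound of \<open>H\<close> of least trace.\<close>

lemma trace_mult_le_trace_norm:
  assumes "hermitian d H" "dominated d A (1\<^sub>m d)"
  shows "Re (mat_trace (A * H)) \<le> trace_norm H"
proof -
  from trace_norm_dominated[OF assms(1)] obtain K where K: "dominated d H K" "Re (mat_trace K) = trace_norm H" .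
  have "Re (mat_trace (A * H)) \<le> Re (mat_trace (1\<^sub>m d * K))"
    by (rule dominated_trace_mult[OF assms(2) K(1)])
  moreover have "1\<^sub>m d * K = K" using K by (intro left_mult_one_mat[of K d d]) (simp add: dominated_iff)
  ultimately show ?thesis using K by simp
qed

section \<open>The operator norm\<close>

lemma vnorm_eq: "v \<in> carrier_vec d \<Longrightarrow> vnorm v = sqrt (\<Sum>i<d. (cmod (v $ i))\<^sup>2)"
  unfolding vnorm_def inner_vec Re_sum
  by (simp add: cmod_power2 flip: power2_eq_square)

text \<open>Members of the supremum in \<open>op_norm\<close> can be compared with it only once they
  are known to be bounded; row sums of the moduli of the entries are enough.\<close>

lemma op_norm_bdd:
  assumes A: "A \<in> carrier_mat d d"
  shows "bdd_above ((\<lambda>v. vnorm (A *\<^sub>v v)) ` {v \<in> carrier_vec (dim_col A). vnorm v \<le> 1})"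
proof (rule bdd_aboveI2)
  fix v :: "complex vec" assume "v \<in> {v \<in> carrier_vec (dim_col A). vnorm v \<le> 1}"
  hence v: "v \<in> carrier_vec d" "vnorm v \<le> 1" using A by auto
  have vb: "cmod (v $ b) \<le> 1" if "b < d" for b
  proof -
    have "(cmod (v $ b))\<^sup>2 \<le> (\<Sum>i<d. (cmod (v $ i))\<^sup>2)"
      using that by (intro member_le_sum) auto
    also have "\<dots> \<le> 1" using v by (simp add: vnorm_eq[of _ d])
    finally show ?thesis by (simp add: abs_square_le_1)
  qed
  have "cmod ((A *\<^sub>v v) $ a) \<le> (\<Sum>b<d. cmod (A $$ (a, b)))" if "a < d" for a
    unfolding mult_mat_vec_nth[OF A v(1) that]
    by (rule sum_norm_le) (auto simp: norm_mult intro!: mult_left_le vb)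
  thus "vnorm (A *\<^sub>v v) \<le> sqrt (\<Sum>a<d. (\<Sum>b<d. cmod (A $$ (a, b)))\<^sup>2)"
    using A v by (subst vnorm_eq[of _ d]) (auto intro!: sum_mono power_mono)
qed

lemma op_norm_le:
  assumes "\<And>v. v \<in> carrier_vec (dim_col A) \<Longrightarrow> vnorm v \<le> 1 \<Longrightarrow> vnorm (A *\<^sub>v v) \<le> c"
  shows "op_norm A \<le> c"
  unfolding op_norm_def
proof (rule cSUP_least)
  have "0\<^sub>v (dim_col A) \<in> {v \<in> carrier_vec (dim_col A). vnorm v \<le> 1}"
    by (auto simp: vnorm_eq[of _ "dim_col A"])
  thus "{v \<in> carrier_vec (dim_col A). vnorm v \<le> 1} \<noteq> {}" by blast
qed (use assms in auto)

lemma op_norm_nonneg: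
  assumes A: "A \<in> carrier_mat d d" shows "0 \<le> op_norm A"
proof -
  have "vnorm (A *\<^sub>v 0\<^sub>v d) \<le> op_norm A"
    unfolding op_norm_def using A by (intro cSUP_upper[OF _ op_norm_bdd[OF A]]) (auto simp: vnorm_eq[of _ d])
  moreover have "0 \<le> vnorm (A *\<^sub>v 0\<^sub>v d)"
    using A by (subst vnorm_eq[of _ d]) (auto intro: sum_nonneg)
  ultimately show ?thesis by linarith
qed

text \<open>Unit eigenvectors are admissible in the supremum, so each eigenvalue has modulus at most
  the norm. Expanding the identity in the same eigenvectors makes both differences nonnegative
  combinations.\<close>

lemma dominated_op_norm:
  assumes H: "hermitian d H"
  shows "dominated d H (of_real (op_norm H) \<cdot>\<^sub>m 1\<^sub>m d)"
proof -
  obtain u c where S: "spectral_form d H u c" by (rule spectral_decomposition[OF H])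
  note u = spectral_formD(1)[OF S] and v = spectral_formD(2)[OF S] and c = spectral_formD(3)[OF S]
  have Hc: "H \<in> carrier_mat d d" using H by (simp add: hermitian_def)
  have ck: "\<bar>c k\<bar> \<le> op_norm H" if k: "k < d" for k
  proof -
    have n: "(\<Sum>a<d. (cmod (u k a))\<^sup>2) = 1"
    proof -
      have "complex_of_real (\<Sum>a<d. (cmod (u k a))\<^sup>2) = (\<Sum>a<d. u k a * cnj (u k a))"
        unfolding of_real_sum by (intro sum.cong refl) (simp only: complex_norm_square)
      also have "\<dots> = 1" using u k by simp
      finally show ?thesis using of_real_eq_1_iff by blast
    qed
    have Hu: "(H *\<^sub>v vec d (u k)) $ a = of_real (c k) * u k a" if a: "a < d" for a
    proof -
      have "(H *\<^sub>v vec d (u k)) $ a = (\<Sum>b<d. H $$ (a, b) * vec d (u k) $ b)"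
        by (rule mult_mat_vec_nth) (use Hc a in auto)
      also have "\<dots> = (\<Sum>b<d. \<Sum>l<d. of_real (c l) * u l a * (u k b * cnj (u l b)))"
        using a by (intro sum.cong refl) (simp add: c sum_distrib_left mult_ac)
      also have "\<dots> = (\<Sum>l<d. of_real (c l) * u l a * (\<Sum>b<d. u k b * cnj (u l b)))"
        unfolding sum_distrib_left by (rule sum.swap)
      also have "\<dots> = (\<Sum>l<d. if l = k then of_real (c k) * u k a else 0)"
        using k by (intro sum.cong refl) (auto simp: u)
      finally show ?thesis using k by simp
    qed
    have "vnorm (H *\<^sub>v vec d (u k)) = sqrt (\<Sum>a<d. (c k)\<^sup>2 * (cmod (u k a))\<^sup>2)"
      using Hc by (subst vnorm_eq[of _ d]) (auto simp del: index_mult_mat_vec simp: Hu norm_mult power_mult_distrib)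
    also have "\<dots> = \<bar>c k\<bar>" unfolding sum_distrib_left[symmetric] n by simp
    finally have "\<bar>c k\<bar> = vnorm (H *\<^sub>v vec d (u k))" ..
    also have "\<dots> \<le> op_norm H"
      unfolding op_norm_def using Hc n
      by (intro cSUP_upper[OF _ op_norm_bdd[OF Hc]]) (auto simp: vnorm_eq[of _ d])
    finally show ?thesis .
  qed
  let ?c = "op_norm H"
  have I: "(of_real ?c \<cdot>\<^sub>m 1\<^sub>m d) $$ (a, b) = (\<Sum>k<d. of_real ?c * u k a * cnj (u k b))"
    if "a < d" "b < d" for a b
    using that v[OF that] by (simp add: mult.assoc flip: sum_distrib_left)
  have "psd d (of_real ?c \<cdot>\<^sub>m 1\<^sub>m d - H)"
  proof (rule psdI_weighted_sum[of _ _ "{..<d}" "\<lambda>k. ?c - c k" u])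
    fix k assume "k \<in> {..<d}"
    thus "0 \<le> ?c - c k" using ck[of k] by auto
  next
    fix a b assume ab: "a < d" "b < d"
    have "(of_real ?c \<cdot>\<^sub>m 1\<^sub>m d - H) $$ (a, b) = (of_real ?c \<cdot>\<^sub>m 1\<^sub>m d) $$ (a, b) - H $$ (a, b)"
      using ab Hc by simp
    also have "\<dots> = (\<Sum>k<d. of_real (?c - c k) * u k a * cnj (u k b))"
      unfolding I[OF ab] c[OF ab] by (simp add: left_diff_distrib sum_subtractf)
    finally show "(of_real ?c \<cdot>\<^sub>m 1\<^sub>m d - H) $$ (a, b) =
      (\<Sum>k<d. of_real (?c - c k) * u k a * cnj (u k b))" .
  qed (use Hc in auto)
  moreover have "psd d (of_real ?c \<cdot>\<^sub>m 1\<^sub>m d + H)"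
  proof (rule psdI_weighted_sum[of _ _ "{..<d}" "\<lambda>k. ?c + c k" u])
    fix k assume "k \<in> {..<d}"
    thus "0 \<le> ?c + c k" using ck[of k] by auto
  next
    fix a b assume ab: "a < d" "b < d"
    have "(of_real ?c \<cdot>\<^sub>m 1\<^sub>m d + H) $$ (a, b) = (of_real ?c \<cdot>\<^sub>m 1\<^sub>m d) $$ (a, b) + H $$ (a, b)"
      using ab Hc by simp
    also have "\<dots> = (\<Sum>k<d. of_real (?c + c k) * u k a * cnj (u k b))"
      unfolding I[OF ab] c[OF ab] by (simp add: distrib_right sum.distrib)
    finally show "(of_real ?c \<cdot>\<^sub>m 1\<^sub>m d + H) $$ (a, b) =
      (\<Sum>k<d. of_real (?c + c k) * u k a * cnj (u k b))" .
  qed (use Hc in auto)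
  ultimately show ?thesis using Hc by (simp add: dominated_iff)
qed

section \<open>Bipartite operators\<close>

text \<open>Passes between a flat basis index and its pair of local indices; for
  \<open>n = 0\<close> both sides are empty sums.\<close>

lemma sum_div_mod:
  fixes f :: "nat \<Rightarrow> nat \<Rightarrow> 'a::comm_monoid_add"
  shows "(\<Sum>r<m * n. f (r div n) (r mod n)) = (\<Sum>i<m. \<Sum>j<n. f i j)"
proof (cases "n = 0")
  case False
  have "(\<Sum>r<m * n. f (r div n) (r mod n)) = (\<Sum>i<m. \<Sum>r=i * n..<i * n + n. f (r div n) (r mod n))"
    by (rule sum.nat_group[symmetric])
  also have "\<dots> = (\<Sum>i<m. \<Sum>j<n. f i j)"
  proof (rule sum.cong[OF refl])
    fix i
    have "(\<Sum>r=i * n..<i * n + n. f (r div n) (r mod n)) =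
      (\<Sum>j=0..<n. f ((j + i * n) div n) ((j + i * n) mod n))"
      using sum.shift_bounds_nat_ivl[of "\<lambda>r. f (r div n) (r mod n)" 0 "i * n" n] by (simp add: add.commute)
    also have "\<dots> = (\<Sum>j<n. f i j)" using False by (intro sum.cong) auto
    finally show "(\<Sum>r=i * n..<i * n + n. f (r div n) (r mod n)) = (\<Sum>j<n. f i j)" .
  qed
  finally show ?thesis .
qed simp

lemma index_less: "a < m \<Longrightarrow> b < n \<Longrightarrow> a * n + b < m * (n::nat)"
proof -
  assume ab: "a < m" "b < n"
  have "a * n + b < (a + 1) * n" using ab by simp
  also have "\<dots> \<le> m * n" using ab by (intro mult_le_mono1) simp
  finally show ?thesis .
qed

lemma div_less: "r < m * n \<Longrightarrow> r div n < (m::nat)"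
  by (simp add: less_mult_imp_div_less)

lemma mod_less: "r < m * n \<Longrightarrow> r mod n < (n::nat)"
  by (cases "n = 0") auto

lemma ptranspose_carrier [simp]: "ptranspose dA dB M \<in> carrier_mat (dA * dB) (dA * dB)"
  by (simp add: ptranspose_def bmat_def)

lemma ptranspose_index:
  "r < dA * dB \<Longrightarrow> c < dA * dB \<Longrightarrow> ptranspose dA dB M $$ (r, c) =
    M $$ ((r div dB) * dB + c mod dB, (c div dB) * dB + r mod dB)"
  by (simp add: ptranspose_def bmat_def bentry_def)

lemma ptranspose_index_less:
  "r < dA * dB \<Longrightarrow> c < dA * dB \<Longrightarrow> (r div dB) * dB + c mod dB < dA * (dB::nat)"
  by (intro index_less div_less mod_less)

lemma ptranspose_ptranspose:
  assumes "M \<in> carrier_mat (dA * dB) (dA * dB)"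
  shows "ptranspose dA dB (ptranspose dA dB M) = M"
proof (rule eq_matI)
  fix r c assume "r < dim_row M" "c < dim_col M"
  hence rc: "r < dA * dB" "c < dA * dB" using assms by auto
  hence "dB > 0" by (cases dB) auto
  thus "ptranspose dA dB (ptranspose dA dB M) $$ (r, c) = M $$ (r, c)"
    using rc ptranspose_index_less[OF rc] ptranspose_index_less[OF rc(2,1)]
    by (simp add: ptranspose_index)
qed (use assms in \<open>auto simp: ptranspose_def bmat_def\<close>)

lemma ptranspose_smult:
  assumes "M \<in> carrier_mat (dA * dB) (dA * dB)"
  shows "ptranspose dA dB (c \<cdot>\<^sub>m M) = c \<cdot>\<^sub>m ptranspose dA dB M"
proof (rule eq_matI)
  fix i j assume "i < dim_row (c \<cdot>\<^sub>m ptranspose dA dB M)" "j < dim_col (c \<cdot>\<^sub>m ptranspose dA dB M)"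
  hence rc: "i < dA * dB" "j < dA * dB" by (auto simp: ptranspose_def bmat_def)
  show "ptranspose dA dB (c \<cdot>\<^sub>m M) $$ (i, j) = (c \<cdot>\<^sub>m ptranspose dA dB M) $$ (i, j)"
    using rc assms ptranspose_index_less[OF rc] ptranspose_index_less[OF rc(2,1)]
      carrier_matD[OF ptranspose_carrier[of dA dB M]]
    by (simp add: ptranspose_index)
qed (auto simp: ptranspose_def bmat_def)

lemma ptranspose_one: "ptranspose dA dB (1\<^sub>m (dA * dB)) = 1\<^sub>m (dA * dB)"
proof (rule eq_matI)
  fix r c assume "r < dim_row (1\<^sub>m (dA * dB) :: complex mat)" "c < dim_col (1\<^sub>m (dA * dB) :: complex mat)"
  hence rc: "r < dA * dB" "c < dA * dB" by auto
  hence "dB > 0" by (cases dB) auto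
  have "(r div dB) * dB + c mod dB = (c div dB) * dB + r mod dB \<longleftrightarrow> r = c"
  proof
    assume *: "(r div dB) * dB + c mod dB = (c div dB) * dB + r mod dB"
    have "r div dB = c div dB" using arg_cong[OF *, of "\<lambda>x. x div dB"] \<open>dB > 0\<close> by simp
    moreover have "r mod dB = c mod dB" using arg_cong[OF *, of "\<lambda>x. x mod dB"] by simp
    ultimately show "r = c" by (metis div_mult_mod_eq)
  qed simp
  thus "ptranspose dA dB (1\<^sub>m (dA * dB)) $$ (r, c) = 1\<^sub>m (dA * dB) $$ (r, c)"
    using rc ptranspose_index_less[OF rc] ptranspose_index_less[OF rc(2,1)]
    by (simp add: ptranspose_index)
qed (auto simp: ptranspose_def bmat_def)

lemma hermitian_ptranspose:
  assumes "hermitian (dA * dB) M"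
  shows "hermitian (dA * dB) (ptranspose dA dB M)"
proof (rule hermitianI)
  fix i j assume rc: "i < dA * dB" "j < dA * dB"
  show "cnj (ptranspose dA dB M $$ (i, j)) = ptranspose dA dB M $$ (j, i)"
    using rc ptranspose_index_less[OF rc] ptranspose_index_less[OF rc(2,1)]
    by (simp add: ptranspose_index hermitian_cnj[OF assms])
qed simp

lemma mat_trace_ptranspose:
  assumes "M \<in> carrier_mat (dA * dB) (dA * dB)"
  shows "mat_trace (ptranspose dA dB M) = mat_trace M"
  using assms carrier_matD[OF ptranspose_carrier[of dA dB M]]
  by (auto simp: mat_trace_def ptranspose_index intro!: sum.cong)

text \<open>In both factors the second-system indices of row and column are exchanged, so the sum is
  the original one with these two variables renamed. Together with involutivity, this moves a
  transpose from one factor of a trace to the other.\<close>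

lemma mat_trace_ptranspose_mult:
  assumes "M \<in> carrier_mat (dA * dB) (dA * dB)" "N \<in> carrier_mat (dA * dB) (dA * dB)"
  shows "mat_trace (ptranspose dA dB M * ptranspose dA dB N) = mat_trace (M * N)"
proof -
  let ?g = "\<lambda>a b a' b'. M $$ (a * dB + b, a' * dB + b') * N $$ (a' * dB + b', a * dB + b)"
  let ?d = "dA * dB"
  have "mat_trace (ptranspose dA dB M * ptranspose dA dB N) =
    (\<Sum>r<?d. \<Sum>c<?d. ptranspose dA dB M $$ (r, c) * ptranspose dA dB N $$ (c, r))"
    by (rule mat_trace_mult) auto
  also have "\<dots> = (\<Sum>r<?d. \<Sum>c<?d. ?g (r div dB) (c mod dB) (c div dB) (r mod dB))"
    by (intro sum.cong refl) (simp add: ptranspose_index)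
  also have "\<dots> = (\<Sum>r<?d. \<Sum>a'<dA. \<Sum>b'<dB. ?g (r div dB) b' a' (r mod dB))"
    by (intro sum.cong refl sum_div_mod[where f="\<lambda>a' b'. ?g _ b' a' _"])
  also have "\<dots> = (\<Sum>a<dA. \<Sum>b<dB. \<Sum>a'<dA. \<Sum>b'<dB. ?g a b' a' b)"
    by (rule sum_div_mod[where f="\<lambda>a b. \<Sum>a'<dA. \<Sum>b'<dB. ?g a b' a' b"])
  \<comment> \<open>Three exchanges of adjacent sums swap the roles of \<open>b\<close> and
    \<open>b'\<close>.\<close>
  also have "\<dots> = (\<Sum>a<dA. \<Sum>a'<dA. \<Sum>b<dB. \<Sum>b'<dB. ?g a b' a' b)"
    by (intro sum.cong[OF refl] sum.swap)
  also have "\<dots> = (\<Sum>a<dA. \<Sum>a'<dA. \<Sum>b'<dB. \<Sum>b<dB. ?g a b' a' b)"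
    by (rule sum.cong[OF refl], rule sum.cong[OF refl], rule sum.swap)
  also have "\<dots> = (\<Sum>a<dA. \<Sum>b'<dB. \<Sum>a'<dA. \<Sum>b<dB. ?g a b' a' b)"
    by (rule sum.cong[OF refl], rule sum.swap)
  also have "\<dots> = (\<Sum>r<?d. \<Sum>a'<dA. \<Sum>b<dB. ?g (r div dB) (r mod dB) a' b)"
    by (rule sum_div_mod[symmetric, where f="\<lambda>a b. \<Sum>a'<dA. \<Sum>b'<dB. ?g a b a' b'"])
  also have "\<dots> = (\<Sum>r<?d. \<Sum>c<?d. ?g (r div dB) (r mod dB) (c div dB) (c mod dB))"
    by (rule sum.cong[OF refl], rule sum_div_mod[symmetric])
  also have "\<dots> = mat_trace (M * N)"
    by (subst mat_trace_mult[OF assms]) simp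
  finally show ?thesis .
qed

section \<open>Tensor products\<close>

text \<open>
  A basis index \<open>r\<close> of the regrouped space \<open>(A \<otimes> A') \<otimes> (B \<otimes> B')\<close> splits into the index of the
  component in \<open>A \<otimes> B\<close> and that of the component in \<open>A' \<otimes> B'\<close>.
\<close>

definition fst_idx :: "nat \<Rightarrow> nat \<Rightarrow> nat \<Rightarrow> nat \<Rightarrow> nat" where
  "fst_idx dB dA' dB' r = (r div (dB * dB') div dA') * dB + r mod (dB * dB') div dB'"

definition snd_idx :: "nat \<Rightarrow> nat \<Rightarrow> nat \<Rightarrow> nat \<Rightarrow> nat" where
  "snd_idx dB dA' dB' r = (r div (dB * dB') mod dA') * dB' + r mod (dB * dB') mod dB'"

lemma idx_less:
  assumes "r < dA * dA' * (dB * dB')"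
  shows "fst_idx dB dA' dB' r < dA * dB" "snd_idx dB dA' dB' r < dA' * dB'"
  unfolding fst_idx_def snd_idx_def
  using div_less[OF div_less[OF assms]] mod_less[OF div_less[OF assms]]
    div_less[OF mod_less[OF assms]] mod_less[OF mod_less[OF assms]]
  by (auto intro: index_less)

text \<open>The pair of component indices runs bijectively over the two ranges. Beyond splitting and
  merging, the only rearrangement exchanges the second component on Alice's side with the first on
  Bob's.\<close>

lemma sum_idx:
  fixes f :: "nat \<Rightarrow> nat \<Rightarrow> 'a::comm_monoid_add"
  shows "(\<Sum>r<dA * dA' * (dB * dB'). f (fst_idx dB dA' dB' r) (snd_idx dB dA' dB' r)) =
    (\<Sum>i<dA * dB. \<Sum>j<dA' * dB'. f i j)"
proof -
  have "(\<Sum>r<dA * dA' * (dB * dB'). f (fst_idx dB dA' dB' r) (snd_idx dB dA' dB' r)) =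
    (\<Sum>x<dA * dA'. \<Sum>y<dB * dB'. f (x div dA' * dB + y div dB') (x mod dA' * dB' + y mod dB'))"
    unfolding fst_idx_def snd_idx_def
    by (rule sum_div_mod[where f="\<lambda>x y. f (x div dA' * dB + y div dB') (x mod dA' * dB' + y mod dB')"])
  also have "\<dots> = (\<Sum>x<dA * dA'. \<Sum>b<dB. \<Sum>b'<dB'. f (x div dA' * dB + b) (x mod dA' * dB' + b'))"
    by (rule sum.cong[OF refl], rule sum_div_mod[where f="\<lambda>b b'. f (_ * dB + b) (_ * dB' + b')"])
  also have "\<dots> = (\<Sum>a<dA. \<Sum>a'<dA'. \<Sum>b<dB. \<Sum>b'<dB'. f (a * dB + b) (a' * dB' + b'))"
    by (rule sum_div_mod[where f="\<lambda>a a'. \<Sum>b<dB. \<Sum>b'<dB'. f (a * dB + b) (a' * dB' + b')"])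
  also have "\<dots> = (\<Sum>a<dA. \<Sum>b<dB. \<Sum>a'<dA'. \<Sum>b'<dB'. f (a * dB + b) (a' * dB' + b'))"
    by (rule sum.cong[OF refl], rule sum.swap)
  also have "\<dots> = (\<Sum>i<dA * dB. \<Sum>a'<dA'. \<Sum>b'<dB'. f (i div dB * dB + i mod dB) (a' * dB' + b'))"
    by (rule sum_div_mod[symmetric, where f="\<lambda>a b. \<Sum>a'<dA'. \<Sum>b'<dB'. f (a * dB + b) (a' * dB' + b')"])
  also have "\<dots> = (\<Sum>i<dA * dB. \<Sum>j<dA' * dB'. f (i div dB * dB + i mod dB) (j div dB' * dB' + j mod dB'))"
    by (rule sum.cong[OF refl], rule sum_div_mod[symmetric])
  finally show ?thesis by simp
qed

lemma btensor_carrier [simp]: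
  "btensor dA dB dA' dB' M N \<in> carrier_mat (dA * dA' * (dB * dB')) (dA * dA' * (dB * dB'))"
  by (simp add: btensor_def bmat_def)

lemma btensor_index:
  "r < dA * dA' * (dB * dB') \<Longrightarrow> c < dA * dA' * (dB * dB') \<Longrightarrow> btensor dA dB dA' dB' M N $$ (r, c) =
    M $$ (fst_idx dB dA' dB' r, fst_idx dB dA' dB' c) * N $$ (snd_idx dB dA' dB' r, snd_idx dB dA' dB' c)"
  by (simp add: btensor_def bmat_def bentry_def fst_idx_def snd_idx_def)

text \<open>Products of the vectors in rank-one expansions of \<open>M\<close> and \<open>N\<close>
  expand the tensor product.\<close>

lemma psd_btensor:
  assumes M: "psd (dA * dB) M" and N: "psd (dA' * dB') N"
  shows "psd (dA * dA' * (dB * dB')) (btensor dA dB dA' dB' M N)"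
proof -
  obtain f :: "nat \<Rightarrow> nat \<Rightarrow> complex" where
    f: "\<forall>a<dA * dB. \<forall>b<dA * dB. M $$ (a, b) = (\<Sum>k<dA * dB. f k a * cnj (f k b))"
    by (rule psd_decomposition[OF M])
  obtain g :: "nat \<Rightarrow> nat \<Rightarrow> complex" where
    g: "\<forall>a<dA' * dB'. \<forall>b<dA' * dB'. N $$ (a, b) = (\<Sum>k<dA' * dB'. g k a * cnj (g k b))"
    by (rule psd_decomposition[OF N])
  show ?thesis
  proof (rule psdI_sum[of _ _ "{..<dA * dB} \<times> {..<dA' * dB'}"
        "\<lambda>(k, l) r. f k (fst_idx dB dA' dB' r) * g l (snd_idx dB dA' dB' r)"])
    fix r c assume rc: "r < dA * dA' * (dB * dB')" "c < dA * dA' * (dB * dB')"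
    show "btensor dA dB dA' dB' M N $$ (r, c) = (\<Sum>k\<in>{..<dA * dB} \<times> {..<dA' * dB'}.
      (case k of (k, l) \<Rightarrow> \<lambda>r. f k (fst_idx dB dA' dB' r) * g l (snd_idx dB dA' dB' r)) r *
      cnj ((case k of (k, l) \<Rightarrow> \<lambda>r. f k (fst_idx dB dA' dB' r) * g l (snd_idx dB dA' dB' r)) c))"
      using f g idx_less[OF rc(1)] idx_less[OF rc(2)]
      by (simp add: btensor_index[OF rc] sum_product sum.cartesian_product split_def mult_ac)
  qed auto
qed

lemma mat_trace_btensor_mult:
  assumes "M \<in> carrier_mat (dA * dB) (dA * dB)" "M' \<in> carrier_mat (dA * dB) (dA * dB)"
    "N \<in> carrier_mat (dA' * dB') (dA' * dB')" "N' \<in> carrier_mat (dA' * dB') (dA' * dB')"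
  shows "mat_trace (btensor dA dB dA' dB' M N * btensor dA dB dA' dB' M' N') =
    mat_trace (M * M') * mat_trace (N * N')"
proof -
  let ?D = "dA * dA' * (dB * dB')" and ?p = "fst_idx dB dA' dB'" and ?q = "snd_idx dB dA' dB'"
  let ?m = "\<lambda>i k. M $$ (i, k) * M' $$ (k, i)" and ?n = "\<lambda>j l. N $$ (j, l) * N' $$ (l, j)"
  have "mat_trace (btensor dA dB dA' dB' M N * btensor dA dB dA' dB' M' N') =
    (\<Sum>r<?D. \<Sum>c<?D. btensor dA dB dA' dB' M N $$ (r, c) * btensor dA dB dA' dB' M' N' $$ (c, r))"
    by (rule mat_trace_mult) auto
  also have "\<dots> = (\<Sum>r<?D. \<Sum>c<?D. ?m (?p r) (?p c) * ?n (?q r) (?q c))"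
    by (intro sum.cong refl) (simp add: btensor_index)
  also have "\<dots> = (\<Sum>r<?D. \<Sum>k<dA * dB. \<Sum>l<dA' * dB'. ?m (?p r) k * ?n (?q r) l)"
    by (rule sum.cong[OF refl], rule sum_idx[where f="\<lambda>k l. ?m _ k * ?n _ l"])
  also have "\<dots> = (\<Sum>i<dA * dB. \<Sum>j<dA' * dB'. \<Sum>k<dA * dB. \<Sum>l<dA' * dB'. ?m i k * ?n j l)"
    by (rule sum_idx[where f="\<lambda>i j. \<Sum>k<dA * dB. \<Sum>l<dA' * dB'. ?m i k * ?n j l"])
  also have "\<dots> = (\<Sum>i<dA * dB. \<Sum>j<dA' * dB'. (\<Sum>k<dA * dB. ?m i k) * (\<Sum>l<dA' * dB'. ?n j l))"
    by (simp only: sum_product)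
  also have "\<dots> = (\<Sum>i<dA * dB. \<Sum>k<dA * dB. ?m i k) * (\<Sum>j<dA' * dB'. \<Sum>l<dA' * dB'. ?n j l)"
    by (simp only: sum_product)
  finally show ?thesis by (simp only: mat_trace_mult[OF assms(1,2)] mat_trace_mult[OF assms(3,4)])
qed

lemma mat_trace_btensor:
  assumes "M \<in> carrier_mat (dA * dB) (dA * dB)" "N \<in> carrier_mat (dA' * dB') (dA' * dB')"
  shows "mat_trace (btensor dA dB dA' dB' M N) = mat_trace M * mat_trace N"
proof -
  let ?D = "dA * dA' * (dB * dB')" and ?p = "fst_idx dB dA' dB'" and ?q = "snd_idx dB dA' dB'"
  have "mat_trace (btensor dA dB dA' dB' M N) = (\<Sum>r<?D. M $$ (?p r, ?p r) * N $$ (?q r, ?q r))"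
    unfolding mat_trace_def carrier_matD[OF btensor_carrier] by (intro sum.cong refl) (simp add: btensor_index)
  also have "\<dots> = (\<Sum>i<dA * dB. \<Sum>j<dA' * dB'. M $$ (i, i) * N $$ (j, j))"
    by (rule sum_idx[where f="\<lambda>i j. M $$ (i, i) * N $$ (j, j)"])
  finally show ?thesis using assms by (simp add: mat_trace_def sum_product)
qed

lemma ptranspose_btensor:
  assumes "M \<in> carrier_mat (dA * dB) (dA * dB)" "N \<in> carrier_mat (dA' * dB') (dA' * dB')"
  shows "ptranspose (dA * dA') (dB * dB') (btensor dA dB dA' dB' M N) =
    btensor dA dB dA' dB' (ptranspose dA dB M) (ptranspose dA' dB' N)"
proof (rule eq_matI)
  let ?p = "fst_idx dB dA' dB'" and ?q = "snd_idx dB dA' dB'"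
  fix r c assume "r < dim_row (btensor dA dB dA' dB' (ptranspose dA dB M) (ptranspose dA' dB' N))"
    "c < dim_col (btensor dA dB dA' dB' (ptranspose dA dB M) (ptranspose dA' dB' N))"
  hence rc: "r < dA * dA' * (dB * dB')" "c < dA * dA' * (dB * dB')" by (auto simp: btensor_def bmat_def)
  \<comment> \<open>The index with the Alice part of \<open>r\<close> and the Bob part of
    \<open>c\<close> has components formed in the same way from those of \<open>r\<close> and
    \<open>c\<close>, because regrouping never mixes Alice's indices with Bob's.\<close>
  have key: "?p (r div (dB * dB') * (dB * dB') + c mod (dB * dB')) = ?p r div dB * dB + ?p c mod dB \<and>
    ?q (r div (dB * dB') * (dB * dB') + c mod (dB * dB')) = ?q r div dB' * dB' + ?q c mod dB'"
    if rc: "r < dA * dA' * (dB * dB')" "c < dA * dA' * (dB * dB')" for r c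
  proof -
    have pos: "dB > 0" "dB' > 0" using rc by (auto intro: Nat.gr0I)
    have "r mod (dB * dB') < dB * dB'" "c mod (dB * dB') < dB * dB'" using pos by auto
    hence "r mod (dB * dB') div dB' < dB" "c mod (dB * dB') div dB' < dB" by (auto intro: div_less)
    thus ?thesis using pos by (simp add: fst_idx_def snd_idx_def)
  qed
  show "ptranspose (dA * dA') (dB * dB') (btensor dA dB dA' dB' M N) $$ (r, c) =
    btensor dA dB dA' dB' (ptranspose dA dB M) (ptranspose dA' dB' N) $$ (r, c)"
    unfolding btensor_index[OF rc] ptranspose_index[OF rc]
      btensor_index[OF ptranspose_index_less[OF rc] ptranspose_index_less[OF rc(2,1)]]
    using key[OF rc] key[OF rc(2,1)] idx_less[OF rc(1)] idx_less[OF rc(2)]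
    by (simp add: ptranspose_index)
qed (auto simp: btensor_def bmat_def ptranspose_def)

text \<open>The tensor analogue of the trace identity: twice the difference of the tensor products
  is the sum of (Y - A) with (Z + B) and (Y + A) with (Z - B). For the sum of the tensor products,
  equal signs are paired instead.\<close>

lemma dominated_btensor:
  assumes "dominated (dA * dB) A Y" "dominated (dA' * dB') B Z"
  shows "dominated (dA * dA' * (dB * dB')) (btensor dA dB dA' dB' A B) (btensor dA dB dA' dB' Y Z)"
proof -
  let ?D = "dA * dA' * (dB * dB')"
  have c: "A \<in> carrier_mat (dA * dB) (dA * dB)" "Y \<in> carrier_mat (dA * dB) (dA * dB)"
    "B \<in> carrier_mat (dA' * dB') (dA' * dB')" "Z \<in> carrier_mat (dA' * dB') (dA' * dB')"
    and p: "psd (dA * dB) (Y - A)" "psd (dA * dB) (Y + A)"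
      "psd (dA' * dB') (Z - B)" "psd (dA' * dB') (Z + B)"
    using assms by (auto simp: dominated_iff)
  let ?t = "btensor dA dB dA' dB'"
  have "?t Y Z - ?t A B = of_real (1 / 2) \<cdot>\<^sub>m (?t (Y - A) (Z + B) + ?t (Y + A) (Z - B))"
  proof (rule eq_matI)
    fix r c assume "r < dim_row (of_real (1 / 2) \<cdot>\<^sub>m (?t (Y - A) (Z + B) + ?t (Y + A) (Z - B)))"
      "c < dim_col (of_real (1 / 2) \<cdot>\<^sub>m (?t (Y - A) (Z + B) + ?t (Y + A) (Z - B)))"
    hence rc: "r < ?D" "c < ?D" by (auto simp: btensor_def bmat_def)
    show "(?t Y Z - ?t A B) $$ (r, c) =
      (of_real (1 / 2) \<cdot>\<^sub>m (?t (Y - A) (Z + B) + ?t (Y + A) (Z - B))) $$ (r, c)"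
      using rc c idx_less[OF rc(1)] idx_less[OF rc(2)]
        carrier_matD[OF btensor_carrier[of dA dB dA' dB']]
      by (simp add: btensor_index[OF rc]) (simp add: algebra_simps)
  qed (auto simp: btensor_def bmat_def)
  moreover have "?t Y Z + ?t A B = of_real (1 / 2) \<cdot>\<^sub>m (?t (Y - A) (Z - B) + ?t (Y + A) (Z + B))"
  proof (rule eq_matI)
    fix r c assume "r < dim_row (of_real (1 / 2) \<cdot>\<^sub>m (?t (Y - A) (Z - B) + ?t (Y + A) (Z + B)))"
      "c < dim_col (of_real (1 / 2) \<cdot>\<^sub>m (?t (Y - A) (Z - B) + ?t (Y + A) (Z + B)))"
    hence rc: "r < ?D" "c < ?D" by (auto simp: btensor_def bmat_def)
    show "(?t Y Z + ?t A B) $$ (r, c) =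
      (of_real (1 / 2) \<cdot>\<^sub>m (?t (Y - A) (Z - B) + ?t (Y + A) (Z + B))) $$ (r, c)"
      using rc c idx_less[OF rc(1)] idx_less[OF rc(2)]
        carrier_matD[OF btensor_carrier[of dA dB dA' dB']]
      by (simp add: btensor_index[OF rc]) (simp add: algebra_simps)
  qed (auto simp: btensor_def bmat_def)
  ultimately show ?thesis
    unfolding dominated_iff using p by (auto intro!: psd_smult psd_add psd_btensor simp del: of_real_divide)
qed

text \<open>The difference telescopes into (Y - A) tensor Z plus A tensor (Z - B), so it is positive
  once \<open>Z\<close> is, which follows from positivity of \<open>B\<close>.\<close>

lemma loewner_btensor:
  assumes A: "psd (dA * dB) A" and Y: "loewner_le (dA * dB) A Y"
    and B: "psd (dA' * dB') B" and Z: "loewner_le (dA' * dB') B Z"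
  shows "loewner_le (dA * dA' * (dB * dB')) (btensor dA dB dA' dB' A B) (btensor dA dB dA' dB' Y Z)"
proof -
  let ?D = "dA * dA' * (dB * dB')"
  have c: "A \<in> carrier_mat (dA * dB) (dA * dB)" "Y \<in> carrier_mat (dA * dB) (dA * dB)"
    "B \<in> carrier_mat (dA' * dB') (dA' * dB')" "Z \<in> carrier_mat (dA' * dB') (dA' * dB')"
    and p: "psd (dA * dB) (Y - A)" "psd (dA' * dB') (Z - B)"
    using Y Z by (auto simp: loewner_le_def)
  have "psd (dA' * dB') (B + (Z - B))" using B p by (intro psd_add)
  moreover have "B + (Z - B) = Z" using c by (intro eq_matI) auto
  ultimately have Zp: "psd (dA' * dB') Z" by simp
  let ?t = "btensor dA dB dA' dB'"
  have "?t Y Z - ?t A B = ?t (Y - A) Z + ?t A (Z - B)"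
  proof (rule eq_matI)
    fix r c assume "r < dim_row (?t (Y - A) Z + ?t A (Z - B))" "c < dim_col (?t (Y - A) Z + ?t A (Z - B))"
    hence rc: "r < ?D" "c < ?D" by (auto simp: btensor_def bmat_def)
    show "(?t Y Z - ?t A B) $$ (r, c) = (?t (Y - A) Z + ?t A (Z - B)) $$ (r, c)"
      using rc c idx_less[OF rc(1)] idx_less[OF rc(2)]
        carrier_matD[OF btensor_carrier[of dA dB dA' dB']]
      by (simp add: btensor_index[OF rc]) (simp add: algebra_simps)
  qed (auto simp: btensor_def bmat_def)
  thus ?thesis
    unfolding loewner_le_def using A Zp p by (auto intro!: psd_add psd_btensor)
qed

section \<open>Tensor powers\<close>

lemma btensor_power_carrier [simp]:
  "btensor_power dA dB M n \<in> carrier_mat (dA ^ n * dB ^ n) (dA ^ n * dB ^ n)"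
  by (cases n) auto

lemma psd_btensor_power: "psd (dA * dB) M \<Longrightarrow> psd (dA ^ n * dB ^ n) (btensor_power dA dB M n)"
  by (induction n) (auto simp: psd_one intro: psd_btensor)

lemma dominated_btensor_power:
  "dominated (dA * dB) A Y \<Longrightarrow> dominated (dA ^ n * dB ^ n) (btensor_power dA dB A n) (btensor_power dA dB Y n)"
  by (induction n) (auto simp: dominated_self psd_one intro: dominated_btensor)

lemma loewner_btensor_power:
  assumes "psd (dA * dB) A" "loewner_le (dA * dB) A Y"
  shows "loewner_le (dA ^ n * dB ^ n) (btensor_power dA dB A n) (btensor_power dA dB Y n)"
proof (induction n)
  case 0
  show ?case using dominated_self[OF psd_one[of 1]] by (simp add: dominated_def)
next
  case (Suc n)
  show ?case using loewner_btensor[OF assms psd_btensor_power[OF assms(1)] Suc] by simp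
qed

lemma mat_trace_one: "mat_trace (1\<^sub>m n) = of_nat n"
  by (simp add: mat_trace_def)

lemma mat_trace_btensor_power:
  "M \<in> carrier_mat (dA * dB) (dA * dB) \<Longrightarrow> mat_trace (btensor_power dA dB M n) = mat_trace M ^ n"
  by (induction n) (auto simp: mat_trace_one mat_trace_btensor)

lemma mat_trace_btensor_power_mult:
  assumes "M \<in> carrier_mat (dA * dB) (dA * dB)" "N \<in> carrier_mat (dA * dB) (dA * dB)"
  shows "mat_trace (btensor_power dA dB M n * btensor_power dA dB N n) = mat_trace (M * N) ^ n"
proof (induction n)
  case 0
  show ?case by (simp add: mat_trace_one)
next
  case (Suc n)
  thus ?case using assms by (simp add: mat_trace_btensor_mult)
qed

lemma ptranspose_btensor_power:
  assumes "M \<in> carrier_mat (dA * dB) (dA * dB)"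
  shows "ptranspose (dA ^ n) (dB ^ n) (btensor_power dA dB M n) = btensor_power dA dB (ptranspose dA dB M) n"
proof (induction n)
  case 0
  show ?case using ptranspose_one[of 1 1] by simp
next
  case (Suc n)
  thus ?case using assms by (simp add: ptranspose_btensor)
qed

text \<open>Off the diagonal, at least one component index differs, so the entries of a tensor
  product of multiples of the identity vanish there.\<close>

lemma idx_inj:
  assumes "r < dA * dA' * (dB * dB')" "c < dA * dA' * (dB * dB')"
    and eq: "fst_idx dB dA' dB' r = fst_idx dB dA' dB' c" "snd_idx dB dA' dB' r = snd_idx dB dA' dB' c"
  shows "r = c"
proof -
  have pos: "dB > 0" "dB' > 0" using assms by (auto intro: Nat.gr0I)
  have 1: "x mod (dB * dB') div dB' < dB" for x using pos by (intro div_less) auto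
  have "x div (dB * dB') div dA' = fst_idx dB dA' dB' x div dB"
    "x mod (dB * dB') div dB' = fst_idx dB dA' dB' x mod dB"
    "x div (dB * dB') mod dA' = snd_idx dB dA' dB' x div dB'"
    "x mod (dB * dB') mod dB' = snd_idx dB dA' dB' x mod dB'" for x
    using pos 1[of x] by (auto simp: fst_idx_def snd_idx_def)
  hence *: "r div (dB * dB') div dA' = c div (dB * dB') div dA'"
    "r mod (dB * dB') div dB' = c mod (dB * dB') div dB'"
    "r div (dB * dB') mod dA' = c div (dB * dB') mod dA'"
    "r mod (dB * dB') mod dB' = c mod (dB * dB') mod dB'"
    by (simp_all only: eq)
  have "r div (dB * dB') = c div (dB * dB')" using *(1,3) by (metis div_mult_mod_eq)
  moreover have "r mod (dB * dB') = c mod (dB * dB')" using *(2,4) by (metis div_mult_mod_eq)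
  ultimately show ?thesis by (metis div_mult_mod_eq)
qed

lemma btensor_power_smult_one:
  "btensor_power dA dB (c \<cdot>\<^sub>m 1\<^sub>m (dA * dB)) n = c ^ n \<cdot>\<^sub>m 1\<^sub>m (dA ^ n * dB ^ n)"
proof (induction n)
  case (Suc n)
  show ?case
  proof (rule eq_matI)
    fix i j assume "i < dim_row (c ^ Suc n \<cdot>\<^sub>m 1\<^sub>m (dA ^ Suc n * dB ^ Suc n))"
      "j < dim_col (c ^ Suc n \<cdot>\<^sub>m 1\<^sub>m (dA ^ Suc n * dB ^ Suc n))"
    hence ij: "i < dA * dA ^ n * (dB * dB ^ n)" "j < dA * dA ^ n * (dB * dB ^ n)" by auto
    show "btensor_power dA dB (c \<cdot>\<^sub>m 1\<^sub>m (dA * dB)) (Suc n) $$ (i, j) =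
      (c ^ Suc n \<cdot>\<^sub>m 1\<^sub>m (dA ^ Suc n * dB ^ Suc n)) $$ (i, j)"
      using ij idx_less[OF ij(1)] idx_less[OF ij(2)] idx_inj[OF ij]
      by (auto simp: Suc btensor_index[OF ij])
  qed (auto simp: btensor_def bmat_def)
qed (auto intro: eq_matI)

section \<open>Completely positive maps\<close>

text \<open>The trivial ancilla is what turns complete positivity into positivity of the map
  itself.\<close>

lemma ampliation_one:
  assumes L: "linear_op_map d d' L" and X: "X \<in> carrier_mat d d"
  shows "ampliation 1 d d' L X = L X"
proof (rule eq_matI)
  have X': "mat d d (\<lambda>(u, v). X $$ (u, v)) = X" using X by (intro eq_matI) auto
  have LX: "L X \<in> carrier_mat d' d'" using L X by (simp add: linear_op_map_def)
  fix i j assume "i < dim_row (L X)" "j < dim_col (L X)"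
  thus "ampliation 1 d d' L X $$ (i, j) = L X $$ (i, j)"
    using LX X' by (simp add: ampliation_def bmat_def bentry_def)
qed (use assms in \<open>auto simp: ampliation_def bmat_def linear_op_map_def\<close>)

lemma cp_linear: "completely_positive d d' L \<Longrightarrow> linear_op_map d d' L"
  by (simp add: completely_positive_def)

lemma cp_carrier: "completely_positive d d' L \<Longrightarrow> X \<in> carrier_mat d d \<Longrightarrow> L X \<in> carrier_mat d' d'"
  by (simp add: completely_positive_def linear_op_map_def)

lemma cp_psd:
  assumes L: "completely_positive d d' L" and X: "psd d X"
  shows "psd d' (L X)"
proof -
  have "psd (1 * d) X \<longrightarrow> psd (1 * d') (ampliation 1 d d' L X)"
    using L unfolding completely_positive_def by blast
  thus ?thesis using X ampliation_one[OF cp_linear[OF L] psd_carrier[OF X]] by simp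
qed

lemma cp_add:
  "completely_positive d d' L \<Longrightarrow> X \<in> carrier_mat d d \<Longrightarrow> Y \<in> carrier_mat d d \<Longrightarrow> L (X + Y) = L X + L Y"
  by (simp add: completely_positive_def linear_op_map_def)

lemma cp_minus:
  assumes L: "completely_positive d d' L" and X: "X \<in> carrier_mat d d" and Y: "Y \<in> carrier_mat d d"
  shows "L (X - Y) = L X - L Y"
proof -
  have c: "L X \<in> carrier_mat d' d'" "L Y \<in> carrier_mat d' d'" using L X Y by (auto simp: cp_carrier)
  have "X - Y = X + (- 1) \<cdot>\<^sub>m Y" using X Y by (intro eq_matI) auto
  hence "L (X - Y) = L X + L ((- 1) \<cdot>\<^sub>m Y)" using cp_add[OF L X, of "(- 1) \<cdot>\<^sub>m Y"] Y by simp
  also have "L ((- 1) \<cdot>\<^sub>m Y) = (- 1) \<cdot>\<^sub>m L Y"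
    using cp_linear[OF L] Y unfolding linear_op_map_def by blast
  also have "L X + (- 1) \<cdot>\<^sub>m L Y = L X - L Y" using c by (intro eq_matI) auto
  finally show ?thesis .
qed

lemma cp_dominated:
  assumes L: "completely_positive d d' L" and A: "dominated d A Y"
  shows "dominated d' (L A) (L Y)"
  using A cp_psd[OF L, of "Y - A"] cp_psd[OF L, of "Y + A"]
  by (auto simp: dominated_iff cp_carrier[OF L] cp_add[OF L] cp_minus[OF L])

lemma cp_loewner:
  assumes L: "completely_positive d d' L" and A: "loewner_le d A Y"
  shows "loewner_le d' (L A) (L Y)"
  using A cp_psd[OF L, of "Y - A"]
  by (auto simp: loewner_le_def cp_carrier[OF L] cp_minus[OF L])

text \<open>The projection onto the first basis vector; on a bipartite space this is a product
  vector, so the projection is fixed by the partial transpose.\<close>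

definition E00 :: "nat \<Rightarrow> complex mat" where
  "E00 d = mat d d (\<lambda>(i, j). if i = 0 \<and> j = 0 then 1 else 0)"

text \<open>This channel discards its input and prepares a fixed pure state. Prescribing
  \<open>L\<close> only on the carrier covers the reset map and its conjugate by partial transposes
  alike.\<close>

lemma cp_trace_map:
  assumes L: "\<And>X. X \<in> carrier_mat d d \<Longrightarrow> L X = mat_trace X \<cdot>\<^sub>m E00 d'"
  shows "completely_positive d d' L"
  unfolding completely_positive_def
proof (intro conjI allI impI)
  have E: "E00 d' \<in> carrier_mat d' d'" by (simp add: E00_def)
  show "linear_op_map d d' L"
    unfolding linear_op_map_def using E
    by (auto simp: L mat_trace_add mat_trace_smult add_smult_distrib_right_mat intro!: eq_matI)
  fix k M assume "psd (k * d) M"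
  then obtain f :: "nat \<Rightarrow> nat \<Rightarrow> complex" where
    f: "\<forall>a<k * d. \<forall>b<k * d. M $$ (a, b) = (\<Sum>l<k * d. f l a * cnj (f l b))"
    by (rule psd_decomposition)
  \<comment> \<open>One vector for each discarded basis state \<open>u\<close> and each rank-one
    term \<open>l\<close> of \<open>M\<close>: the entries of \<open>f l\<close> at position
    \<open>u\<close> of every block, tensored with the first basis vector of the output.\<close>
  let ?h = "\<lambda>(u, l) r. if r mod d' = 0 then f l (r div d' * d + u) else 0"
  show "psd (k * d') (ampliation k d d' L M)"
  proof (rule psdI_sum[of _ _ "{..<d} \<times> {..<k * d}" ?h])
    fix r c assume rc: "r < k * d'" "c < k * d'"
    have "ampliation k d d' L M $$ (r, c) =
      mat_trace (mat d d (\<lambda>(u, v). M $$ (r div d' * d + u, c div d' * d + v))) * E00 d' $$ (r mod d', c mod d')"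
      using rc mod_less[OF rc(1)] mod_less[OF rc(2)] E
      by (simp add: ampliation_def bmat_def bentry_def L)
    also have "\<dots> = (\<Sum>u<d. M $$ (r div d' * d + u, c div d' * d + u)) *
        (if r mod d' = 0 \<and> c mod d' = 0 then 1 else 0)"
      using mod_less[OF rc(1)] mod_less[OF rc(2)] by (simp add: mat_trace_def E00_def)
    also have "\<dots> = (\<Sum>u<d. \<Sum>l<k * d. ?h (u, l) r * cnj (?h (u, l) c))"
    proof -
      have "M $$ (r div d' * d + u, c div d' * d + u) =
        (\<Sum>l<k * d. f l (r div d' * d + u) * cnj (f l (c div d' * d + u)))" if "u < d" for u
        using f index_less[OF div_less[OF rc(1)] that] index_less[OF div_less[OF rc(2)] that] by blast
      thus ?thesis by (auto intro!: sum.cong)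
    qed
    also have "\<dots> = (\<Sum>p\<in>{..<d} \<times> {..<k * d}. ?h p r * cnj (?h p c))"
      by (simp only: sum.cartesian_product split_def prod.collapse fst_conv snd_conv)
    finally show "ampliation k d d' L M $$ (r, c) = (\<Sum>p\<in>{..<d} \<times> {..<k * d}. ?h p r * cnj (?h p c))" .
  qed (auto simp: ampliation_def bmat_def)
qed

lemma ptranspose_E00: "ptranspose dA dB (E00 (dA * dB)) = E00 (dA * dB)"
proof (rule eq_matI)
  fix r c assume "r < dim_row (E00 (dA * dB))" "c < dim_col (E00 (dA * dB))"
  hence rc: "r < dA * dB" "c < dA * dB" by (auto simp: E00_def)
  have "r div dB * dB + c mod dB = 0 \<and> c div dB * dB + r mod dB = 0 \<longleftrightarrow> r = 0 \<and> c = 0"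
    by (metis add_is_0 div_mult_mod_eq mod_0 div_0 mult_0)
  thus "ptranspose dA dB (E00 (dA * dB)) $$ (r, c) = E00 (dA * dB) $$ (r, c)"
    using rc ptranspose_index_less[OF rc] ptranspose_index_less[OF rc(2,1)]
    by (simp add: ptranspose_index E00_def)
qed (auto simp: E00_def ptranspose_def bmat_def)

text \<open>Ensures that the infima over operations in \<open>E_D\<close> and \<open>E_C\<close>
  range over nonempty sets. The reset map works because conjugation by partial transposes leaves it
  unchanged.\<close>

lemma ppt_operation_exists:
  assumes "dA' > 0" "dB' > 0"
  shows "\<exists>L. ppt_operation dA dB dA' dB' L"
proof
  let ?d = "dA * dB" and ?d' = "dA' * dB'"
  let ?L = "\<lambda>X. mat_trace X \<cdot>\<^sub>m E00 ?d'"
  have E: "E00 ?d' \<in> carrier_mat ?d' ?d'" by (simp add: E00_def)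
  have "mat_trace (E00 ?d') = (\<Sum>i<?d'. if i = 0 then 1 else 0)"
    unfolding mat_trace_def E00_def by (auto intro!: sum.cong)
  hence "mat_trace (E00 ?d') = 1" using assms by simp
  hence "cptp ?d ?d' ?L"
    unfolding cptp_def using E by (auto intro: cp_trace_map simp: mat_trace_smult)
  moreover have "completely_positive ?d ?d' (ptranspose dA' dB' \<circ> ?L \<circ> ptranspose dA dB)"
    by (rule cp_trace_map)
      (use E in \<open>simp add: mat_trace_ptranspose ptranspose_smult ptranspose_E00\<close>)
  ultimately show "ppt_operation dA dB dA' dB' ?L" by (simp add: ppt_operation_def)
qed

section \<open>The maximally entangled state\<close>

lemma max_entangled_index:
  "i < 4 \<Longrightarrow> j < 4 \<Longrightarrow> max_entangled $$ (i, j) = (if i \<in> {0, 3} \<and> j \<in> {0, 3} then 1 / 2 else 0)"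
proof -
  have "complex_of_real (sqrt 2) * complex_of_real (sqrt 2) = 2" by (simp flip: of_real_mult)
  moreover assume "i < 4" "j < 4"
  hence "i \<in> {0, 1, 2, 3}" "j \<in> {0, 1, 2, 3}" by auto
  ultimately show ?thesis
    by (auto simp: max_entangled_def proj_def ket2_def)
qed

lemma max_entangled_carrier [simp]: "max_entangled \<in> carrier_mat 4 4"
  by (simp add: max_entangled_def proj_def ket2_def)

lemma less_4_cases: "i < 4 \<Longrightarrow> i = 0 \<or> i = 1 \<or> i = 2 \<or> i = (3 :: nat)"
  by auto

lemma psd_max_entangled: "psd 4 max_entangled"
  by (rule psdI_weighted_sum[of _ _ "{0}" "\<lambda>_. 1 / 2" "\<lambda>_ a. if a \<in> {0, 3} then 1 else 0"])
    (auto simp: max_entangled_index)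

lemma max_entangled_le_one: "loewner_le 4 max_entangled (1\<^sub>m 4)"
  unfolding loewner_le_def
proof (intro conjI)
  show "psd 4 (1\<^sub>m 4 - max_entangled)"
  \<comment> \<open>The complement of the maximally entangled vector is spanned by |00> - |11>, |01>
    and |10>; the weight 1/2 normalises the first.\<close>
  proof (rule psdI_weighted_sum[of _ _ "{0, 1, 2::nat}" "\<lambda>k. if k = 0 then 1 / 2 else 1"
        "\<lambda>k a. if k = 0 then (if a = 0 then 1 else if a = 3 then - 1 else 0) else if a = k then 1 else 0"])
    fix a b :: nat assume "a < 4" "b < 4"
    thus "(1\<^sub>m 4 - max_entangled) $$ (a, b) =
       (\<Sum>k\<in>{0, 1, 2}. complex_of_real (if k = 0 then 1 / 2 else 1) *
          (if k = 0 then (if a = 0 then 1 else if a = 3 then - 1 else 0) else if a = k then 1 else 0) *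
          cnj (if k = 0 then (if b = 0 then 1 else if b = 3 then - 1 else 0) else if b = k then 1 else 0))"
      using carrier_matD[OF max_entangled_carrier]
      by (auto dest!: less_4_cases simp: max_entangled_index)
  qed (auto intro: minus_carrier_mat)
qed auto

lemma mat_trace_max_entangled: "mat_trace (max_entangled * max_entangled) = 1"
proof -
  have "{..<4::nat} = {0, 1, 2, 3}" by auto
  thus ?thesis by (subst mat_trace_mult[of _ 4 4]) (simp_all add: max_entangled_index)
qed

text \<open>With F the swap, the two differences are (1 - F) / 2 and (1 + F) / 2, the projections
  onto the antisymmetric and the symmetric subspace.\<close>

lemma dominated_ptranspose_max_entangled:
  "dominated 4 (ptranspose 2 2 max_entangled) ((1 / 2) \<cdot>\<^sub>m 1\<^sub>m 4)"
proof -
  have [simp]: "ptranspose 2 2 max_entangled \<in> carrier_mat 4 4"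
    using ptranspose_carrier[of 2 2 max_entangled] by simp
  have pt: "ptranspose 2 2 max_entangled $$ (a, b) =
    (if (a, b) \<in> {(0, 0), (3, 3), (1, 2), (2, 1)} then 1 / 2 else 0)" if "a < 4" "b < 4" for a b
    using less_4_cases[OF that(1)] less_4_cases[OF that(2)]
    by (auto simp: ptranspose_index max_entangled_index)
  have "psd 4 ((1 / 2) \<cdot>\<^sub>m 1\<^sub>m 4 - ptranspose 2 2 max_entangled)"
    by (rule psdI_weighted_sum[of _ _ "{0}" "\<lambda>_. 1 / 2" "\<lambda>_ a. if a = 1 then 1 else if a = 2 then - 1 else 0"])
      (use carrier_matD[of "ptranspose 2 2 max_entangled" 4 4] in \<open>auto dest!: less_4_cases simp: pt\<close>)
  moreover have "psd 4 ((1 / 2) \<cdot>\<^sub>m 1\<^sub>m 4 + ptranspose 2 2 max_entangled)"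
  proof (rule psdI_weighted_sum[of _ _ "{0, 1, 3::nat}" "\<lambda>k. if k = 1 then 1 / 2 else 1"
        "\<lambda>k a. if k = a \<or> k = 1 \<and> a = 2 then 1 else 0"])
    fix a b :: nat assume "a < 4" "b < 4"
    thus "((1 / 2) \<cdot>\<^sub>m 1\<^sub>m 4 + ptranspose 2 2 max_entangled) $$ (a, b) =
       (\<Sum>k\<in>{0, 1, 3}. complex_of_real (if k = 1 then 1 / 2 else 1) *
          (if k = a \<or> k = 1 \<and> a = 2 then 1 else 0) * cnj (if k = b \<or> k = 1 \<and> b = 2 then 1 else 0))"
      using carrier_matD[of "ptranspose 2 2 max_entangled" 4 4]
      by (auto dest!: less_4_cases simp: pt)
  qed auto
  ultimately show ?thesis by (simp add: dominated_iff)
qed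

section \<open>Bounds for PPT operations\<close>

lemma dominated_uminus: "dominated d A Y \<Longrightarrow> dominated d (- A) Y"
proof -
  assume *: "dominated d A Y"
  hence "Y - - A = Y + A" "Y + - A = Y - A" by (auto simp: dominated_iff intro!: eq_matI)
  thus ?thesis using * by (simp add: dominated_iff)
qed

lemma trace_norm_nonneg:
  assumes H: "hermitian d H" shows "0 \<le> trace_norm H"
proof -
  obtain u c where "spectral_form d H u c" by (rule spectral_decomposition[OF H])
  thus ?thesis by (simp add: trace_norm_spectral[OF H] sum_nonneg)
qed

text \<open>\<open>Y + A\<close> is \<open>Y - A\<close> plus twice the positive
  \<open>A\<close>.\<close>

lemma dominated_psd_le:
  assumes "psd d A" "loewner_le d A Y"
  shows "dominated d A Y"
proof -
  have "Y + A = (Y - A) + (A + A)" "psd d ((Y - A) + (A + A))"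
    using assms by (auto simp: loewner_le_def intro!: eq_matI psd_add)
  thus ?thesis using assms by (simp add: dominated_iff loewner_le_def)
qed

lemma trace_mult_ge_uminus_trace_norm:
  assumes "hermitian d H" "dominated d A (1\<^sub>m d)"
  shows "- trace_norm H \<le> Re (mat_trace (A * H))"
proof -
  have c: "A \<in> carrier_mat d d" "H \<in> carrier_mat d d" using assms by (auto simp: dominated_iff hermitian_def)
  have "mat_trace (- A * H) = - mat_trace (A * H)"
    using c by (simp add: mat_trace_def sum_negf)
  thus ?thesis using trace_mult_le_trace_norm[OF assms(1) dominated_uminus[OF assms(2)]] by simp
qed

lemma mat_trace_hermitian:
  assumes "hermitian d A"
  shows "mat_trace A = of_real (Re (mat_trace A))"
proof -
  have "A $$ (i, i) = of_real (Re (A $$ (i, i)))" if "i < d" for i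
    using hermitian_cnj[OF assms that that] by (simp add: complex_eq_iff)
  thus ?thesis using hermitian_carrier[OF assms] by (simp add: mat_trace_def)
qed

lemma ppt_operation_psd:
  assumes "ppt_operation dA dB dA' dB' L" "psd (dA * dB) X"
  shows "psd (dA' * dB') (L X)"
  using assms by (auto simp: ppt_operation_def cptp_def intro: cp_psd)

text \<open>The PPT condition enters here: conjugated by partial transposes, \<open>L\<close> is
  positive and maps the transpose of \<open>X\<close> to the transpose of \<open>L X\<close>, so it
  carries a bound on the former to one on the latter.\<close>

lemma ppt_operation_ptranspose:
  assumes L: "ppt_operation dA dB dA' dB' L" and X: "X \<in> carrier_mat (dA * dB) (dA * dB)"
    and K: "dominated (dA * dB) (ptranspose dA dB X) K"
  shows "dominated (dA' * dB') (ptranspose dA' dB' (L X)) (ptranspose dA' dB' (L (ptranspose dA dB K)))"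
proof -
  have "completely_positive (dA * dB) (dA' * dB') (ptranspose dA' dB' \<circ> L \<circ> ptranspose dA dB)"
    using L by (simp add: ppt_operation_def)
  from cp_dominated[OF this K] show ?thesis by (simp add: ptranspose_ptranspose[OF X])
qed

lemma ppt_operation_trace:
  assumes "ppt_operation dA dB dA' dB' L" "X \<in> carrier_mat (dA * dB) (dA * dB)"
  shows "mat_trace (L X) = mat_trace X"
  using assms by (simp add: ppt_operation_def cptp_def)

lemma ppt_operation_carrier:
  assumes "ppt_operation dA dB dA' dB' L" "X \<in> carrier_mat (dA * dB) (dA * dB)"
  shows "L X \<in> carrier_mat (dA' * dB') (dA' * dB')"
  using assms by (auto simp: ppt_operation_def cptp_def intro: cp_carrier)

lemma
  shows psd_max_entangled_power: "psd (2 ^ m * 2 ^ m) (btensor_power 2 2 max_entangled m)"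
    and max_entangled_power_le_one:
      "loewner_le (2 ^ m * 2 ^ m) (btensor_power 2 2 max_entangled m) (1\<^sub>m (2 ^ m * 2 ^ m))"
    and mat_trace_max_entangled_power:
      "mat_trace (btensor_power 2 2 max_entangled m * btensor_power 2 2 max_entangled m) = 1"
    and dominated_ptranspose_max_entangled_power:
      "dominated (2 ^ m * 2 ^ m) (ptranspose (2 ^ m) (2 ^ m) (btensor_power 2 2 max_entangled m))
        ((1 / 2) ^ m \<cdot>\<^sub>m 1\<^sub>m (2 ^ m * 2 ^ m))"
proof -
  have c: "max_entangled \<in> carrier_mat (2 * 2) (2 * 2)" by simp
  show "psd (2 ^ m * 2 ^ m) (btensor_power 2 2 max_entangled m)"
    by (rule psd_btensor_power) (simp add: psd_max_entangled)
  have "btensor_power 2 2 (1\<^sub>m (2 * 2)) m = 1\<^sub>m (2 ^ m * 2 ^ m)"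
  proof -
    have "1 \<cdot>\<^sub>m 1\<^sub>m n = (1\<^sub>m n :: complex mat)" for n by (intro eq_matI) auto
    thus ?thesis using btensor_power_smult_one[of 2 2 1 m] by simp
  qed
  thus "loewner_le (2 ^ m * 2 ^ m) (btensor_power 2 2 max_entangled m) (1\<^sub>m (2 ^ m * 2 ^ m))"
    using loewner_btensor_power[of 2 2 max_entangled "1\<^sub>m (2 * 2)" m] psd_max_entangled max_entangled_le_one
    by simp
  show "mat_trace (btensor_power 2 2 max_entangled m * btensor_power 2 2 max_entangled m) = 1"
    using mat_trace_btensor_power_mult[OF c c] by (simp add: mat_trace_max_entangled)
  show "dominated (2 ^ m * 2 ^ m) (ptranspose (2 ^ m) (2 ^ m) (btensor_power 2 2 max_entangled m))
        ((1 / 2) ^ m \<cdot>\<^sub>m 1\<^sub>m (2 ^ m * 2 ^ m))"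
    using dominated_btensor_power[of 2 2 "ptranspose 2 2 max_entangled" "(1 / 2) \<cdot>\<^sub>m 1\<^sub>m (2 * 2)" m]
      btensor_power_smult_one[of 2 2 "1 / 2" m] dominated_ptranspose_max_entangled
    by (simp add: ptranspose_btensor_power[OF c])
qed

text \<open>Since \<Phi> is pure and lies between 0 and 1, the error in trace norm limits how far
  its overlap with the output falls below 1. It remains to bound this overlap from above through the
  partial transposes.\<close>

lemma distillation_bound:
  assumes rho: "psd (dA * dB) \<rho>" and X: "loewner_le (dA * dB) \<rho> X"
    and herm: "hermitian (dA * dB) X"
    and L: "ppt_operation (dA ^ n) (dB ^ n) (2 ^ m) (2 ^ m) L"
  shows "1 - trace_norm (L (btensor_power dA dB \<rho> n) - btensor_power 2 2 max_entangled m)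
    \<le> trace_norm (ptranspose dA dB X) ^ n / 2 ^ m"
proof -
  let ?D = "2 ^ m * 2 ^ m :: nat" and ?d = "dA ^ n * dB ^ n"
  define \<Phi> where "\<Phi> = btensor_power 2 2 max_entangled m"
  define R where "R = btensor_power dA dB \<rho> n"
  define Z where "Z = btensor_power dA dB X n"
  have Phi: "psd ?D \<Phi>" "dominated ?D \<Phi> (1\<^sub>m ?D)" "\<Phi> \<in> carrier_mat ?D ?D"
    unfolding \<Phi>_def by (auto intro: psd_max_entangled_power dominated_psd_le max_entangled_power_le_one)
  have Xc: "X \<in> carrier_mat (dA * dB) (dA * dB)" by (rule hermitian_carrier[OF herm])
  have c: "R \<in> carrier_mat ?d ?d" "Z \<in> carrier_mat ?d ?d" by (simp_all add: R_def Z_def)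
  have "psd ?d R" unfolding R_def by (rule psd_btensor_power[OF rho])
  hence LR: "psd ?D (L R)" by (rule ppt_operation_psd[OF L])
  have LRc: "L R \<in> carrier_mat ?D ?D" "L Z \<in> carrier_mat ?D ?D"
    using c by (auto intro: ppt_operation_carrier[OF L])
  \<comment> \<open>The tensor power of an optimal one-copy bound has the required power of the
    trace norm as its trace.\<close>
  obtain K where K: "dominated (dA * dB) (ptranspose dA dB X) K"
    "Re (mat_trace K) = trace_norm (ptranspose dA dB X)"
    by (rule trace_norm_dominated[OF hermitian_ptranspose[OF herm]])
  define Kn where "Kn = btensor_power dA dB K n"
  have Kc: "Kn \<in> carrier_mat ?d ?d" "K \<in> carrier_mat (dA * dB) (dA * dB)"
    using K by (simp_all add: Kn_def dominated_iff)
  have trK: "mat_trace Kn = of_real (trace_norm (ptranspose dA dB X) ^ n)"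
    using mat_trace_hermitian[of "dA * dB" K] dominated_hermitian(2)[OF K(1)] K(2) Kc
    by (simp add: Kn_def mat_trace_btensor_power psd_def)
  let ?N = "ptranspose (2 ^ m) (2 ^ m) (L (ptranspose (dA ^ n) (dB ^ n) Kn))"
  have "ptranspose (dA ^ n) (dB ^ n) Z = btensor_power dA dB (ptranspose dA dB X) n"
    unfolding Z_def by (rule ptranspose_btensor_power[OF Xc])
  hence "dominated ?d (ptranspose (dA ^ n) (dB ^ n) Z) Kn"
    using dominated_btensor_power[OF K(1)] by (simp add: Kn_def)
  from ppt_operation_ptranspose[OF L c(2) this]
  have N: "dominated ?D (ptranspose (2 ^ m) (2 ^ m) (L Z)) ?N" .
  have "mat_trace ?N = mat_trace (ptranspose (dA ^ n) (dB ^ n) Kn)"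
    by (simp add: mat_trace_ptranspose ppt_operation_carrier[OF L] ppt_operation_trace[OF L])
  also have "\<dots> = mat_trace Kn" by (rule mat_trace_ptranspose[OF Kc(1)])
  finally have trN: "mat_trace ?N = of_real (trace_norm (ptranspose dA dB X) ^ n)" using trK by simp
  have "1 - trace_norm (L R - \<Phi>) \<le> Re (mat_trace (\<Phi> * L R))"
  proof -
    have "hermitian ?D (L R - \<Phi>)" using LR Phi by (auto simp: psd_def intro: hermitian_minus)
    from trace_mult_ge_uminus_trace_norm[OF this Phi(2)]
    have "- trace_norm (L R - \<Phi>) \<le> Re (mat_trace (\<Phi> * (L R - \<Phi>)))" .
    also have "\<Phi> * (L R - \<Phi>) = \<Phi> * L R - \<Phi> * \<Phi>"
      using LRc Phi by (intro mult_minus_distrib_mat) auto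
    also have "mat_trace \<dots> = mat_trace (\<Phi> * L R) - 1"
      using LRc Phi mat_trace_max_entangled_power[of m]
      by (subst mat_trace_minus[of _ ?D]) (auto simp: \<Phi>_def intro: mult_carrier_mat[of _ ?D ?D _ ?D])
    finally show ?thesis by simp
  qed
  also have "\<dots> \<le> Re (mat_trace (\<Phi> * L Z))"
  proof (rule mat_trace_mult_mono[OF Phi(1)])
    have "completely_positive ?d ?D L" using L by (simp add: ppt_operation_def cptp_def)
    thus "loewner_le ?D (L R) (L Z)"
      unfolding R_def Z_def by (rule cp_loewner[OF _ loewner_btensor_power[OF rho X]])
  qed
  also have "\<dots> = Re (mat_trace (ptranspose (2 ^ m) (2 ^ m) \<Phi> * ptranspose (2 ^ m) (2 ^ m) (L Z)))"
    by (simp only: mat_trace_ptranspose_mult[OF Phi(3) LRc(2)])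
  also have "\<dots> \<le> Re (mat_trace (((1 / 2) ^ m \<cdot>\<^sub>m 1\<^sub>m ?D) * ?N))"
    using dominated_ptranspose_max_entangled_power[of m] N unfolding \<Phi>_def by (rule dominated_trace_mult)
  also have "((1 / 2) ^ m \<cdot>\<^sub>m 1\<^sub>m ?D) * ?N = (1 / 2) ^ m \<cdot>\<^sub>m ?N"
    by (subst mult_smult_assoc_mat[of _ ?D ?D _ ?D]) (auto intro!: left_mult_one_mat[of _ ?D ?D] arg_cong2[where f=smult_mat])
  also have "mat_trace \<dots> = (1 / 2) ^ m * mat_trace ?N" by (rule mat_trace_smult) (rule ptranspose_carrier)
  also have "Re \<dots> = trace_norm (ptranspose dA dB X) ^ n / 2 ^ m"
  proof -
    have "(1 / 2) ^ m = complex_of_real ((1 / 2) ^ m)" by simp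
    hence "(1 / 2) ^ m * mat_trace ?N = of_real ((1 / 2) ^ m * trace_norm (ptranspose dA dB X) ^ n)"
      unfolding trN by (simp only: of_real_mult)
    thus ?thesis by (simp only: Re_complex_of_real) (simp add: power_divide)
  qed
  finally show ?thesis unfolding R_def \<Phi>_def .
qed

text \<open>\<open>P\<close> is a test that \<rho> passes with certainty, and its tensor power is
  such a test for n copies; an output close to the target must then pass it with probability at
  least 1 minus the error.\<close>

lemma cost_bound:
  assumes P: "psd (dA * dB) P" "loewner_le (dA * dB) P (1\<^sub>m (dA * dB))"
    and rho: "psd (dA * dB) \<rho>" and tr: "mat_trace (P * \<rho>) = 1"
    and Y: "dominated (dA * dB) (ptranspose dA dB P) Y"
    and L: "ppt_operation (2 ^ m) (2 ^ m) (dA ^ n) (dB ^ n) L"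
  shows "1 - trace_norm (btensor_power dA dB \<rho> n - L (btensor_power 2 2 max_entangled m))
    \<le> 2 ^ m * op_norm (ptranspose dA dB Y) ^ n"
proof -
  let ?D = "2 ^ m * 2 ^ m :: nat" and ?d = "dA ^ n * dB ^ n"
  let ?c = "op_norm (ptranspose dA dB Y)"
  define \<Phi> where "\<Phi> = btensor_power 2 2 max_entangled m"
  define R where "R = btensor_power dA dB \<rho> n"
  define Q where "Q = btensor_power dA dB P n"
  define Z where "Z = btensor_power dA dB Y n"
  have Yc: "Y \<in> carrier_mat (dA * dB) (dA * dB)" using Y by (simp add: dominated_iff)
  have Pc: "P \<in> carrier_mat (dA * dB) (dA * dB)" by (rule psd_carrier[OF P(1)])
  have c: "\<Phi> \<in> carrier_mat ?D ?D" "R \<in> carrier_mat ?d ?d" "Q \<in> carrier_mat ?d ?d"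
    "Z \<in> carrier_mat ?d ?d" by (simp_all add: \<Phi>_def R_def Q_def Z_def)
  have Lc: "L \<Phi> \<in> carrier_mat ?d ?d" "L (1\<^sub>m ?D) \<in> carrier_mat ?d ?d"
    using c by (auto intro: ppt_operation_carrier[OF L])
  have one: "btensor_power dA dB (1\<^sub>m (dA * dB)) n = 1\<^sub>m ?d"
  proof -
    have "1 \<cdot>\<^sub>m 1\<^sub>m n = (1\<^sub>m n :: complex mat)" for n by (intro eq_matI) auto
    thus ?thesis using btensor_power_smult_one[of dA dB 1 n] by simp
  qed
  have Q: "dominated ?d Q (1\<^sub>m ?d)"
    using loewner_btensor_power[OF P, of n] psd_btensor_power[OF P(1), of n]
    unfolding one Q_def by (intro dominated_psd_le)
  have "psd ?D \<Phi>" unfolding \<Phi>_def by (rule psd_max_entangled_power)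
  hence "psd ?d (L \<Phi>)" by (rule ppt_operation_psd[OF L])
  moreover have "psd ?d R" unfolding R_def by (rule psd_btensor_power[OF rho])
  ultimately have H: "hermitian ?d (R - L \<Phi>)" by (auto simp: psd_def intro: hermitian_minus)
  have trQ: "mat_trace (Q * R) = 1"
    unfolding Q_def R_def using mat_trace_btensor_power_mult[OF Pc psd_carrier[OF rho]] tr by simp
  have "Re (mat_trace (Q * (R - L \<Phi>))) \<le> trace_norm (R - L \<Phi>)"
    by (rule trace_mult_le_trace_norm[OF H Q])
  moreover have "Q * (R - L \<Phi>) = Q * R - Q * L \<Phi>" using c Lc by (intro mult_minus_distrib_mat) auto
  hence "mat_trace (Q * (R - L \<Phi>)) = 1 - mat_trace (Q * L \<Phi>)"
    using c Lc trQ by (simp add: mat_trace_minus[of _ ?d])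
  ultimately have "1 - trace_norm (R - L \<Phi>) \<le> Re (mat_trace (Q * L \<Phi>))" by simp
  also have "mat_trace (Q * L \<Phi>) =
    mat_trace (ptranspose (dA ^ n) (dB ^ n) Q * ptranspose (dA ^ n) (dB ^ n) (L \<Phi>))"
    by (simp only: mat_trace_ptranspose_mult[OF c(3) Lc(1)])
  also have "Re \<dots> \<le> Re (mat_trace (Z * ((1 / 2) ^ m \<cdot>\<^sub>m ptranspose (dA ^ n) (dB ^ n) (L (1\<^sub>m ?D)))))"
  proof (rule dominated_trace_mult)
    show "dominated ?d (ptranspose (dA ^ n) (dB ^ n) Q) Z"
      unfolding Q_def Z_def ptranspose_btensor_power[OF Pc] by (rule dominated_btensor_power[OF Y])
    \<comment> \<open>The partial transpose fixes multiples of the identity, so the bound on the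
      transposed \<Phi> is carried to a multiple of the transpose of
      \<open>L (1\<^sub>m ?D)\<close>.\<close>
    have "ptranspose (2 ^ m) (2 ^ m) ((1 / 2) ^ m \<cdot>\<^sub>m 1\<^sub>m ?D) = (1 / 2) ^ m \<cdot>\<^sub>m (1\<^sub>m ?D :: complex mat)"
      by (simp add: ptranspose_smult ptranspose_one)
    moreover have "L ((1 / 2) ^ m \<cdot>\<^sub>m 1\<^sub>m ?D) = (1 / 2) ^ m \<cdot>\<^sub>m L (1\<^sub>m ?D)"
      using L by (auto simp: ppt_operation_def cptp_def completely_positive_def linear_op_map_def)
    moreover note ppt_operation_ptranspose[OF L c(1) dominated_ptranspose_max_entangled_power[of m, folded \<Phi>_def]]
    ultimately show "dominated ?d (ptranspose (dA ^ n) (dB ^ n) (L \<Phi>))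
        ((1 / 2) ^ m \<cdot>\<^sub>m ptranspose (dA ^ n) (dB ^ n) (L (1\<^sub>m ?D)))"
      by (simp add: ptranspose_smult[OF Lc(2)])
  qed
  also have "Z * ((1 / 2) ^ m \<cdot>\<^sub>m ptranspose (dA ^ n) (dB ^ n) (L (1\<^sub>m ?D))) =
      (1 / 2) ^ m \<cdot>\<^sub>m (Z * ptranspose (dA ^ n) (dB ^ n) (L (1\<^sub>m ?D)))"
    by (rule mult_smult_distrib[of _ ?d ?d _ ?d]) (simp_all add: c)
  also have "mat_trace \<dots> = (1 / 2) ^ m * mat_trace (Z * ptranspose (dA ^ n) (dB ^ n) (L (1\<^sub>m ?D)))"
    by (rule mat_trace_smult[of _ ?d]) (rule mult_carrier_mat[of _ _ ?d], simp_all add: c)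
  \<comment> \<open>The transpose moves back to \<open>Z\<close>: it is the transposed
    \<open>Y\<close> whose operator norm is controlled.\<close>
  also have "mat_trace (Z * ptranspose (dA ^ n) (dB ^ n) (L (1\<^sub>m ?D))) =
      mat_trace (ptranspose (dA ^ n) (dB ^ n) Z * L (1\<^sub>m ?D))"
    using mat_trace_ptranspose_mult[OF c(4) ptranspose_carrier, of "L (1\<^sub>m ?D)"]
    by (simp add: ptranspose_ptranspose[OF Lc(2)])
  also have "Re ((1 / 2) ^ m * mat_trace (ptranspose (dA ^ n) (dB ^ n) Z * L (1\<^sub>m ?D))) =
    (1 / 2) ^ m * Re (mat_trace (ptranspose (dA ^ n) (dB ^ n) Z * L (1\<^sub>m ?D)))"
  proof -
    have "(1 / 2) ^ m = complex_of_real ((1 / 2) ^ m)" by simp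
    thus ?thesis by (simp only: Re_complex_of_real times_complex.simps Im_complex_of_real)
  qed
  also have "\<dots> \<le> (1 / 2) ^ m * Re (mat_trace ((of_real ?c ^ n \<cdot>\<^sub>m 1\<^sub>m ?d) * L (1\<^sub>m ?D)))"
  proof (intro mult_left_mono dominated_trace_mult)
    have "dominated (dA * dB) (ptranspose dA dB Y) (of_real ?c \<cdot>\<^sub>m 1\<^sub>m (dA * dB))"
      using dominated_hermitian(2)[OF Y] by (intro dominated_op_norm hermitian_ptranspose) (simp add: psd_def)
    from dominated_btensor_power[OF this, of n]
    show "dominated ?d (ptranspose (dA ^ n) (dB ^ n) Z) (of_real ?c ^ n \<cdot>\<^sub>m 1\<^sub>m ?d)"
      by (simp add: btensor_power_smult_one Z_def ptranspose_btensor_power[OF Yc])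
    show "dominated ?d (L (1\<^sub>m ?D)) (L (1\<^sub>m ?D))"
      by (rule dominated_self[OF ppt_operation_psd[OF L psd_one]])
  qed simp
  also have "(of_real ?c ^ n \<cdot>\<^sub>m 1\<^sub>m ?d) * L (1\<^sub>m ?D) = of_real ?c ^ n \<cdot>\<^sub>m L (1\<^sub>m ?D)"
    using Lc by (subst mult_smult_assoc_mat[of _ ?d ?d _ ?d]) auto
  \<comment> \<open>By trace preservation \<open>L (1\<^sub>m ?D)\<close> has trace
    \<open>2 ^ m * 2 ^ m\<close>, one factor of which cancels \<open>(1 / 2) ^ m\<close>.\<close>
  also have "mat_trace \<dots> = of_real (?c ^ n * 2 ^ m * 2 ^ m)"
    using Lc by (simp add: mat_trace_smult ppt_operation_trace[OF L] mat_trace_one)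
  also have "(1 / 2) ^ m * Re (of_real (?c ^ n * 2 ^ m * 2 ^ m)) = 2 ^ m * ?c ^ n"
    by (simp add: power_divide)
  finally show ?thesis unfolding R_def \<Phi>_def .
qed

section \<open>From bounds for n copies to rates\<close>

lemma le_of_eventually_linear:
  fixes a b c :: real
  assumes "eventually (\<lambda>n. real n * a \<le> real n * b + c) sequentially"
  shows "a \<le> b"
proof (rule ccontr)
  assume "\<not> a \<le> b"
  hence "eventually (\<lambda>n. real n * (a - b) > c) sequentially" by real_asymp
  with assms have "eventually (\<lambda>n. False) sequentially"
    by eventually_elim (simp add: algebra_simps)
  thus False by simp
qed

lemma INF_tendsto_0_eventually_less:
  fixes f :: "nat \<Rightarrow> 'a \<Rightarrow> real"
  assumes "(\<lambda>n. INF x\<in>A n. f n x) \<longlonglongrightarrow> 0" "e > 0" "\<And>n. A n \<noteq> {}"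
  shows "eventually (\<lambda>n. \<exists>x\<in>A n. f n x < e) sequentially"
  using order_tendstoD(2)[OF assms(1,2)]
proof eventually_elim
  case (elim n)
  from cInf_lessD[OF _ elim] show ?case using assms(3) by auto
qed

text \<open>An error eventually below 1/2 is all that is extracted from the limit: the bound then
  compares two exponentials up to a constant factor, and their growth rates give the
  inequality.\<close>

theorem E_D_le_E_W:
  assumes rho: "psd (dA * dB) \<rho>"
  shows "E_D dA dB \<rho> \<le> ereal (E_W dA dB \<rho>)"
  unfolding E_D_def
proof (rule SUP_least)
  let ?d = "dA * dB"
  fix r assume "r \<in> {r. 0 \<le> r \<and> (\<lambda>n. let m = nat \<lfloor>r * real n\<rfloor>
          in INF L \<in> {L. ppt_operation (dA ^ n) (dB ^ n) (2 ^ m) (2 ^ m) L}.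
               trace_norm (L (btensor_power dA dB \<rho> n) - btensor_power 2 2 max_entangled m))
       \<longlonglongrightarrow> 0}"
  hence r: "0 \<le> r" and lim: "(\<lambda>n. INF L \<in> {L. ppt_operation (dA ^ n) (dB ^ n) (2 ^ nat \<lfloor>r * real n\<rfloor>) (2 ^ nat \<lfloor>r * real n\<rfloor>) L}.
               trace_norm (L (btensor_power dA dB \<rho> n) - btensor_power 2 2 max_entangled (nat \<lfloor>r * real n\<rfloor>)))
       \<longlonglongrightarrow> 0" by (auto simp: Let_def)
  have half: "eventually (\<lambda>n. \<exists>L\<in>{L. ppt_operation (dA ^ n) (dB ^ n) (2 ^ nat \<lfloor>r * real n\<rfloor>) (2 ^ nat \<lfloor>r * real n\<rfloor>) L}.
      trace_norm (L (btensor_power dA dB \<rho> n) - btensor_power 2 2 max_entangled (nat \<lfloor>r * real n\<rfloor>)) < 1 / 2) sequentially"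
    by (rule INF_tendsto_0_eventually_less[OF lim]) (use ppt_operation_exists in auto)
  have bound: "r \<le> log 2 (trace_norm (ptranspose dA dB X))"
    if X: "hermitian ?d X" "loewner_le ?d \<rho> X" for X
  proof -
    let ?w = "trace_norm (ptranspose dA dB X)"
    have ev: "eventually (\<lambda>n. 2 powr (r * real n) \<le> 4 * ?w ^ n) sequentially"
      using half
    proof eventually_elim
      case (elim n)
      define m where "m = nat \<lfloor>r * real n\<rfloor>"
      from elim obtain L where L: "ppt_operation (dA ^ n) (dB ^ n) (2 ^ m) (2 ^ m) L"
        "trace_norm (L (btensor_power dA dB \<rho> n) - btensor_power 2 2 max_entangled m) < 1 / 2"
        by (auto simp: m_def)
      have "1 / 2 \<le> ?w ^ n / 2 ^ m"
        using distillation_bound[OF rho X(2,1) L(1)] L(2) by linarith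
      hence "2 ^ m \<le> 2 * ?w ^ n" by (simp add: field_simps)
      \<comment> \<open>Rounding down loses at most one pair, that is a factor 2; the error 1/2
        accounts for the other factor 2.\<close>
      moreover have "r * real n \<le> real m + 1" using r unfolding m_def by linarith
      hence "2 powr (r * real n) \<le> 2 powr (real m + 1)" by simp
      hence "2 powr (r * real n) \<le> 2 * 2 ^ m" by (simp add: powr_add powr_realpow)
      ultimately show ?case by simp
    qed
    have "eventually (\<lambda>n. real n * r \<le> real n * log 2 ?w + 2) sequentially"
      using ev eventually_gt_at_top[of 0]
    proof eventually_elim
      case (elim n)
      \<comment> \<open>The left side of the bound is positive and \<open>n > 0\<close>, so the
        trace norm is nonzero and logarithms may be taken.\<close>
      have "(2::real) powr (r * real n) > 0" by simp
      hence "?w ^ n > 0" using elim(1) by linarith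
      moreover have "?w \<ge> 0" by (rule trace_norm_nonneg[OF hermitian_ptranspose[OF X(1)]])
      ultimately have w: "?w > 0" using elim(2) by (cases "?w = 0") (auto simp: zero_power)
      have "r * real n = log 2 (2 powr (r * real n))" by simp
      also have "\<dots> \<le> log 2 (4 * ?w ^ n)" using elim(1) w by (subst log_le_cancel_iff) auto
      also have "\<dots> = log 2 4 + real n * log 2 ?w" using w by (simp add: log_mult log_nat_power)
      also have "log 2 (4::real) = 2" using log_pow_cancel[of "2::real" 2] by simp
      finally show ?case by (simp add: mult.commute)
    qed
    thus ?thesis by (rule le_of_eventually_linear)
  qed
  \<comment> \<open>\<rho> itself is feasible, so the infimum in \<open>E_W\<close> ranges over a
    nonempty set.\<close>
  have "loewner_le ?d \<rho> \<rho>" using dominated_self[OF rho] by (simp add: dominated_def)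
  hence "r \<le> E_W dA dB \<rho>"
    unfolding E_W_def using rho bound by (intro cInf_greatest) (auto simp: psd_def)
  thus "ereal r \<le> ereal (E_W dA dB \<rho>)" by simp
qed

theorem E_eta_le_E_C:
  assumes rho: "psd (dA * dB) \<rho>" and dims: "dA > 0" "dB > 0"
    and supp: "orth_proj (dA * dB) (supp (dA * dB) \<rho>) = P"
    and P: "psd (dA * dB) P" "loewner_le (dA * dB) P (1\<^sub>m (dA * dB))" "mat_trace (P * \<rho>) = 1"
  shows "ereal (E_eta dA dB \<rho>) \<le> E_C dA dB \<rho>"
  unfolding E_C_def
proof (rule INF_greatest)
  let ?d = "dA * dB"
  fix r assume "r \<in> {r. 0 \<le> r \<and> (\<lambda>n. let m = nat \<lfloor>r * real n\<rfloor>
          in INF L \<in> {L. ppt_operation (2 ^ m) (2 ^ m) (dA ^ n) (dB ^ n) L}.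
               trace_norm (btensor_power dA dB \<rho> n - L (btensor_power 2 2 max_entangled m)))
       \<longlonglongrightarrow> 0}"
  hence r: "0 \<le> r" and lim: "(\<lambda>n. INF L \<in> {L. ppt_operation (2 ^ nat \<lfloor>r * real n\<rfloor>) (2 ^ nat \<lfloor>r * real n\<rfloor>) (dA ^ n) (dB ^ n) L}.
               trace_norm (btensor_power dA dB \<rho> n - L (btensor_power 2 2 max_entangled (nat \<lfloor>r * real n\<rfloor>))))
       \<longlonglongrightarrow> 0" by (auto simp: Let_def)
  have half: "eventually (\<lambda>n. \<exists>L\<in>{L. ppt_operation (2 ^ nat \<lfloor>r * real n\<rfloor>) (2 ^ nat \<lfloor>r * real n\<rfloor>) (dA ^ n) (dB ^ n) L}.
      trace_norm (btensor_power dA dB \<rho> n - L (btensor_power 2 2 max_entangled (nat \<lfloor>r * real n\<rfloor>))) < 1 / 2) sequentially"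
    by (rule INF_tendsto_0_eventually_less[OF lim]) (use ppt_operation_exists dims in auto)
  have bound: "- log 2 (op_norm (ptranspose dA dB Y)) \<le> r"
    if Y: "dominated ?d (ptranspose dA dB P) Y" for Y
  proof -
    let ?c = "op_norm (ptranspose dA dB Y)"
    have ev: "eventually (\<lambda>n. 1 / 2 \<le> 2 powr (r * real n) * ?c ^ n) sequentially"
      using half
    proof eventually_elim
      case (elim n)
      define m where "m = nat \<lfloor>r * real n\<rfloor>"
      from elim obtain L where L: "ppt_operation (2 ^ m) (2 ^ m) (dA ^ n) (dB ^ n) L"
        "trace_norm (btensor_power dA dB \<rho> n - L (btensor_power 2 2 max_entangled m)) < 1 / 2"
        by (auto simp: m_def)
      have "1 / 2 \<le> 2 ^ m * ?c ^ n"
        using cost_bound[OF P(1,2) rho P(3) Y L(1)] L(2) by linarith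
      \<comment> \<open>Here rounding down goes in the favourable direction, so only the factor 1/2
        from the error remains.\<close>
      also have "real m \<le> r * real n" using r unfolding m_def by simp
      hence "2 powr real m \<le> 2 powr (r * real n)" by simp
      hence "2 ^ m * ?c ^ n \<le> 2 powr (r * real n) * ?c ^ n"
        by (intro mult_right_mono) (auto simp: powr_realpow op_norm_nonneg[OF ptranspose_carrier])
      finally show ?case .
    qed
    have "eventually (\<lambda>n. real n * (- log 2 ?c) \<le> real n * r + 1) sequentially"
      using ev eventually_gt_at_top[of 0]
    proof eventually_elim
      case (elim n)
      have "?c \<ge> 0" by (rule op_norm_nonneg[OF ptranspose_carrier])
      with elim have c: "?c > 0" by (cases "?c = 0") (auto simp: zero_power)
      have "- 1 = log 2 (1 / 2 :: real)" by (simp add: log_divide)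
      also have "\<dots> \<le> log 2 (2 powr (r * real n) * ?c ^ n)" using elim(1) c by (subst log_le_cancel_iff) auto
      also have "\<dots> = r * real n + real n * log 2 ?c" using c by (simp add: log_mult log_nat_power)
      finally show ?case by (simp add: mult.commute)
    qed
    thus ?thesis by (rule le_of_eventually_linear)
  qed
  \<comment> \<open>A bound of least trace is feasible, so the supremum in \<open>E_eta\<close>
    ranges over a nonempty set.\<close>
  have "hermitian ?d (ptranspose dA dB P)" using P by (intro hermitian_ptranspose) (simp add: psd_def)
  then obtain K where K: "dominated ?d (ptranspose dA dB P) K" by (rule trace_norm_dominated)
  have "E_eta dA dB \<rho> \<le> r"
    unfolding E_eta_def Let_def supp
  proof (rule cSup_least)
    have "hermitian ?d K" "loewner_le ?d (- K) (ptranspose dA dB P)" "loewner_le ?d (ptranspose dA dB P) K"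
      using K dominated_hermitian(2)[OF K] by (auto simp: dominated_def psd_def)
    thus "{- log 2 (op_norm (ptranspose dA dB Y)) |Y. hermitian ?d Y \<and>
      loewner_le ?d (- Y) (ptranspose dA dB P) \<and> loewner_le ?d (ptranspose dA dB P) Y} \<noteq> {}" by blast
  qed (use bound in \<open>auto simp: dominated_def\<close>)
  thus "ereal (E_eta dA dB \<rho>) \<le> ereal r" by simp
qed

section \<open>Support projections\<close>

lemma inner_vec_cnj:
  fixes v w :: "complex vec"
  assumes "v \<in> carrier_vec d" "w \<in> carrier_vec d"
  shows "v \<bullet>c w = cnj (w \<bullet>c v)"
  by (simp add: inner_vec[OF assms(1)] inner_vec[OF assms(2)] mult.commute)

lemma hermitian_inner:
  assumes A: "hermitian d A" and v: "v \<in> carrier_vec d" and w: "w \<in> carrier_vec d"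
  shows "(A *\<^sub>v v) \<bullet>c w = v \<bullet>c (A *\<^sub>v w)"
proof -
  have Ac: "A \<in> carrier_mat d d" by (rule hermitian_carrier[OF A])
  hence Aw: "A *\<^sub>v w \<in> carrier_vec d" using w by simp
  have "(A *\<^sub>v v) \<bullet>c w = (\<Sum>i<d. \<Sum>j<d. A $$ (i, j) * v $ j * cnj (w $ i))"
    unfolding inner_vec[OF w] by (intro sum.cong refl) (simp only: mult_mat_vec_nth[OF Ac v] lessThan_iff sum_distrib_right)
  also have "\<dots> = (\<Sum>j<d. \<Sum>i<d. A $$ (i, j) * v $ j * cnj (w $ i))" by (rule sum.swap)
  also have "\<dots> = (\<Sum>j<d. v $ j * cnj (\<Sum>i<d. A $$ (j, i) * w $ i))"
    unfolding cnj_sum sum_distrib_left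
    by (intro sum.cong refl) (simp add: hermitian_cnj[OF A] mult_ac)
  also have "\<dots> = v \<bullet>c (A *\<^sub>v w)"
    unfolding inner_vec[OF Aw] by (intro sum.cong refl) (simp only: mult_mat_vec_nth[OF Ac w] lessThan_iff)
  finally show ?thesis .
qed

text \<open>\<open>orth_proj\<close> is a definite description, so uniqueness has to be shown as
  well: two candidates agree on every vector, hence entry by entry on the unit vectors.\<close>

lemma orth_proj_supp:
  assumes P: "hermitian d P" "P * P = P" and A: "A \<in> carrier_mat d d"
    and ker: "mat_kernel A = mat_kernel P"
  shows "orth_proj d (supp d A) = P"
  unfolding orth_proj_def
proof (rule the_equality)
  have Pc: "P \<in> carrier_mat d d" by (rule hermitian_carrier[OF P(1)])
  have kerP: "w \<in> mat_kernel A \<longleftrightarrow> w \<in> carrier_vec d \<and> P *\<^sub>v w = 0\<^sub>v d" for w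
    unfolding ker using Pc by (simp add: mat_kernel_def)
  have 1: "P *\<^sub>v v \<in> supp d A" if v: "v \<in> carrier_vec d" for v
    using Pc v by (auto simp: supp_def kerP hermitian_inner[OF P(1) v])
  have 2: "(v - P *\<^sub>v v) \<bullet>c w = 0" if v: "v \<in> carrier_vec d" and w: "w \<in> supp d A" for v w
  proof -
    have "P *\<^sub>v (v - P *\<^sub>v v) = P *\<^sub>v v - P *\<^sub>v (P *\<^sub>v v)"
      using Pc v by (intro mult_minus_distrib_mat_vec) auto
    also have "P *\<^sub>v (P *\<^sub>v v) = P *\<^sub>v v" using Pc v P(2) by (metis assoc_mult_mat_vec)
    finally have "v - P *\<^sub>v v \<in> mat_kernel A" using Pc v by (simp add: kerP)
    hence "w \<bullet>c (v - P *\<^sub>v v) = 0" using w by (simp add: supp_def)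
    thus ?thesis using w v Pc by (subst inner_vec_cnj[of _ d]) (auto simp: supp_def)
  qed
  show "P \<in> carrier_mat d d \<and> (\<forall>v\<in>carrier_vec d. P *\<^sub>v v \<in> supp d A \<and>
      (\<forall>w\<in>supp d A. (v - P *\<^sub>v v) \<bullet>c w = 0))" using Pc 1 2 by blast
  fix P' assume P': "P' \<in> carrier_mat d d \<and> (\<forall>v\<in>carrier_vec d. P' *\<^sub>v v \<in> supp d A \<and>
      (\<forall>w\<in>supp d A. (v - P' *\<^sub>v v) \<bullet>c w = 0))"
  have Pv: "P' *\<^sub>v v = P *\<^sub>v v" if v: "v \<in> carrier_vec d" for v
  proof -
    \<comment> \<open>\<open>z\<close> lies in the support, and both residuals of \<open>v\<close>
      are orthogonal to the support, so \<open>z\<close> is orthogonal to itself.\<close>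
    define z where "z = P *\<^sub>v v - P' *\<^sub>v v"
    have c: "P *\<^sub>v v \<in> carrier_vec d" "P' *\<^sub>v v \<in> carrier_vec d" "z \<in> carrier_vec d"
      using P' Pc v by (auto simp: z_def)
    have "z \<in> supp d A"
      using 1[OF v] P' v c unfolding z_def
      by (auto simp: supp_def kerP minus_scalar_prod_distrib[of _ d])
    hence "(v - P *\<^sub>v v) \<bullet>c z = 0" "(v - P' *\<^sub>v v) \<bullet>c z = 0" using 2[OF v] P' v by auto
    hence "v \<bullet>c z - (P *\<^sub>v v) \<bullet>c z = 0" "v \<bullet>c z - (P' *\<^sub>v v) \<bullet>c z = 0"
      using c v by (auto simp: minus_scalar_prod_distrib[of _ d])
    hence "(P *\<^sub>v v) \<bullet>c z - (P' *\<^sub>v v) \<bullet>c z = 0" by simp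
    hence "z \<bullet>c z = 0" using c by (subst (1) z_def) (simp add: minus_scalar_prod_distrib[of _ d])
    hence z: "z = 0\<^sub>v d" using conjugate_square_eq_0_vec[OF c(3)] by simp
    have "(P' *\<^sub>v v) $ i = (P *\<^sub>v v) $ i" if "i < d" for i
      using arg_cong[OF z, of "\<lambda>x. x $ i"] carrier_vecD[OF c(1)] carrier_vecD[OF c(2)] that
      unfolding z_def by (simp del: index_mult_mat_vec dim_mult_mat_vec)
    thus ?thesis using carrier_vecD[OF c(1)] carrier_vecD[OF c(2)]
      by (intro eq_vecI) (simp_all del: index_mult_mat_vec dim_mult_mat_vec)
  qed
  show "P' = P"
  proof (rule eq_matI)
    fix i j assume ij: "i < dim_row P" "j < dim_col P"
    have entry: "M $$ (i, j) = (M *\<^sub>v unit_vec d j) $ i" if M: "M \<in> carrier_mat d d" for M :: "complex mat"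
    proof -
      have "(M *\<^sub>v unit_vec d j) $ i = (\<Sum>k<d. M $$ (i, k) * unit_vec d j $ k)"
        using ij Pc by (intro mult_mat_vec_nth[OF M]) auto
      also have "\<dots> = (\<Sum>k<d. if k = j then M $$ (i, j) else 0)"
        using ij Pc by (intro sum.cong refl) (auto simp: unit_vec_def)
      finally show ?thesis using ij Pc by simp
    qed
    show "P' $$ (i, j) = P $$ (i, j)"
      using P' by (simp only: entry[OF Pc] entry[of P'] Pv[OF unit_vec_carrier])
  qed (use Pc P' in auto)
qed

section \<open>General estimates of the two entanglement measures\<close>

text \<open>Comparing the infimum with a member requires a lower bound on all members: the trace
  norm is at least the trace, and the trace of \<open>X\<close> is at least 1, so each logarithm is
  nonnegative.\<close>

lemma E_W_le:
  assumes rho: "psd (dA * dB) \<rho>" and tr: "mat_trace \<rho> = 1"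
    and X: "hermitian (dA * dB) X" "loewner_le (dA * dB) \<rho> X"
  shows "E_W dA dB \<rho> \<le> log 2 (trace_norm (ptranspose dA dB X))"
  unfolding E_W_def
proof (rule cInf_lower)
  let ?d = "dA * dB"
  have "0 \<le> log 2 (trace_norm (ptranspose dA dB X))"
    if X: "hermitian ?d X" "loewner_le ?d \<rho> X" for X
  proof -
    obtain K where K: "dominated ?d (ptranspose dA dB X) K"
      "Re (mat_trace K) = trace_norm (ptranspose dA dB X)"
      by (rule trace_norm_dominated[OF hermitian_ptranspose[OF X(1)]])
    have "1 \<le> Re (mat_trace X)" using dominated_trace[OF dominated_psd_le[OF rho X(2)]] tr by simp
    also have "\<dots> = Re (mat_trace (ptranspose dA dB X))"
      by (simp add: mat_trace_ptranspose[OF hermitian_carrier[OF X(1)]])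
    also have "\<dots> \<le> trace_norm (ptranspose dA dB X)" using dominated_trace[OF K(1)] K(2) by simp
    finally show ?thesis by simp
  qed
  thus "bdd_below {log 2 (trace_norm (ptranspose dA dB X)) |X. hermitian ?d X \<and> loewner_le ?d \<rho> X}"
    by (intro bdd_belowI[of _ 0]) auto
qed (use X in auto)

text \<open>Traces are preserved by the transpose and monotone under two-sided bounds. For
  \<open>P\<close> of positive trace this keeps the norms away from zero and the values in
  \<open>E_eta\<close> bounded above.\<close>

lemma op_norm_ptranspose_ge:
  assumes Y: "dominated (dA * dB) (ptranspose dA dB P) Y" and P: "P \<in> carrier_mat (dA * dB) (dA * dB)"
  shows "Re (mat_trace P) \<le> op_norm (ptranspose dA dB Y) * real (dA * dB)"
proof -
  have Yh: "hermitian (dA * dB) Y" using dominated_hermitian(2)[OF Y] by (simp add: psd_def)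
  have "Re (mat_trace P) \<le> Re (mat_trace Y)"
    using dominated_trace[OF Y] by (simp add: mat_trace_ptranspose[OF P])
  also have "\<dots> = Re (mat_trace (ptranspose dA dB Y))"
    by (simp add: mat_trace_ptranspose[OF hermitian_carrier[OF Yh]])
  also have "\<dots> \<le> Re (mat_trace (of_real (op_norm (ptranspose dA dB Y)) \<cdot>\<^sub>m 1\<^sub>m (dA * dB)))"
    by (rule dominated_trace[OF dominated_op_norm[OF hermitian_ptranspose[OF Yh]]])
  finally show ?thesis by (simp add: mat_trace_smult[of _ "dA * dB"] mat_trace_one)
qed

lemma E_eta_ge:
  assumes supp: "orth_proj (dA * dB) (supp (dA * dB) \<rho>) = P"
    and P: "P \<in> carrier_mat (dA * dB) (dA * dB)" "0 < Re (mat_trace P)"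
    and dims: "dA > 0" "dB > 0"
    and Y: "dominated (dA * dB) (ptranspose dA dB P) Y" and c: "op_norm (ptranspose dA dB Y) \<le> c"
  shows "- log 2 c \<le> E_eta dA dB \<rho>"
proof -
  let ?d = "dA * dB" and ?t = "Re (mat_trace P) / real (dA * dB)"
  have t: "?t > 0" using P dims by simp
  have ge: "?t \<le> op_norm (ptranspose dA dB Y)" if "dominated ?d (ptranspose dA dB P) Y" for Y
    using op_norm_ptranspose_ge[OF that P(1)] dims by (simp add: field_simps)
  have "- log 2 c \<le> - log 2 (op_norm (ptranspose dA dB Y))"
    using ge[OF Y] t c by (simp del: divide_le_eq)
  also have "\<dots> \<le> E_eta dA dB \<rho>"
    unfolding E_eta_def Let_def supp
  proof (rule cSup_upper)
    have "hermitian ?d Y" using dominated_hermitian(2)[OF Y] by (simp add: psd_def)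
    with Y show "- log 2 (op_norm (ptranspose dA dB Y)) \<in> {- log 2 (op_norm (ptranspose dA dB Y)) |Y.
      hermitian ?d Y \<and> loewner_le ?d (- Y) (ptranspose dA dB P) \<and> loewner_le ?d (ptranspose dA dB P) Y}"
      by (auto simp: dominated_def)
    have "- log 2 (op_norm (ptranspose dA dB Y)) \<le> - log 2 ?t" if "dominated ?d (ptranspose dA dB P) Y" for Y
    proof -
      have "log 2 ?t \<le> log 2 (op_norm (ptranspose dA dB Y))"
        using ge[OF that] t by (subst log_le_cancel_iff) linarith+
      thus ?thesis by linarith
    qed
    thus "bdd_above {- log 2 (op_norm (ptranspose dA dB Y)) |Y.
      hermitian ?d Y \<and> loewner_le ?d (- Y) (ptranspose dA dB P) \<and> loewner_le ?d (ptranspose dA dB P) Y}"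
      by (intro bdd_aboveI[of _ "- log 2 ?t"]) (auto simp: dominated_def)
  qed
  finally show ?thesis .
qed

section \<open>The family of states\<close>

lemma less_9_cases:
  "i < 9 \<Longrightarrow> i = 0 \<or> i = 1 \<or> i = 2 \<or> i = 3 \<or> i = 4 \<or> i = 5 \<or> i = 6 \<or> i = 7 \<or> i = (8 :: nat)"
  by auto

lemma lessThan_9: "{..<9::nat} = {0, 1, 2, 3, 4, 5, 6, 7, 8}"
  by auto

text \<open>Coordinates of the two vectors, for \<open>k\<close> equal to 1 or 2: |0k> has index
  \<open>k\<close> and |k0> has index \<open>3 * k\<close>. Real values let the concrete
  computations run over the reals.\<close>

definition psi :: "real \<Rightarrow> nat \<Rightarrow> nat \<Rightarrow> real" where
  "psi \<alpha> k i = (if i = k then sqrt \<alpha> else if i = 3 * k then - sqrt (1 - \<alpha>) else 0)"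

lemma
  assumes "i < 9"
  shows psi1_index: "psi1 \<alpha> $ i = of_real (psi \<alpha> 1 i)"
    and psi2_index: "psi2 \<alpha> $ i = of_real (psi \<alpha> 2 i)"
proof -
  show "psi1 \<alpha> $ i = of_real (psi \<alpha> 1 i)"
    using less_9_cases[OF assms] by (elim disjE) (simp_all add: psi1_def psi_def ket2_def)
  show "psi2 \<alpha> $ i = of_real (psi \<alpha> 2 i)"
    using less_9_cases[OF assms] by (elim disjE) (simp_all add: psi2_def psi_def ket2_def)
qed

definition rho_proj :: "real \<Rightarrow> complex mat" where
  "rho_proj \<alpha> = proj (psi1 \<alpha>) + proj (psi2 \<alpha>)"

lemma rho_eq: "rho \<alpha> = of_real (1 / 2) \<cdot>\<^sub>m rho_proj \<alpha>"
  by (simp add: rho_def rho_proj_def)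

lemma dim_psi [simp]: "dim_vec (psi1 \<alpha>) = 9" "dim_vec (psi2 \<alpha>) = 9"
  by (simp_all add: psi1_def psi2_def ket2_def)

lemma rho_proj_carrier [simp]: "rho_proj \<alpha> \<in> carrier_mat 9 9"
  by (simp add: rho_proj_def proj_def)

lemma rho_proj_index:
  "i < 9 \<Longrightarrow> j < 9 \<Longrightarrow> rho_proj \<alpha> $$ (i, j) = of_real (psi \<alpha> 1 i * psi \<alpha> 1 j + psi \<alpha> 2 i * psi \<alpha> 2 j)"
  by (simp add: rho_proj_def proj_def psi1_index psi2_index)

lemma psd_rho_proj: "psd 9 (rho_proj \<alpha>)"
  by (rule psdI_sum[of _ _ "{1, 2}" "\<lambda>k i. of_real (psi \<alpha> k i)"]) (auto simp: rho_proj_index)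

lemma psi_orthonormal:
  assumes "0 \<le> \<alpha>" "\<alpha> \<le> 1" "k \<in> {1, 2}" "l \<in> {1, 2}"
  shows "(\<Sum>i<9. psi \<alpha> k i * psi \<alpha> l i) = (if k = l then 1 else 0)"
proof -
  have "sqrt \<alpha> * sqrt \<alpha> + sqrt (1 - \<alpha>) * sqrt (1 - \<alpha>) = 1" using assms(1,2) by simp
  thus ?thesis using assms(3,4) by (elim insertE emptyE) (simp_all add: psi_def lessThan_9 del: real_sqrt_mult_self)
qed

lemma rho_proj_idempotent:
  assumes "0 \<le> \<alpha>" "\<alpha> \<le> 1"
  shows "rho_proj \<alpha> * rho_proj \<alpha> = rho_proj \<alpha>"
proof (rule eq_matI)
  fix i j assume "i < dim_row (rho_proj \<alpha>)" "j < dim_col (rho_proj \<alpha>)"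
  hence ij: "i < 9" "j < 9" by (auto simp: rho_proj_def proj_def)
  let ?u = "psi \<alpha> 1" and ?v = "psi \<alpha> 2"
  have "(rho_proj \<alpha> * rho_proj \<alpha>) $$ (i, j) = (\<Sum>c<9. rho_proj \<alpha> $$ (i, c) * rho_proj \<alpha> $$ (c, j))"
    by (rule mult_mat_index) (use ij in auto)
  also have "\<dots> = of_real (\<Sum>c<9. (?u i * ?u c + ?v i * ?v c) * (?u c * ?u j + ?v c * ?v j))"
    unfolding of_real_sum using ij by (intro sum.cong refl) (simp add: rho_proj_index)
  also have "(\<Sum>c<9. (?u i * ?u c + ?v i * ?v c) * (?u c * ?u j + ?v c * ?v j)) =
    ?u i * ?u j * (\<Sum>c<9. ?u c * ?u c) + ?u i * ?v j * (\<Sum>c<9. ?u c * ?v c) +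
    ?v i * ?u j * (\<Sum>c<9. ?v c * ?u c) + ?v i * ?v j * (\<Sum>c<9. ?v c * ?v c)"
    unfolding sum_distrib_left sum.distrib[symmetric] by (intro sum.cong refl) (simp add: algebra_simps)
  also have "\<dots> = ?u i * ?u j + ?v i * ?v j" using assms by (simp add: psi_orthonormal)
  finally show "(rho_proj \<alpha> * rho_proj \<alpha>) $$ (i, j) = rho_proj \<alpha> $$ (i, j)"
    using ij by (simp add: rho_proj_index)
qed (auto simp: rho_proj_def proj_def)

text \<open>The complement \<open>?R\<close> is Hermitian and idempotent, so it equals
  \<open>?R\<close> times its adjoint, a sum of rank-one operators built from its columns.\<close>

lemma rho_proj_le_one:
  assumes \<alpha>: "0 \<le> \<alpha>" "\<alpha> \<le> 1"
  shows "loewner_le 9 (rho_proj \<alpha>) (1\<^sub>m 9)"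
proof -
  let ?P = "rho_proj \<alpha>" and ?R = "1\<^sub>m 9 - rho_proj \<alpha>"
  have Rc: "?R \<in> carrier_mat 9 9" by (simp add: minus_carrier_mat)
  have Rh: "hermitian 9 ?R"
    using psd_one[of 9] psd_rho_proj by (intro hermitian_minus) (auto simp: psd_def)
  have "?R * ?R = ?R * 1\<^sub>m 9 - ?R * ?P" by (rule mult_minus_distrib_mat[OF Rc]) auto
  also have "?R * 1\<^sub>m 9 = ?R" by (rule right_mult_one_mat[OF Rc])
  also have "?R * ?P = 1\<^sub>m 9 * ?P - ?P * ?P" by (rule minus_mult_distrib_mat[of _ 9 9 _ _ 9]) auto
  also have "\<dots> = ?P - ?P"
    unfolding rho_proj_idempotent[OF \<alpha>] by (subst left_mult_one_mat[of _ 9 9]) simp_all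
  also have "?R - (?P - ?P) = ?R" by (intro eq_matI) (auto simp: rho_proj_def proj_def)
  finally have RR: "?R * ?R = ?R" .
  have "psd 9 ?R"
  proof (rule psdI_sum[OF Rc, of "{..<9}" "\<lambda>k a. ?R $$ (a, k)"])
    fix a b :: nat assume ab: "a < 9" "b < 9"
    have "?R $$ (a, b) = (?R * ?R) $$ (a, b)" by (simp only: RR)
    also have "\<dots> = (\<Sum>k<9. ?R $$ (a, k) * ?R $$ (k, b))" by (rule mult_mat_index[OF Rc Rc ab])
    also have "\<dots> = (\<Sum>k<9. ?R $$ (a, k) * cnj (?R $$ (b, k)))"
      using ab by (intro sum.cong refl) (simp only: hermitian_cnj[OF Rh] lessThan_iff)
    finally show "?R $$ (a, b) = (\<Sum>k<9. ?R $$ (a, k) * cnj (?R $$ (b, k)))" .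
  qed simp
  thus ?thesis by (simp add: loewner_le_def)
qed

lemma mat_trace_rho_proj:
  assumes "0 \<le> \<alpha>" "\<alpha> \<le> 1"
  shows "mat_trace (rho_proj \<alpha>) = 2"
proof -
  have "mat_trace (rho_proj \<alpha>) = of_real (\<Sum>i<9. psi \<alpha> 1 i * psi \<alpha> 1 i + psi \<alpha> 2 i * psi \<alpha> 2 i)"
    unfolding mat_trace_def of_real_sum carrier_matD[OF rho_proj_carrier]
    by (intro sum.cong refl) (simp add: rho_proj_index)
  thus ?thesis using assms by (simp add: sum.distrib psi_orthonormal)
qed

lemma psd_rho: "psd 9 (rho \<alpha>)"
  unfolding rho_eq by (intro psd_smult psd_rho_proj) simp

lemma mat_trace_rho:
  assumes "0 \<le> \<alpha>" "\<alpha> \<le> 1"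
  shows "mat_trace (rho \<alpha>) = 1" "mat_trace (rho_proj \<alpha> * rho \<alpha>) = 1"
proof -
  show *: "mat_trace (rho \<alpha>) = 1"
    unfolding rho_eq by (simp add: mat_trace_smult[of _ 9] mat_trace_rho_proj[OF assms])
  have "rho_proj \<alpha> * rho \<alpha> = rho \<alpha>"
    unfolding rho_eq by (subst mult_smult_distrib[of _ 9 9 _ 9]) (simp_all add: rho_proj_idempotent[OF assms])
  thus "mat_trace (rho_proj \<alpha> * rho \<alpha>) = 1" using * by simp
qed

text \<open>\<open>rho\<close> is half of the projection, so both have the same kernel.\<close>

lemma orth_proj_rho:
  assumes "0 \<le> \<alpha>" "\<alpha> \<le> 1"
  shows "orth_proj 9 (supp 9 (rho \<alpha>)) = rho_proj \<alpha>"
proof (rule orth_proj_supp)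
  show "hermitian 9 (rho_proj \<alpha>)" using psd_rho_proj by (simp add: psd_def)
  show "mat_kernel (rho \<alpha>) = mat_kernel (rho_proj \<alpha>)"
  proof -
    have "rho \<alpha> *\<^sub>v v = 0\<^sub>v 9 \<longleftrightarrow> rho_proj \<alpha> *\<^sub>v v = 0\<^sub>v 9" if v: "v \<in> carrier_vec 9" for v
    proof -
      have "rho \<alpha> *\<^sub>v v = of_real (1 / 2) \<cdot>\<^sub>v (rho_proj \<alpha> *\<^sub>v v)"
      proof (rule eq_vecI)
        fix i assume "i < dim_vec (complex_of_real (1 / 2) \<cdot>\<^sub>v (rho_proj \<alpha> *\<^sub>v v))"
        hence i: "i < 9" using carrier_matD[OF rho_proj_carrier[of \<alpha>]] by simp
        have "(rho \<alpha> *\<^sub>v v) $ i = (\<Sum>k<9. rho \<alpha> $$ (i, k) * v $ k)"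
          by (rule mult_mat_vec_nth[OF psd_carrier[OF psd_rho] v i])
        also have "\<dots> = of_real (1 / 2) * (\<Sum>k<9. rho_proj \<alpha> $$ (i, k) * v $ k)"
          unfolding sum_distrib_left rho_eq using i carrier_matD[OF rho_proj_carrier[of \<alpha>]]
          by (intro sum.cong refl) simp
        also have "\<dots> = of_real (1 / 2) * (rho_proj \<alpha> *\<^sub>v v) $ i"
          by (simp only: mult_mat_vec_nth[OF rho_proj_carrier v i])
        finally show "(rho \<alpha> *\<^sub>v v) $ i = (complex_of_real (1 / 2) \<cdot>\<^sub>v (rho_proj \<alpha> *\<^sub>v v)) $ i"
          using i carrier_matD[OF rho_proj_carrier[of \<alpha>]] by (simp del: index_mult_mat_vec)
      qed (use carrier_matD[OF psd_carrier[OF psd_rho]] carrier_matD[OF rho_proj_carrier[of \<alpha>]] in auto)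
      thus ?thesis
        using carrier_matD[OF rho_proj_carrier[of \<alpha>]]
        by (auto simp: vec_eq_iff simp del: index_mult_mat_vec)
    qed
    moreover have "dim_row (rho \<alpha>) = 9" "dim_col (rho \<alpha>) = 9"
      using psd_carrier[OF psd_rho] by auto
    ultimately show ?thesis
      using carrier_matD[OF rho_proj_carrier[of \<alpha>]] by (auto simp: mat_kernel_def)
  qed
qed (use assms psd_carrier[OF psd_rho] in \<open>auto simp: rho_proj_idempotent\<close>)

text \<open>
  With \<open>s = sqrt (\<alpha> * (1 - \<alpha>))\<close>, the partial transpose of the support projection is diagonal with
  entries \<open>\<alpha>\<close>, \<open>1 - \<alpha>\<close> apart from the block \<open>- s (|00\<rangle>(\<langle>11| + \<langle>22|) + h.c.)\<close>. This block is
  dominated by \<open>a |00\<rangle>\<langle>00| + (b / 2) (|11\<rangle> + |22\<rangle>)(\<langle>11| + \<langle>22|)\<close> as soon as \<open>a * b \<ge> 2 s\<^sup>2\<close>.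
  Equal \<open>a\<close> and \<open>b\<close> minimise the trace of the bound, while \<open>a = 1 - \<alpha>\<close>, \<open>b = 2 \<alpha>\<close> keeps the operator
  norm of its partial transpose at \<open>1 - \<alpha>\<close>.
\<close>

definition proj_pt :: "real \<Rightarrow> nat \<Rightarrow> nat \<Rightarrow> real" where
  "proj_pt \<alpha> i j =
    (if i = j \<and> i \<in> {1, 2} then \<alpha> else if i = j \<and> i \<in> {3, 6} then 1 - \<alpha>
     else if i = 0 \<and> j \<in> {4, 8} \<or> j = 0 \<and> i \<in> {4, 8} then - sqrt \<alpha> * sqrt (1 - \<alpha>) else 0)"

definition proj_pt_bound :: "real \<Rightarrow> real \<Rightarrow> real \<Rightarrow> nat \<Rightarrow> nat \<Rightarrow> real" where
  "proj_pt_bound \<alpha> a b i j =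
    (if i = j \<and> i \<in> {1, 2} then \<alpha> else if i = j \<and> i \<in> {3, 6} then 1 - \<alpha>
     else if i = 0 \<and> j = 0 then a else if i \<in> {4, 8} \<and> j \<in> {4, 8} then b / 2 else 0)"

definition bound_mat :: "real \<Rightarrow> real \<Rightarrow> real \<Rightarrow> complex mat" where
  "bound_mat \<alpha> a b = mat 9 9 (\<lambda>(i, j). of_real (proj_pt_bound \<alpha> a b i j))"

lemma ptranspose_rho_proj_index:
  assumes "0 \<le> \<alpha>" "\<alpha> \<le> 1" "i < 9" "j < 9"
  shows "ptranspose 3 3 (rho_proj \<alpha>) $$ (i, j) = of_real (proj_pt \<alpha> i j)"
proof -
  have "ptranspose 3 3 (rho_proj \<alpha>) $$ (i, j) =
     rho_proj \<alpha> $$ (i div 3 * 3 + j mod 3, j div 3 * 3 + i mod 3)"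
    using assms by (simp add: ptranspose_index)
  also have "\<dots> = of_real (psi \<alpha> 1 (i div 3 * 3 + j mod 3) * psi \<alpha> 1 (j div 3 * 3 + i mod 3)
    + psi \<alpha> 2 (i div 3 * 3 + j mod 3) * psi \<alpha> 2 (j div 3 * 3 + i mod 3))"
    using ptranspose_index_less[of i 3 3 j] ptranspose_index_less[of j 3 3 i] assms
    by (intro rho_proj_index) auto
  also have "\<dots> = of_real (proj_pt \<alpha> i j)"
    using less_9_cases[OF assms(3)] less_9_cases[OF assms(4)] assms(1,2)
    by (elim disjE) (simp_all add: psi_def proj_pt_def)
  finally show ?thesis .
qed

text \<open>The sign \<open>t\<close> treats the two sides of the bound together: it only flips the
  off-diagonal entries of the block, which does not affect its positivity.\<close>

lemma psd_bound:
  assumes \<alpha>: "0 \<le> \<alpha>" "\<alpha> \<le> 1" and a: "a > 0" and ab: "2 * \<alpha> * (1 - \<alpha>) \<le> a * b"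
    and t: "t = 1 \<or> t = -1"
  shows "psd 9 (mat 9 9 (\<lambda>(i, j). complex_of_real (proj_pt_bound \<alpha> a b i j + t * proj_pt \<alpha> i j)))"
proof -
  define s where "s = sqrt \<alpha> * sqrt (1 - \<alpha>)"
  have s2: "s * s = \<alpha> * (1 - \<alpha>)" unfolding s_def using \<alpha> by (simp add: mult_ac flip: real_sqrt_mult)
  \<comment> \<open>Completing the square on the indices 0, 4, 8: weight \<open>a\<close> on |00> -
    c (|11> + |22>) accounts for the first row and column, leaving weight \<open>e\<close> on |11> +
    |22>. The condition on \<open>a * b\<close> says that \<open>e\<close> is nonnegative.\<close>
  define c where "c = t * s / a"
  define e where "e = b / 2 - s * s / a"
  \<comment> \<open>Label 0 stands for the completed square and 4 for |11> + |22>; the others are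
    basis indices. There the bound and the transpose agree, so the weights double for
    \<open>t = 1\<close> and vanish for \<open>t = -1\<close>.\<close>
  define w where "w k = (if k = 0 then a else if k = 4 then e
    else if k \<in> {1, 2} then (1 + t) * \<alpha> else (1 + t) * (1 - \<alpha>))" for k :: nat
  define f where "f k i = (if i = k then 1 else if k = 0 \<and> i \<in> {4, 8} then - c
    else if k = 4 \<and> i = 8 then 1 else 0)" for k i :: nat
  have "0 \<le> e" unfolding e_def s2 using a ab by (simp add: field_simps)
  hence w: "0 \<le> w k" for k using \<alpha> a t by (auto simp: w_def)
  have ac: "t * (sqrt \<alpha> * sqrt (1 - \<alpha>)) = a * c" using a by (simp add: c_def s_def)
  have "t * t = 1" using t by auto
  hence key: "a * (c * c) + e = b / 2" unfolding c_def e_def using a by (simp add: field_simps)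
  have entry: "proj_pt_bound \<alpha> a b i j + t * proj_pt \<alpha> i j = (\<Sum>k\<in>{0, 1, 2, 3, 4, 6}. w k * f k i * f k j)"
    if "i < 9" "j < 9" for i j
  proof -
    have "(\<Sum>k\<in>{0, 1, 2, 3, 4, 6}. w k * f k i * f k j) =
      w 0 * f 0 i * f 0 j + w 1 * f 1 i * f 1 j + w 2 * f 2 i * f 2 j +
      w 3 * f 3 i * f 3 j + w 4 * f 4 i * f 4 j + w 6 * f 6 i * f 6 j" by simp
    also have "\<dots> = proj_pt_bound \<alpha> a b i j + t * proj_pt \<alpha> i j"
      using less_9_cases[OF that(1)] less_9_cases[OF that(2)]
      by (elim disjE; simp only:)
        (simp_all add: w_def f_def proj_pt_def proj_pt_bound_def ac key mult.assoc distrib_right)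
    finally show ?thesis by (rule sym)
  qed
  show ?thesis
  proof (rule psdI_weighted_sum[of _ _ "{0, 1, 2, 3, 4, 6}" w "\<lambda>k i. of_real (f k i)"])
    fix i j :: nat assume ij: "i < 9" "j < 9"
    show "mat 9 9 (\<lambda>(i, j). complex_of_real (proj_pt_bound \<alpha> a b i j + t * proj_pt \<alpha> i j)) $$ (i, j) =
      (\<Sum>k\<in>{0, 1, 2, 3, 4, 6}. of_real (w k) * of_real (f k i) * cnj (of_real (f k j)))"
      using ij by (simp only: index_mat split_conv entry[OF ij] of_real_sum of_real_mult complex_cnj_complex_of_real)
  qed (use w in auto)
qed

lemma dominated_bound_mat:
  assumes \<alpha>: "0 \<le> \<alpha>" "\<alpha> \<le> 1" and "a > 0" "2 * \<alpha> * (1 - \<alpha>) \<le> a * b"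
  shows "dominated 9 (ptranspose 3 3 (rho_proj \<alpha>)) (bound_mat \<alpha> a b)"
proof -
  have c: "ptranspose 3 3 (rho_proj \<alpha>) \<in> carrier_mat 9 9"
    using ptranspose_carrier[of 3 3 "rho_proj \<alpha>"] by simp
  have "bound_mat \<alpha> a b - ptranspose 3 3 (rho_proj \<alpha>) =
    mat 9 9 (\<lambda>(i, j). complex_of_real (proj_pt_bound \<alpha> a b i j + (-1) * proj_pt \<alpha> i j))"
    "bound_mat \<alpha> a b + ptranspose 3 3 (rho_proj \<alpha>) =
    mat 9 9 (\<lambda>(i, j). complex_of_real (proj_pt_bound \<alpha> a b i j + 1 * proj_pt \<alpha> i j))"
    using c by (auto intro!: eq_matI simp: bound_mat_def ptranspose_rho_proj_index[OF \<alpha>])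
  thus ?thesis
    unfolding dominated_iff using c psd_bound[OF assms, of "-1"] psd_bound[OF assms, of 1]
    by (auto simp: bound_mat_def)
qed

text \<open>The transpose moves the entries \<open>b / 2 = \<alpha>\<close> that couple |11> and
  |22> to the pair |12>, |21>. What results is a permutation matrix with weights \<alpha> and 1 -
  \<alpha>, the latter being the larger for \<alpha> up to 1/2.\<close>

lemma op_norm_bound_mat:
  assumes \<alpha>: "0 \<le> \<alpha>" "\<alpha> \<le> 1 / 2"
  shows "op_norm (ptranspose 3 3 (bound_mat \<alpha> (1 - \<alpha>) (2 * \<alpha>))) \<le> 1 - \<alpha>"
proof (rule op_norm_le)
  let ?Y = "ptranspose 3 3 (bound_mat \<alpha> (1 - \<alpha>) (2 * \<alpha>))"
  have Yc: "?Y \<in> carrier_mat 9 9" using ptranspose_carrier[of 3 3] by simp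
  define \<sigma> where "\<sigma> i = (if i = 5 then 7 else if i = 7 then 5 else i)" for i :: nat
  define w where "w i = (if i \<in> {0, 3, 6} then 1 - \<alpha> else \<alpha>)" for i :: nat
  have Y: "?Y $$ (i, j) = (if j = \<sigma> i then of_real (w i) else 0)" if "i < 9" "j < 9" for i j
  proof -
    have "?Y $$ (i, j) = of_real (proj_pt_bound \<alpha> (1 - \<alpha>) (2 * \<alpha>)
        (i div 3 * 3 + j mod 3) (j div 3 * 3 + i mod 3))"
      using that ptranspose_index_less[of i 3 3 j] ptranspose_index_less[of j 3 3 i]
      by (simp add: ptranspose_index bound_mat_def)
    also have "\<dots> = (if j = \<sigma> i then of_real (w i) else 0)"
      using less_9_cases[OF that(1)] less_9_cases[OF that(2)]
      by (elim disjE) (simp_all add: proj_pt_bound_def \<sigma>_def w_def)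
    finally show ?thesis .
  qed
  fix v assume "v \<in> carrier_vec (dim_col ?Y)" "vnorm v \<le> 1"
  hence v: "v \<in> carrier_vec 9" "vnorm v \<le> 1" using Yc by auto
  have Yv: "(?Y *\<^sub>v v) $ i = of_real (w i) * v $ \<sigma> i" if i: "i < 9" for i
  proof -
    have "(?Y *\<^sub>v v) $ i = (\<Sum>j<9. ?Y $$ (i, j) * v $ j)" by (rule mult_mat_vec_nth[OF Yc v(1) i])
    also have "\<dots> = (\<Sum>j<9. if j = \<sigma> i then of_real (w i) * v $ \<sigma> i else 0)"
      using i by (intro sum.cong refl) (simp add: Y)
    also have "\<dots> = of_real (w i) * v $ \<sigma> i" using i by (simp add: \<sigma>_def)
    finally show ?thesis .
  qed
  have "vnorm (?Y *\<^sub>v v) = sqrt (\<Sum>i<9. (w i)\<^sup>2 * (cmod (v $ \<sigma> i))\<^sup>2)"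
    using Yc v by (subst vnorm_eq[of _ 9]) (auto simp del: index_mult_mat_vec simp: Yv norm_mult power_mult_distrib)
  also have "\<dots> \<le> sqrt (\<Sum>i<9. (1 - \<alpha>)\<^sup>2 * (cmod (v $ \<sigma> i))\<^sup>2)"
    using \<alpha> by (intro real_sqrt_le_mono sum_mono mult_right_mono power_mono) (auto simp: w_def)
  also have "\<dots> = (1 - \<alpha>) * sqrt (\<Sum>i<9. (cmod (v $ \<sigma> i))\<^sup>2)"
    using \<alpha> by (simp add: real_sqrt_mult flip: sum_distrib_left)
  also have "(\<Sum>i<9. (cmod (v $ \<sigma> i))\<^sup>2) = (\<Sum>i<9. (cmod (v $ i))\<^sup>2)"
    by (simp add: lessThan_9 \<sigma>_def)
  also have "sqrt \<dots> = vnorm v" using v by (simp add: vnorm_eq[of _ 9])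
  also have "(1 - \<alpha>) * vnorm v \<le> (1 - \<alpha>) * 1" using v \<alpha> by (intro mult_left_mono) auto
  finally show "vnorm (?Y *\<^sub>v v) \<le> 1 - \<alpha>" by simp
qed

lemma dominated_smult:
  assumes "dominated d A Y" "r \<ge> 0"
  shows "dominated d (of_real r \<cdot>\<^sub>m A) (of_real r \<cdot>\<^sub>m Y)"
proof -
  have c: "A \<in> carrier_mat d d" "Y \<in> carrier_mat d d" using assms by (auto simp: dominated_iff)
  have "of_real r \<cdot>\<^sub>m Y - of_real r \<cdot>\<^sub>m A = of_real r \<cdot>\<^sub>m (Y - A)"
    "of_real r \<cdot>\<^sub>m Y + of_real r \<cdot>\<^sub>m A = of_real r \<cdot>\<^sub>m (Y + A)"
    using c by (auto intro!: eq_matI simp: algebra_simps)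
  thus ?thesis using assms by (auto simp: dominated_iff intro: psd_smult)
qed

text \<open>The trace of the bound is 2 from the diagonal outside the block plus
  \<open>2 * ?a\<close> from the block; the factor 1/2 in \<open>rho\<close> halves it.\<close>

lemma trace_norm_ptranspose_rho:
  assumes \<alpha>: "0 < \<alpha>" "\<alpha> < 1"
  shows "trace_norm (ptranspose 3 3 (rho \<alpha>)) \<le> 1 + sqrt (2 * \<alpha> * (1 - \<alpha>))"
proof -
  let ?a = "sqrt (2 * \<alpha> * (1 - \<alpha>))"
  have a: "?a > 0" using \<alpha> by simp
  have "dominated 9 (ptranspose 3 3 (rho_proj \<alpha>)) (bound_mat \<alpha> ?a ?a)"
    by (rule dominated_bound_mat) (use \<alpha> a in auto)
  from dominated_smult[OF this, of "1 / 2"]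
  have "dominated 9 (ptranspose 3 3 (rho \<alpha>)) (of_real (1 / 2) \<cdot>\<^sub>m bound_mat \<alpha> ?a ?a)"
    by (simp add: rho_eq ptranspose_smult)
  from trace_norm_le[OF this]
  have "trace_norm (ptranspose 3 3 (rho \<alpha>)) \<le> Re (mat_trace (of_real (1 / 2) \<cdot>\<^sub>m bound_mat \<alpha> ?a ?a))" .
  also have "mat_trace (of_real (1 / 2) \<cdot>\<^sub>m bound_mat \<alpha> ?a ?a) =
    of_real (1 / 2) * (\<Sum>i<9. of_real (proj_pt_bound \<alpha> ?a ?a i i))"
    by (subst mat_trace_smult[of _ 9]) (simp_all add: bound_mat_def mat_trace_def)
  also have "(\<Sum>i<9. complex_of_real (proj_pt_bound \<alpha> ?a ?a i i)) = of_real (2 + 2 * ?a)"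
    by (simp add: lessThan_9 proj_pt_bound_def)
  also have "of_real (1 / 2) * complex_of_real (2 + 2 * ?a) = of_real (1 + ?a)"
    unfolding of_real_mult[symmetric] by (simp add: field_simps)
  finally show ?thesis by simp
qed

theorem mainTheorem10:
  fixes \<alpha> :: real
  assumes "0.42 \<le> \<alpha>" and "\<alpha> \<le> 0.5"
  shows "E_D 3 3 (rho \<alpha>) \<le> ereal (E_W 3 3 (rho \<alpha>))
    \<and> E_W 3 3 (rho \<alpha>) < E_eta 3 3 (rho \<alpha>)
    \<and> ereal (E_eta 3 3 (rho \<alpha>)) \<le> E_C 3 3 (rho \<alpha>)"
proof (intro conjI)
  have \<alpha>: "0 \<le> \<alpha>" "\<alpha> \<le> 1" "0 < \<alpha>" "\<alpha> < 1" "\<alpha> \<le> 1 / 2" using assms by auto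
  have rho: "psd (3 * 3) (rho \<alpha>)" using psd_rho by simp
  have supp: "orth_proj (3 * 3) (supp (3 * 3) (rho \<alpha>)) = rho_proj \<alpha>"
    using orth_proj_rho[OF \<alpha>(1,2)] by simp
  show "E_D 3 3 (rho \<alpha>) \<le> ereal (E_W 3 3 (rho \<alpha>))" by (rule E_D_le_E_W[OF rho])
  show "ereal (E_eta 3 3 (rho \<alpha>)) \<le> E_C 3 3 (rho \<alpha>)"
    by (rule E_eta_le_E_C[OF rho _ _ supp])
      (use psd_rho_proj rho_proj_le_one[OF \<alpha>(1,2)] mat_trace_rho[OF \<alpha>(1,2)] in auto)
  let ?a = "sqrt (2 * \<alpha> * (1 - \<alpha>))"
  \<comment> \<open>Keeps the argument of the logarithm positive, as monotonicity requires.\<close>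
  have tn: "1 \<le> trace_norm (ptranspose 3 3 (rho \<alpha>))"
  proof -
    have h: "hermitian (3 * 3) (rho \<alpha>)" using rho by (simp add: psd_def)
    obtain K where K: "dominated (3 * 3) (ptranspose 3 3 (rho \<alpha>)) K"
      "Re (mat_trace K) = trace_norm (ptranspose 3 3 (rho \<alpha>))"
      by (rule trace_norm_dominated[OF hermitian_ptranspose[OF h]])
    show ?thesis using dominated_trace[OF K(1)] K(2)
      by (simp add: mat_trace_ptranspose[OF hermitian_carrier[OF h]] mat_trace_rho[OF \<alpha>(1,2)])
  qed
  have "E_W 3 3 (rho \<alpha>) \<le> log 2 (trace_norm (ptranspose 3 3 (rho \<alpha>)))"
    using rho dominated_self[OF rho] mat_trace_rho[OF \<alpha>(1,2)]
    by (intro E_W_le) (auto simp: psd_def dominated_def)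
  also have "\<dots> \<le> log 2 (1 + ?a)"
    using trace_norm_ptranspose_rho[OF \<alpha>(3,4)] tn by (subst log_le_cancel_iff) auto
  also have "\<dots> < - log 2 (1 - \<alpha>)"
  proof -
    \<comment> \<open>Here 0.58 is 1 - 0.42, and twice its cube is about 0.39, below 0.42.\<close>
    have "(1 - \<alpha>) ^ 3 \<le> 0.58 ^ 3" using assms by (intro power_mono) auto
    hence "2 * (1 - \<alpha>) ^ 3 < \<alpha>" using assms(1) by (simp add: power3_eq_cube)
    \<comment> \<open>Multiplied by \<alpha>, the cubic inequality compares two squares, and taking
      roots yields (1 + ?a) (1 - \<alpha>) < 1.\<close>
    hence "\<alpha> * (2 * (1 - \<alpha>) ^ 3) < \<alpha> * \<alpha>" using \<alpha> by (intro mult_strict_left_mono)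
    hence "(?a * (1 - \<alpha>))\<^sup>2 < \<alpha>\<^sup>2"
      using \<alpha> by (simp add: power_mult_distrib power2_eq_square power3_eq_cube mult_ac)
    hence "?a * (1 - \<alpha>) < \<alpha>" by (rule power2_less_imp_less) (rule \<alpha>)
    hence "(1 + ?a) * (1 - \<alpha>) < 1" by (simp add: algebra_simps)
    moreover have "1 + ?a > 0" using \<alpha> by (intro add_pos_nonneg) auto
    ultimately have "log 2 ((1 + ?a) * (1 - \<alpha>)) < log 2 1"
      using \<alpha> by (subst log_less_cancel_iff) auto
    thus ?thesis using \<open>1 + ?a > 0\<close> \<alpha> by (simp add: log_mult)
  qed
  also have "\<dots> \<le> E_eta 3 3 (rho \<alpha>)"
  proof (rule E_eta_ge[OF supp])
    \<comment> \<open>This choice meets the condition on \<open>a * b\<close> with equality.\<close>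
    show "dominated (3 * 3) (ptranspose 3 3 (rho_proj \<alpha>)) (bound_mat \<alpha> (1 - \<alpha>) (2 * \<alpha>))"
      using dominated_bound_mat[OF \<alpha>(1,2), of "1 - \<alpha>" "2 * \<alpha>"] \<alpha> by (simp add: mult_ac)
    show "op_norm (ptranspose 3 3 (bound_mat \<alpha> (1 - \<alpha>) (2 * \<alpha>))) \<le> 1 - \<alpha>"
      by (rule op_norm_bound_mat[OF \<alpha>(1,5)])
  qed (use mat_trace_rho_proj[OF \<alpha>(1,2)] in auto)
  finally show "E_W 3 3 (rho \<alpha>) < E_eta 3 3 (rho \<alpha>)" .
qed

end
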